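(* Let $j_1,j_2,j_3\in\{0,\tfrac12,1,\tfrac32,\dots\}$. Then the algebra homomorphism $\phi:AW(3)\to\mathcal{C}_{j_1,j_2,j_3}$ determined by $\phi(\alpha_i)=C_i$ ($i=1,2,3$), $\phi(A)=C_{12}$, $\phi(B)=C_{23}$, $\phi(K)=C_{123}$ is surjective.
   Context: Throughout, $q\in\mathbb{C}$ is nonzero and not a root of unity, a square root $q^{1/2}$ is fixed so that $q^m$ makes sense for half-integers $m$, and all algebras are unital associative algebras over $\mathbb{C}$. The quantum algebra $U_q(\mathfrak{sl}_2)$ is generated by $E$, $F$ and the invertible element $q^H$ with relations $q^HE=qEq^H$, $q^HF=q^{-1}Fq^H$, $[E,F]=\frac{q^{2H}-q^{-2H}}{q-q^{-1}}$. Its central Casimir element is $\Gamma=(q-q^{-1})^2FE+q\,q^{2H}+q^{-1}q^{-2H}$. The comultiplication $\Delta$ is the algebra homomorphism with $\Delta(E)=E\otimes q^{-H}+q^H\otimes E$, $\Delta(F)=F\otimes q^{-H}+q^H\otimes F$, $\Delta(q^H)=q^H\otimes q^H$; it is coassociative, and $\Delta^{(2)}=(\Delta\otimes\mathrm{id})\Delta=(\mathrm{id}\otimes\Delta)\Delta$. For $j\in\{0,\tfrac12,1,\dots\}$, $M_j$ denotes the spin-$j$ representation, i.e. the irreducible representation of dimension $2j+1$ generated by a vector $v$ with $Ev=0$, $q^Hv=q^jv$, and $\pi_j:U_q(\mathfrak{sl}_2)\to\mathrm{End}(M_j)$ is the representation map. One has $\pi_j(\Gamma)=\chi_j\,\mathrm{Id}$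 with $\chi_j=q^{2j+1}+q^{-2j-1}$. Write $\pi_{j_1,j_2,j_3}=\pi_{j_1}\otimes\pi_{j_2}\otimes\pi_{j_3}$. The centralizer is $$\mathcal{C}_{j_1,j_2,j_3}=\{m\in\mathrm{End}(M_{j_1}\otimes M_{j_2}\otimes M_{j_3}) : [\pi_{j_1,j_2,j_3}(\Delta^{(2)}(x)),m]=0\ \ \forall x\in U_q(\mathfrak{sl}_2)\}.$$ It contains the images under $\pi_{j_1,j_2,j_3}$: $C_1,C_2,C_3$ of $\Gamma\otimes1\otimes1$, $1\otimes\Gamma\otimes1$, $1\otimes1\otimes\Gamma$ respectively (so $C_i=\chi_{j_i}\mathrm{Id}$), $C_{12}$ of $\Delta(\Gamma)\otimes1$, $C_{23}$ of $1\otimes\Delta(\Gamma)$, and $C_{123}$ of $\Delta^{(2)}(\Gamma)$. With $[X,Y]_q=qXY-q^{-1}YX$, the centrally extended Askey--Wilson algebra $AW(3)$ is the algebra generated by $A,B,D$ and central elements $\alpha_1,\alpha_2,\alpha_3,K$ with defining relations $$A+\frac{[B,D]_q}{q^2-q^{-2}}=\frac{\alpha_1\alpha_2+\alpha_3K}{q+q^{-1}},\quad B+\frac{[D,A]_q}{q^2-q^{-2}}=\frac{\alpha_2\alpha_3+\alpha_1K}{q+q^{-1}},\quad D+\frac{[A,B]_q}{q^2-q^{-2}}=\frac{\alpha_1\alpha_3+\alpha_2K}{q+q^{-1}}.$$ (The last relation expresses $D$ through the other generators, so the listed images determine $\phi$.) *)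

theory Defs
  imports
    "HOL-Analysis.Cartesian_Space"
    "HOL-Library.Poly_Mapping"
    "HOL-Algebra.QuotRing"
    "HOL-Algebra.Module"
begin

text \<open>
  Associative unital complex algebras are records of type \<open>(complex, 'a) module\<close>: a (not necessarily
  commutative) ring together with a scalar multiplication. The locale \<open>algebra\<close> of the library is
  not used because it requires commutativity.
\<close>

definition alg_hom ::
  "(complex, 'a) module \<Rightarrow> (complex, 'b) module \<Rightarrow> ('a \<Rightarrow> 'b) set" where
  "alg_hom A B =
    {h \<in> ring_hom A B. \<forall>c. \<forall>x\<in>carrier A. h (c \<odot>\<^bsub>A\<^esub> x) = c \<odot>\<^bsub>B\<^esub> h x}"

section \<open>Monoid algebras, quotients and presentations\<close>

definition monoid_algebra :: "('a, 'm) monoid_scheme \<Rightarrow> (complex, 'a \<Rightarrow>\<^sub>0 complex) module" where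
  "monoid_algebra M =
    \<lparr>carrier = {f. Poly_Mapping.keys f \<subseteq> carrier M},
     mult = (\<lambda>f g. \<Sum>x\<in>Poly_Mapping.keys f. \<Sum>y\<in>Poly_Mapping.keys g.
       Poly_Mapping.single (x \<otimes>\<^bsub>M\<^esub> y) (Poly_Mapping.lookup f x * Poly_Mapping.lookup g y)),
     one = Poly_Mapping.single \<one>\<^bsub>M\<^esub> 1,
     zero = 0,
     add = (+),
     smult = (\<lambda>c f. Poly_Mapping.map ((*) c) f)\<rparr>"

definition lin_ext :: "(complex, 'b) module \<Rightarrow> ('a \<Rightarrow> 'b) \<Rightarrow> ('a \<Rightarrow>\<^sub>0 complex) \<Rightarrow> 'b" where
  "lin_ext B h f = (\<Oplus>\<^bsub>B\<^esub>x\<in>Poly_Mapping.keys f. Poly_Mapping.lookup f x \<odot>\<^bsub>B\<^esub> h x)"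

text \<open>
  Defining relations are given as pairs of a left-hand and a right-hand side.
  The library's \<open>ideal\<close>, hence \<open>Idl\<close>, is two-sided, and its \<open>Quot\<close> applies to noncommutative rings.
\<close>

definition rel_ideal :: "(complex, 'a) module \<Rightarrow> ('a \<times> 'a) set \<Rightarrow> 'a set" where
  "rel_ideal A R = Idl\<^bsub>A\<^esub> {l \<ominus>\<^bsub>A\<^esub> r | l r. (l, r) \<in> R}"

definition quot_class :: "(complex, 'a) module \<Rightarrow> ('a \<times> 'a) set \<Rightarrow> 'a \<Rightarrow> 'a set" where
  "quot_class A R x = rel_ideal A R +>\<^bsub>A\<^esub> x"

definition quot_algebra ::
  "(complex, 'a) module \<Rightarrow> ('a \<times> 'a) set \<Rightarrow> (complex, 'a set) module" where
  "quot_algebra A R = ring.extend (A Quot rel_ideal A R)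
    (module.fields (\<lambda>c X. \<Union>x\<in>X. quot_class A R (c \<odot>\<^bsub>A\<^esub> x)))"

definition free_algebra :: "(complex, 'g list \<Rightarrow>\<^sub>0 complex) module" where
  "free_algebra = monoid_algebra \<lparr>carrier = UNIV, mult = (@), one = []\<rparr>"

definition gen :: "'g \<Rightarrow> ('g list \<Rightarrow>\<^sub>0 complex)" where
  "gen g = Poly_Mapping.single [g] 1"

text \<open>
  The map induced on a presented algebra by an assignment \<open>\<phi>\<close> of its generators: every
  representative of a class is evaluated at \<open>\<phi>\<close>. It is meaningful only if \<open>\<phi>\<close> respects the relations.
\<close>

definition presented_lift ::
  "(complex, 'b) module \<Rightarrow> ('g \<Rightarrow> 'b) \<Rightarrow> ('g list \<Rightarrow>\<^sub>0 complex) set \<Rightarrow> 'b" where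
  "presented_lift B \<phi> X =
    the_elem (lin_ext B (\<lambda>w. foldr (\<lambda>g y. \<phi> g \<otimes>\<^bsub>B\<^esub> y) w \<one>\<^bsub>B\<^esub>) ` X)"

section \<open>Tensor products of algebras\<close>

text \<open>
  The formal linear combinations of pairs, multiplied componentwise, modulo bilinearity.
  The two-sided ideal generated by the bilinearity relators coincides with their linear span,
  because multiplying a relator by a pair on either side gives a relator again.
\<close>

definition pair :: "'a \<Rightarrow> 'b \<Rightarrow> ('a \<times> 'b \<Rightarrow>\<^sub>0 complex)" where
  "pair a b = Poly_Mapping.single (a, b) 1"

definition bilinear_rels ::
  "(complex, 'a) module \<Rightarrow> (complex, 'b) module \<Rightarrow>
   (('a \<times> 'b \<Rightarrow>\<^sub>0 complex) \<times> ('a \<times> 'b \<Rightarrow>\<^sub>0 complex)) set" where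
  "bilinear_rels A B =
     {(pair (a \<oplus>\<^bsub>A\<^esub> a') b, pair a b + pair a' b) | a a' b.
        a \<in> carrier A \<and> a' \<in> carrier A \<and> b \<in> carrier B} \<union>
     {(pair a (b \<oplus>\<^bsub>B\<^esub> b'), pair a b + pair a b') | a b b'.
        a \<in> carrier A \<and> b \<in> carrier B \<and> b' \<in> carrier B} \<union>
     {(pair (c \<odot>\<^bsub>A\<^esub> a) b, Poly_Mapping.single (a, b) c) | c a b.
        a \<in> carrier A \<and> b \<in> carrier B} \<union>
     {(pair a (c \<odot>\<^bsub>B\<^esub> b), Poly_Mapping.single (a, b) c) | c a b.
        a \<in> carrier A \<and> b \<in> carrier B}"

type_synonym ('a, 'b) tensor = "('a \<times> 'b \<Rightarrow>\<^sub>0 complex) set"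

definition tensor_algebra ::
  "(complex, 'a) module \<Rightarrow> (complex, 'b) module \<Rightarrow> (complex, ('a, 'b) tensor) module" where
  "tensor_algebra A B = quot_algebra (monoid_algebra (A \<times>\<times> B)) (bilinear_rels A B)"

definition tens ::
  "(complex, 'a) module \<Rightarrow> (complex, 'b) module \<Rightarrow> 'a \<Rightarrow> 'b \<Rightarrow> ('a, 'b) tensor" where
  "tens A B a b = quot_class (monoid_algebra (A \<times>\<times> B)) (bilinear_rels A B) (pair a b)"

text \<open>The linear map on a tensor product that is induced by a bilinear map \<open>\<beta>\<close>.\<close>

definition tensor_lift ::
  "(complex, 'c) module \<Rightarrow> ('a \<Rightarrow> 'b \<Rightarrow> 'c) \<Rightarrow> ('a, 'b) tensor \<Rightarrow> 'c" where
  "tensor_lift C \<beta> X = the_elem (lin_ext C (\<lambda>(a, b). \<beta> a b) ` X)"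

definition tensor_assoc ::
  "(complex, 'a) module \<Rightarrow> (complex, 'b) module \<Rightarrow> (complex, 'c) module \<Rightarrow>
   (('a, 'b) tensor, 'c) tensor \<Rightarrow> ('a, ('b, 'c) tensor) tensor" where
  "tensor_assoc A B C =
    (let BC = tensor_algebra B C; ABC = tensor_algebra A BC
     in tensor_lift ABC (\<lambda>t c. tensor_lift ABC (\<lambda>a b. tens A BC a (tens B C b c)) t))"

section \<open>The quantum algebra\<close>

text \<open>\<open>GenQH\<close> and \<open>GenQHinv\<close> stand for \<open>q\<^sup>H\<close> and \<open>q\<^sup>-\<^sup>H\<close>.\<close>

datatype uq_gen = GenE | GenF | GenQH | GenQHinv

type_synonym uq = "(uq_gen list \<Rightarrow>\<^sub>0 complex) set"

definition uq_rels ::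
  "complex \<Rightarrow> ((uq_gen list \<Rightarrow>\<^sub>0 complex) \<times> (uq_gen list \<Rightarrow>\<^sub>0 complex)) set" where
  "uq_rels q =
    (let A = free_algebra; e = gen GenE; f = gen GenF; k = gen GenQH; k' = gen GenQHinv in
     {(k \<otimes>\<^bsub>A\<^esub> k', \<one>\<^bsub>A\<^esub>),
      (k' \<otimes>\<^bsub>A\<^esub> k, \<one>\<^bsub>A\<^esub>),
      (k \<otimes>\<^bsub>A\<^esub> e, q \<odot>\<^bsub>A\<^esub> (e \<otimes>\<^bsub>A\<^esub> k)),
      (k \<otimes>\<^bsub>A\<^esub> f, inverse q \<odot>\<^bsub>A\<^esub> (f \<otimes>\<^bsub>A\<^esub> k)),
      (e \<otimes>\<^bsub>A\<^esub> f \<ominus>\<^bsub>A\<^esub> f \<otimes>\<^bsub>A\<^esub> e,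
       inverse (q - inverse q) \<odot>\<^bsub>A\<^esub> (k \<otimes>\<^bsub>A\<^esub> k \<ominus>\<^bsub>A\<^esub> k' \<otimes>\<^bsub>A\<^esub> k'))})"

definition Uq :: "complex \<Rightarrow> (complex, uq) module" where
  "Uq q = quot_algebra free_algebra (uq_rels q)"

definition uq_elt :: "complex \<Rightarrow> uq_gen \<Rightarrow> uq" where
  "uq_elt q g = quot_class free_algebra (uq_rels q) (gen g)"

definition casimir :: "complex \<Rightarrow> uq" where
  "casimir q =
    (let U = Uq q; k = uq_elt q GenQH; k' = uq_elt q GenQHinv in
     (q - inverse q)^2 \<odot>\<^bsub>U\<^esub> (uq_elt q GenF \<otimes>\<^bsub>U\<^esub> uq_elt q GenE)
       \<oplus>\<^bsub>U\<^esub> q \<odot>\<^bsub>U\<^esub> (k \<otimes>\<^bsub>U\<^esub> k) \<oplus>\<^bsub>U\<^esub> inverse q \<odot>\<^bsub>U\<^esub> (k' \<otimes>\<^bsub>U\<^esub> k'))"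

definition Uq2 :: "complex \<Rightarrow> (complex, (uq, uq) tensor) module" where
  "Uq2 q = tensor_algebra (Uq q) (Uq q)"

definition Uq3 :: "complex \<Rightarrow> (complex, (uq, (uq, uq) tensor) tensor) module" where
  "Uq3 q = tensor_algebra (Uq q) (Uq2 q)"

definition tens2 :: "complex \<Rightarrow> uq \<Rightarrow> uq \<Rightarrow> (uq, uq) tensor" where
  "tens2 q = tens (Uq q) (Uq q)"

definition comult :: "complex \<Rightarrow> uq \<Rightarrow> (uq, uq) tensor" where
  "comult q = presented_lift (Uq2 q)
    (\<lambda>g. let T = Uq2 q; e = uq_elt q GenE; f = uq_elt q GenF;
             k = uq_elt q GenQH; k' = uq_elt q GenQHinv in
      case g of
        GenE \<Rightarrow> tens2 q e k' \<oplus>\<^bsub>T\<^esub> tens2 q k e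
      | GenF \<Rightarrow> tens2 q f k' \<oplus>\<^bsub>T\<^esub> tens2 q k f
      | GenQH \<Rightarrow> tens2 q k k
      | GenQHinv \<Rightarrow> tens2 q k' k')"

text \<open>The iterated coproduct in the form \<open>(id \<otimes> \<Delta>) \<Delta>\<close>.\<close>

definition comult2 :: "complex \<Rightarrow> uq \<Rightarrow> (uq, (uq, uq) tensor) tensor" where
  "comult2 q x =
    tensor_lift (Uq3 q) (\<lambda>a b. tens (Uq q) (Uq2 q) a (comult q b)) (comult q x)"

section \<open>Representations\<close>

text \<open>
  The endomorphism algebra of \<open>complex^'n\<close>. Its product is \<open>**\<close>; the type class
  product of matrices is componentwise.
\<close>

definition End_alg :: "(complex, complex^'n^'n) module" where
  "End_alg =
    \<lparr>carrier = UNIV, mult = (**), one = mat 1, zero = 0, add = (+),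
     smult = (\<lambda>c M. \<chi> i j. c * M $ i $ j)\<rparr>"

text \<open>The tensor product of \<open>complex^'m\<close> and \<open>complex^'n\<close> is identified with \<open>complex^('m \<times> 'n)\<close>.\<close>

definition kronecker :: "complex^'m^'m \<Rightarrow> complex^'n^'n \<Rightarrow> complex^('m \<times> 'n)^('m \<times> 'n)" where
  "kronecker M N = (\<chi> i j. M $ fst i $ fst j * N $ snd i $ snd j)"

definition tensor_rep ::
  "('a \<Rightarrow> complex^'m^'m) \<Rightarrow> ('b \<Rightarrow> complex^'n^'n) \<Rightarrow>
   ('a, 'b) tensor \<Rightarrow> complex^('m \<times> 'n)^('m \<times> 'n)" where
  "tensor_rep \<pi> \<rho> = tensor_lift End_alg (\<lambda>a b. kronecker (\<pi> a) (\<rho> b))"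

text \<open>
  The spin is given by its double \<open>d = 2 j\<close>, and \<open>s\<close> is the chosen square root of \<open>q\<close>,
  so that \<open>s ^ d\<close> is \<open>q\<^sup>j\<close>. The predicate holds for \<open>\<pi>\<close> iff \<open>\<pi>\<close> is the spin-\<open>j\<close>
  representation, written in some basis.
\<close>

definition spin_rep :: "complex \<Rightarrow> complex \<Rightarrow> nat \<Rightarrow> (uq \<Rightarrow> complex^'n^'n) \<Rightarrow> bool" where
  "spin_rep q s d \<pi> \<longleftrightarrow>
     \<pi> \<in> alg_hom (Uq q) End_alg \<and>
     CARD('n) = d + 1 \<and>
     (\<forall>W. vec.subspace W \<and> (\<forall>x\<in>carrier (Uq q). \<forall>w\<in>W. \<pi> x *v w \<in> W)
        \<longrightarrow> W = {0} \<or> W = UNIV) \<and>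
     (\<exists>v. v \<noteq> 0 \<and>
        \<pi> (uq_elt q GenE) *v v = 0 \<and>
        \<pi> (uq_elt q GenQH) *v v = s ^ d *s v \<and>
        {\<pi> x *v v | x. x \<in> carrier (Uq q)} = UNIV)"

locale three_spins =
  fixes q :: complex
    and \<pi>1 :: "uq \<Rightarrow> complex^'n1^'n1"
    and \<pi>2 :: "uq \<Rightarrow> complex^'n2^'n2"
    and \<pi>3 :: "uq \<Rightarrow> complex^'n3^'n3"
begin

definition \<pi>123 ::
  "(uq, (uq, uq) tensor) tensor \<Rightarrow> complex^('n1 \<times> 'n2 \<times> 'n3)^('n1 \<times> 'n2 \<times> 'n3)" where
  "\<pi>123 = tensor_rep \<pi>1 (tensor_rep \<pi>2 \<pi>3)"

definition centralizer :: "(complex, complex^('n1 \<times> 'n2 \<times> 'n3)^('n1 \<times> 'n2 \<times> 'n3)) module" where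
  "centralizer = End_alg\<lparr>carrier :=
    {m. \<forall>x\<in>carrier (Uq q). \<pi>123 (comult2 q x) ** m - m ** \<pi>123 (comult2 q x) = 0}\<rparr>"

abbreviation "tens3 a b c \<equiv> tens (Uq q) (Uq2 q) a (tens2 q b c)"

definition "C1 = \<pi>123 (tens3 (casimir q) \<one>\<^bsub>Uq q\<^esub> \<one>\<^bsub>Uq q\<^esub>)"
definition "C2 = \<pi>123 (tens3 \<one>\<^bsub>Uq q\<^esub> (casimir q) \<one>\<^bsub>Uq q\<^esub>)"
definition "C3 = \<pi>123 (tens3 \<one>\<^bsub>Uq q\<^esub> \<one>\<^bsub>Uq q\<^esub> (casimir q))"
definition "C12 = \<pi>123 (tensor_assoc (Uq q) (Uq q) (Uq q)
  (tens (Uq2 q) (Uq q) (comult q (casimir q)) \<one>\<^bsub>Uq q\<^esub>))"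
definition "C23 = \<pi>123 (tens (Uq q) (Uq2 q) \<one>\<^bsub>Uq q\<^esub> (comult q (casimir q)))"
definition "C123 = \<pi>123 (comult2 q (casimir q))"

end

section \<open>The centrally extended Askey--Wilson algebra\<close>

datatype aw_gen = GenA | GenB | GenD | Alpha1 | Alpha2 | Alpha3 | GenK

type_synonym aw = "(aw_gen list \<Rightarrow>\<^sub>0 complex) set"

definition q_comm :: "complex \<Rightarrow> (complex, 'a) module \<Rightarrow> 'a \<Rightarrow> 'a \<Rightarrow> 'a" where
  "q_comm q A x y = q \<odot>\<^bsub>A\<^esub> (x \<otimes>\<^bsub>A\<^esub> y) \<ominus>\<^bsub>A\<^esub> inverse q \<odot>\<^bsub>A\<^esub> (y \<otimes>\<^bsub>A\<^esub> x)"

definition aw_rels ::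
  "complex \<Rightarrow> ((aw_gen list \<Rightarrow>\<^sub>0 complex) \<times> (aw_gen list \<Rightarrow>\<^sub>0 complex)) set" where
  "aw_rels q =
    (let R = free_algebra; a = gen GenA; b = gen GenB; d = gen GenD;
         \<alpha>1 = gen Alpha1; \<alpha>2 = gen Alpha2; \<alpha>3 = gen Alpha3; k = gen GenK;
         u = inverse (q^2 - inverse (q^2)); v = inverse (q + inverse q) in
     {(z \<otimes>\<^bsub>R\<^esub> gen g, gen g \<otimes>\<^bsub>R\<^esub> z) | z g. z \<in> {\<alpha>1, \<alpha>2, \<alpha>3, k}} \<union>
     {(a \<oplus>\<^bsub>R\<^esub> u \<odot>\<^bsub>R\<^esub> q_comm q R b d, v \<odot>\<^bsub>R\<^esub> (\<alpha>1 \<otimes>\<^bsub>R\<^esub> \<alpha>2 \<oplus>\<^bsub>R\<^esub> \<alpha>3 \<otimes>\<^bsub>R\<^esub> k)),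
      (b \<oplus>\<^bsub>R\<^esub> u \<odot>\<^bsub>R\<^esub> q_comm q R d a, v \<odot>\<^bsub>R\<^esub> (\<alpha>2 \<otimes>\<^bsub>R\<^esub> \<alpha>3 \<oplus>\<^bsub>R\<^esub> \<alpha>1 \<otimes>\<^bsub>R\<^esub> k)),
      (d \<oplus>\<^bsub>R\<^esub> u \<odot>\<^bsub>R\<^esub> q_comm q R a b, v \<odot>\<^bsub>R\<^esub> (\<alpha>1 \<otimes>\<^bsub>R\<^esub> \<alpha>3 \<oplus>\<^bsub>R\<^esub> \<alpha>2 \<otimes>\<^bsub>R\<^esub> k))})"

definition AW3 :: "complex \<Rightarrow> (complex, aw) module" where
  "AW3 q = quot_algebra free_algebra (aw_rels q)"

definition aw_elt :: "complex \<Rightarrow> aw_gen \<Rightarrow> aw" where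
  "aw_elt q g = quot_class free_algebra (aw_rels q) (gen g)"

definition (in three_spins) is_aw_hom ::
  "(aw \<Rightarrow> complex^('n1 \<times> 'n2 \<times> 'n3)^('n1 \<times> 'n2 \<times> 'n3)) \<Rightarrow> bool" where
  "is_aw_hom \<phi> \<longleftrightarrow>
     \<phi> \<in> alg_hom (AW3 q) centralizer \<and>
     \<phi> (aw_elt q Alpha1) = C1 \<and> \<phi> (aw_elt q Alpha2) = C2 \<and> \<phi> (aw_elt q Alpha3) = C3 \<and>
     \<phi> (aw_elt q GenA) = C12 \<and> \<phi> (aw_elt q GenB) = C23 \<and> \<phi> (aw_elt q GenK) = C123"

end

theory Submission
  imports Defs
begin

text \<open>
  Let \<open>A\<close>, \<open>B\<close>, \<open>C\<close> be the images of the Casimir element in positions 12, 23 and 123. An element of the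
  centralizer is determined by its action on the highest weight vectors, which \<open>C\<close> separates by weight.
  On the highest weight vectors of a fixed weight, suitable coordinates make \<open>A\<close> lower and \<open>B\<close> upper
  bidiagonal, with explicit entries. The Askey--Wilson relations become identities between these
  entries. Moreover the first coordinate \<open>\<lambda>\<close> is an eigencovector of \<open>A\<close> for a simple eigenvalue, so some
  polynomial in \<open>A\<close> has the form \<open>v \<mapsto> \<lambda>(v) \<eta>\<close>, and \<open>\<lambda>\<close> is cyclic for \<open>B\<close>. The nondegenerate contravariant form, for which
  \<open>A\<close> and \<open>B\<close> are self-adjoint, transports cyclicity to \<open>\<eta>\<close>. Hence the operators \<open>B\<^sup>k p(A) B\<^sup>l\<close> span all
  endomorphisms of the space of highest weight vectors of that weight.
\<close>

section \<open>Matrices and the Casimir operator\<close>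

text \<open>Neither complete reducibility nor the dimension of any multiplicity space enters. Their
  place is taken by the two normal forms of the Casimir element: comparing the eigenvalues they
  predict shows that strings cannot break off too early, and yields a projector that is a polynomial
  in \<open>C\<close>. The obstacle to a plain matrix argument is that the bidiagonal coordinates
  are injective on highest weight vectors but need not be onto: for spins 1/2, 0, 1/2 the highest
  weight vectors of level 1 form a line, while two coordinates are in range. So matrix units cannot
  be written down, and dual families for an abstract basis are extracted from cyclicity instead.
  Diagonal entries of \<open>A\<close> may also repeat (spins 1, 0, 1 at level 2); only the leading
  one is simple. Existence of the homomorphism belongs to the claim, and the definitions evaluate
  classes at representatives through \<open>the_elem\<close>; hence the long algebraic part showing
  that the presented and tensor maps in play are well defined.\<close>

definition mat_smult :: "complex \<Rightarrow> complex^'n^'n \<Rightarrow> complex^'n^'n" where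
  "mat_smult c M = (\<chi> i j. c * M $ i $ j)"

lemma mat_smult_vec: "mat_smult c M *v v = c *s (M *v v)"
  by (simp add: mat_smult_def matrix_vector_mult_def vec_eq_iff sum_distrib_left mult.assoc)

lemma matrix_eqI: "(\<And>v. M *v v = N *v v) \<Longrightarrow> M = (N :: complex^'n^'n)"
  by (simp add: matrix_eq)

lemmas mv_simps = matrix_vector_mul_assoc[symmetric] matrix_vector_mult_add_rdistrib
  matrix_vector_mult_diff_rdistrib mat_smult_vec vec.add vec.diff vec.scale

definition commute :: "complex^'n^'n \<Rightarrow> complex^'n^'n \<Rightarrow> bool" where
  "commute M N \<longleftrightarrow> M ** N = N ** M"

lemma commute_vec: "commute M N \<longleftrightarrow> (\<forall>v. M *v (N *v v) = N *v (M *v v))"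
  by (auto simp: commute_def matrix_eq matrix_vector_mul_assoc)

lemma commuteD: "commute M N \<Longrightarrow> M *v (N *v v) = N *v (M *v v)"
  by (simp add: commute_vec)

lemma commute_sym: "commute M N \<Longrightarrow> commute N M"
  by (simp add: commute_def)

lemma commute_add: "commute M N \<Longrightarrow> commute M N' \<Longrightarrow> commute M (N + N')"
  by (simp add: commute_vec mv_simps)

lemma commute_diff: "commute M N \<Longrightarrow> commute M N' \<Longrightarrow> commute M (N - N')"
  by (simp add: commute_vec mv_simps)

lemma commute_mult: "commute M N \<Longrightarrow> commute M N' \<Longrightarrow> commute M (N ** N')"
  by (simp add: commute_vec mv_simps)

lemma commute_smc: "commute M N \<Longrightarrow> commute M (mat_smult c N)"
  by (simp add: commute_vec mv_simps)

lemma commute_mat_1: "commute M (mat 1)"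
  by (simp add: commute_def)

lemmas commute_intros = commute_add commute_diff commute_mult commute_smc commute_mat_1

text \<open>Here \<open>K\<close> and \<open>L\<close> stand for \<open>q\<^sup>H\<close> and \<open>q\<^sup>-\<^sup>H\<close>.\<close>

definition uq_triple :: "complex \<Rightarrow> complex^'n^'n \<Rightarrow> complex^'n^'n \<Rightarrow> complex^'n^'n \<Rightarrow> complex^'n^'n \<Rightarrow> bool" where
  "uq_triple q E F K L \<longleftrightarrow> K ** L = mat 1 \<and> L ** K = mat 1 \<and>
     K ** E = mat_smult q (E ** K) \<and> K ** F = mat_smult (inverse q) (F ** K) \<and>
     E ** F - F ** E = mat_smult (inverse (q - inverse q)) (K ** K - L ** L)"

text \<open>The value of the Casimir element at an arbitrary quadruple of matrices, so that one
  definition serves a single slot, two adjacent slots and all three.\<close>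

definition cas :: "complex \<Rightarrow> complex^'n^'n \<Rightarrow> complex^'n^'n \<Rightarrow> complex^'n^'n \<Rightarrow> complex^'n^'n \<Rightarrow> complex^'n^'n" where
  "cas q E F K L = mat_smult ((q - inverse q)^2) (F ** E) + mat_smult q (K ** K) + mat_smult (inverse q) (L ** L)"

context
  fixes q :: complex and E F K L :: "complex^'n^'n"
  assumes q: "q \<noteq> 0" "q^2 \<noteq> 1" and U: "uq_triple q E F K L"
begin

lemma q_cancel: "q * (inverse q * inverse q) = inverse q" "inverse q * (q * q) = q"
  using q by simp_all

lemma KL: "K *v (L *v v) = v" and LK: "L *v (K *v v) = v"
  using U by (auto simp: uq_triple_def matrix_vector_mul_assoc)

lemma KE: "K *v (E *v v) = q *s (E *v (K *v v))"
  and KF: "K *v (F *v v) = inverse q *s (F *v (K *v v))"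
  using U by (auto simp: uq_triple_def matrix_vector_mul_assoc mat_smult_vec)

lemma EF: "E *v (F *v v) = F *v (E *v v) + inverse (q - inverse q) *s (K *v (K *v v) - L *v (L *v v))"
proof -
  have "(E ** F - F ** E) *v v = mat_smult (inverse (q - inverse q)) (K ** K - L ** L) *v v"
    using U by (simp add: uq_triple_def)
  then show ?thesis by (simp add: mv_simps algebra_simps)
qed

lemma LE: "L *v (E *v v) = inverse q *s (E *v (L *v v))"
proof -
  have "K *v (E *v (L *v v)) = q *s (E *v v)" by (simp add: KE KL)
  then have "L *v (K *v (E *v (L *v v))) = q *s (L *v (E *v v))" by (simp add: mv_simps)
  then show ?thesis using q by (simp add: LK vector_smult_assoc)
qed

lemma LF: "L *v (F *v v) = q *s (F *v (L *v v))"
proof -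
  have "K *v (F *v (L *v v)) = inverse q *s (F *v v)" by (simp add: KF KL)
  then have "L *v (K *v (F *v (L *v v))) = inverse q *s (L *v (F *v v))" by (simp add: mv_simps)
  then show ?thesis using q by (simp add: LK vector_smult_assoc)
qed

lemma q_diff: "q - inverse q \<noteq> 0"
proof
  assume "q - inverse q = 0"
  then have "q * q = 1" using q by (simp add: field_simps)
  then show False using q by (simp add: power2_eq_square)
qed

text \<open>Trading \<open>F E\<close> for \<open>E F\<close> interchanges the coefficients
  \<open>q\<close> and \<open>inverse q\<close>. Having both normal forms is what makes the Casimir
  commute with \<open>E\<close> and \<open>F\<close>: the second form applied to \<open>E v\<close>
  is \<open>E\<close> applied to the first.\<close>

lemma cas_EF: "cas q E F K L *v v = (q - inverse q)^2 *s (E *v (F *v v))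
    + inverse q *s (K *v (K *v v)) + q *s (L *v (L *v v))"
proof -
  have [simp]: "(q - inverse q)^2 * inverse (q - inverse q) = q - inverse q"
    using q_diff by (simp add: power2_eq_square)
  show ?thesis
    by (simp add: cas_def EF mv_simps vector_smult_assoc vector_ssub_ldistrib vector_add_ldistrib)
       (simp add: vec_eq_iff algebra_simps)
qed

lemma commute_cas_K: "commute (cas q E F K L) K"
  using q by (simp add: commute_vec cas_def mv_simps KE KF KL LK vector_smult_assoc vector_add_ldistrib mult.commute)

lemma commute_cas_L: "commute (cas q E F K L) L"
  using q by (simp add: commute_vec cas_def mv_simps LE LF KL LK vector_smult_assoc vector_add_ldistrib mult.commute)

lemma commute_cas_E: "commute (cas q E F K L) E"
proof -
  have "cas q E F K L *v (E *v v) = E *v (cas q E F K L *v v)" for v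
  proof -
    have "cas q E F K L *v (E *v v) = (q - inverse q)^2 *s (E *v (F *v (E *v v)))
      + q *s (E *v (K *v (K *v v))) + inverse q *s (E *v (L *v (L *v v)))"
      unfolding cas_EF by (simp add: KE LE vec.scale vector_smult_assoc q_cancel)
    then show ?thesis by (simp add: cas_def mv_simps)
  qed
  then show ?thesis by (simp add: commute_vec)
qed

lemma commute_cas_F: "commute (cas q E F K L) F"
proof -
  have "cas q E F K L *v (F *v v) = F *v (cas q E F K L *v v)" for v
  proof -
    have "F *v (cas q E F K L *v v) = (q - inverse q)^2 *s (F *v (E *v (F *v v)))
      + inverse q *s (F *v (K *v (K *v v))) + q *s (F *v (L *v (L *v v)))"
      unfolding cas_EF by (simp add: mv_simps)
    then show ?thesis by (simp add: cas_def mv_simps KF LF vector_smult_assoc q_cancel)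
  qed
  then show ?thesis by (simp add: commute_vec)
qed

end

section \<open>Tensor products of three weight strings\<close>

text \<open>The Casimir eigenvalue on a vector killed by \<open>E\<close> on which \<open>K\<close>
  acts by \<open>s powi m\<close>; for m = 2j this is the scalar \<chi> of the spin-j
  representation.\<close>

definition chi :: "complex \<Rightarrow> int \<Rightarrow> complex" where
  "chi q m = q powi (m + 1) + q powi (- m - 1)"

definition q_int :: "complex \<Rightarrow> int \<Rightarrow> complex" where
  "q_int q m = (q powi m - q powi (- m)) / (q - inverse q)"

locale generic_q =
  fixes q s :: complex
  assumes q_nz: "q \<noteq> 0" and q_no_root: "\<And>n. n > 0 \<Longrightarrow> q ^ n \<noteq> 1" and s_sq: "s^2 = q"
begin

lemma s_nz: "s \<noteq> 0"
  using q_nz s_sq by auto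

lemma s_powi_double: "s powi (2 * m) = q powi m"
  using s_sq by (simp add: power_int_mult)

lemma q2_ne_1: "q^2 \<noteq> 1" using q_no_root[of 2] by simp

lemma q4_ne_1: "q^4 \<noteq> 1" using q_no_root[of 4] by simp

lemma q_diff_nz: "q - inverse q \<noteq> 0"
proof
  assume "q - inverse q = 0"
  then have "q * q = 1" using q_nz by (simp add: field_simps)
  then show False using q2_ne_1 by (simp add: power2_eq_square)
qed

lemma q_powi_eq_1: "q powi m = 1 \<longleftrightarrow> m = 0"
proof
  assume *: "q powi m = 1"
  show "m = 0"
  proof (rule ccontr)
    assume "m \<noteq> 0"
    then have "nat \<bar>m\<bar> > 0" by simp
    moreover have "q ^ nat \<bar>m\<bar> = 1" using * by (auto simp: power_int_def abs_if power_inverse split: if_splits)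
    ultimately show False using q_no_root by blast
  qed
qed simp

lemma q_powi_inject: "q powi m = q powi n \<longleftrightarrow> m = n"
proof -
  have "q powi m = q powi n \<longleftrightarrow> q powi (m - n) = 1"
    using q_nz by (simp add: power_int_diff)
  then show ?thesis by (simp add: q_powi_eq_1)
qed

text \<open>A sum x + 1/x determines x up to inversion, so m + 1 and n + 1 agree up to sign. Each
  separation of eigenvalues below consists in ruling out the reflected case m + n + 2 = 0.\<close>

lemma chi_eq_iff: "chi q m = chi q n \<longleftrightarrow> m = n \<or> m + n + 2 = 0"
proof -
  define a b where "a = q powi (m + 1)" and "b = q powi (n + 1)"
  have nz: "a \<noteq> 0" "b \<noteq> 0" using q_nz by (simp_all add: a_def b_def)
  have inv: "q powi (- m - 1) = 1 / a" "q powi (- n - 1) = 1 / b"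
  proof -
    have "- m - 1 = - (m + 1)" "- n - 1 = - (n + 1)" by simp_all
    then show "q powi (- m - 1) = 1 / a" "q powi (- n - 1) = 1 / b"
      by (simp_all only: power_int_minus a_def b_def inverse_eq_divide)
  qed
  have "chi q m - chi q n = (a - b) * (a * b - 1) / (a * b)"
    using nz by (simp add: chi_def a_def[symmetric] b_def[symmetric] inv) (simp add: field_simps)
  then have "chi q m = chi q n \<longleftrightarrow> (a - b) * (a * b - 1) = 0"
    using nz by (metis divide_eq_0_iff eq_iff_diff_eq_0 mult_eq_0_iff)
  also have "\<dots> \<longleftrightarrow> a = b \<or> a * b = 1" by simp
  also have "a = b \<longleftrightarrow> m = n" by (simp add: a_def b_def q_powi_inject)
  also have "a * b = q powi (m + n + 2)"
    using q_nz by (simp add: a_def b_def power_int_add[symmetric] algebra_simps)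
  finally show ?thesis by (simp add: q_powi_eq_1)
qed

lemma q_int_eq_0_iff: "q_int q m = 0 \<longleftrightarrow> m = 0"
  using q_diff_nz by (auto simp: q_int_def q_powi_inject)

end

text \<open>
  \<open>c v i j k\<close> are the coordinates of \<open>v\<close> in a tensor product of weight bases, \<open>(i, j, k)\<close> having weight
  \<open>d1 + d2 + d3 - 2 (i + j + k)\<close>. The bases are normalised by \<open>g1\<close>, \<open>g2\<close>, \<open>g3\<close> so that the matrix of \<open>F\<close> in each
  factor is the transpose of that of \<open>E\<close>. \<open>L\<close> denotes the inverse of \<open>K\<close>.
\<close>

locale three_strings = generic_q q s for q s :: complex +
  fixes d1 d2 d3 :: nat
    and c :: "complex^'N \<Rightarrow> nat \<Rightarrow> nat \<Rightarrow> nat \<Rightarrow> complex"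
    and g1 g2 g3 :: "nat \<Rightarrow> complex"
    and E1 F1 K1 L1 E2 F2 K2 L2 E3 F3 K3 L3 :: "complex^'N^'N"
  assumes c_add: "c (v + w) i j k = c v i j k + c w i j k"
    and c_scale: "c (a *s v) i j k = a * c v i j k"
    and c_out: "\<not> (i \<le> d1 \<and> j \<le> d2 \<and> k \<le> d3) \<Longrightarrow> c v i j k = 0"
    and c_inj: "(\<And>i j k. c v i j k = 0) \<Longrightarrow> v = 0"
    and c_surj: "i \<le> d1 \<Longrightarrow> j \<le> d2 \<Longrightarrow> k \<le> d3 \<Longrightarrow>
      \<exists>v. \<forall>i' j' k'. c v i' j' k' = (if i' = i \<and> j' = j \<and> k' = k then 1 else 0)"
    and g1: "g1 0 = 0" "g1 (Suc d1) = 0" "\<And>k. k \<le> Suc d1 \<Longrightarrow> g1 k ^ 2 = q_int q (int k) * q_int q (int d1 + 1 - int k)"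
    and g2: "g2 0 = 0" "g2 (Suc d2) = 0" "\<And>k. k \<le> Suc d2 \<Longrightarrow> g2 k ^ 2 = q_int q (int k) * q_int q (int d2 + 1 - int k)"
    and g3: "g3 0 = 0" "g3 (Suc d3) = 0" "\<And>k. k \<le> Suc d3 \<Longrightarrow> g3 k ^ 2 = q_int q (int k) * q_int q (int d3 + 1 - int k)"
    and cE1: "c (E1 *v v) i j k = g1 (Suc i) * c v (Suc i) j k"
    and cE2: "c (E2 *v v) i j k = g2 (Suc j) * c v i (Suc j) k"
    and cE3: "c (E3 *v v) i j k = g3 (Suc k) * c v i j (Suc k)"
    and cF1: "c (F1 *v v) i j k = g1 i * c v (i - 1) j k"
    and cF2: "c (F2 *v v) i j k = g2 j * c v i (j - 1) k"
    and cF3: "c (F3 *v v) i j k = g3 k * c v i j (k - 1)"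
    and cK1: "c (K1 *v v) i j k = s powi (int d1 - 2 * int i) * c v i j k"
    and cK2: "c (K2 *v v) i j k = s powi (int d2 - 2 * int j) * c v i j k"
    and cK3: "c (K3 *v v) i j k = s powi (int d3 - 2 * int k) * c v i j k"
    and cL1: "c (L1 *v v) i j k = s powi (2 * int i - int d1) * c v i j k"
    and cL2: "c (L2 *v v) i j k = s powi (2 * int j - int d2) * c v i j k"
    and cL3: "c (L3 *v v) i j k = s powi (2 * int k - int d3) * c v i j k"
    and uq12: "uq_triple q (E1 ** L2 + K1 ** E2) (F1 ** L2 + K1 ** F2) (K1 ** K2) (L1 ** L2)"
    and uq23: "uq_triple q (E2 ** L3 + K2 ** E3) (F2 ** L3 + K2 ** F3) (K2 ** K3) (L2 ** L3)"
    and uq123: "uq_triple q (E1 ** L2 ** L3 + K1 ** E2 ** L3 + K1 ** K2 ** E3)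
        (F1 ** L2 ** L3 + K1 ** F2 ** L3 + K1 ** K2 ** F3) (K1 ** K2 ** K3) (L1 ** L2 ** L3)"
begin

lemma c_0 [simp]: "c 0 i j k = 0"
  using c_scale[of 0 0] by simp

lemma c_diff: "c (v - w) i j k = c v i j k - c w i j k"
  using c_add[of "v - w" w] by simp

lemma c_eqI: "(\<And>i j k. c v i j k = c w i j k) \<Longrightarrow> v = w"
  using c_inj[of "v - w"] by (simp add: c_diff)

abbreviation "lam \<equiv> q - inverse q"

definition "E12 = E1 ** L2 + K1 ** E2"
definition "F12 = F1 ** L2 + K1 ** F2"
definition "K12 = K1 ** K2"
definition "L12 = L1 ** L2"
definition "E23 = E2 ** L3 + K2 ** E3"
definition "F23 = F2 ** L3 + K2 ** F3"
definition "K23 = K2 ** K3"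
definition "L23 = L2 ** L3"
definition "E = E1 ** L2 ** L3 + K1 ** E2 ** L3 + K1 ** K2 ** E3"
definition "F = F1 ** L2 ** L3 + K1 ** F2 ** L3 + K1 ** K2 ** F3"
definition "K = K1 ** K2 ** K3"
definition "L = L1 ** L2 ** L3"

definition "A = cas q E12 F12 K12 L12"
definition "B = cas q E23 F23 K23 L23"
definition "C = cas q E F K L"

lemma uq12': "uq_triple q E12 F12 K12 L12"
  and uq23': "uq_triple q E23 F23 K23 L23"
  and uq': "uq_triple q E F K L"
  using uq12 uq23 uq123 by (simp_all add: E12_def F12_def K12_def L12_def E23_def F23_def K23_def L23_def E_def F_def K_def L_def)

lemmas c_lin = c_add c_diff c_scale
lemmas c_gen = cE1 cE2 cE3 cF1 cF2 cF3 cK1 cK2 cK3 cL1 cL2 cL3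

lemma commute_slots:
  assumes "X \<in> {E1, F1, K1, L1}" "Y \<in> {E2, F2, K2, L2}" "Z \<in> {E3, F3, K3, L3}"
  shows "commute X Y" "commute X Z" "commute Y Z"
  unfolding commute_vec using assms
  by (auto intro!: c_eqI simp: c_gen)

text \<open>Coassociativity in matrix form. The first bracketing suits \<open>A\<close>, which
  commutes with slot 3; the second suits \<open>B\<close>, which commutes with slot 1.\<close>

lemma E_split: "E = E12 ** L3 + K12 ** E3" "E = E1 ** L23 + K1 ** E23"
  and F_split: "F = F12 ** L3 + K12 ** F3" "F = F1 ** L23 + K1 ** F23"
  and K_split: "K = K12 ** K3" "K = K1 ** K23"
  and L_split: "L = L12 ** L3" "L = L1 ** L23"
  by (auto intro!: matrix_eqI simp: E_def F_def K_def L_def E12_def F12_def K12_def L12_def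
    E23_def F23_def K23_def L23_def mv_simps)

lemma commute_A_slot3:
  assumes "Z \<in> {E3, F3, K3, L3}"
  shows "commute Z A"
proof -
  have "commute Z X" if "X \<in> {E1, F1, K1, L1, E2, F2, K2, L2}" for X
    using that commute_slots(2)[of X E2 Z, THEN commute_sym] commute_slots(3)[of E1 X Z, THEN commute_sym] assms by blast
  then show ?thesis
    unfolding A_def cas_def E12_def F12_def K12_def L12_def by (intro commute_intros) auto
qed

lemma commute_B_slot1:
  assumes "Z \<in> {E1, F1, K1, L1}"
  shows "commute Z B"
proof -
  have "commute Z X" if "X \<in> {E3, F3, K3, L3, E2, F2, K2, L2}" for X
    using that commute_slots(2)[of Z E2 X] commute_slots(1)[of Z X E3] assms by blast
  then show ?thesis
    unfolding B_def cas_def E23_def F23_def K23_def L23_def by (intro commute_intros) auto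
qed

text \<open>Commutation is demanded for generators only; \<open>centralizer_carrier\<close> later
  identifies this with the centralizer of the whole image.\<close>

definition commutant :: "(complex^'N^'N) set" where
  "commutant = {z. commute z E \<and> commute z F \<and> commute z K \<and> commute z L}"

lemma cas_commute_all:
  assumes "uq_triple q X Y Z W"
  shows "commute (cas q X Y Z W) X" "commute (cas q X Y Z W) Y"
    "commute (cas q X Y Z W) Z" "commute (cas q X Y Z W) W"
  using commute_cas_E commute_cas_F commute_cas_K commute_cas_L assms q_nz q2_ne_1 by blast+

lemma A_commutant: "A \<in> commutant"
  unfolding commutant_def E_split(1) F_split(1) K_split(1) L_split(1)
  using cas_commute_all[OF uq12'] commute_A_slot3[THEN commute_sym]
  by (auto simp: A_def[symmetric] intro!: commute_intros)

lemma B_commutant: "B \<in> commutant"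
  unfolding commutant_def E_split(2) F_split(2) K_split(2) L_split(2)
  using cas_commute_all[OF uq23'] commute_B_slot1[THEN commute_sym]
  by (auto simp: B_def[symmetric] intro!: commute_intros)

lemma C_commutant: "C \<in> commutant"
  unfolding commutant_def using cas_commute_all[OF uq'] by (auto simp: C_def[symmetric])

lemma commutant_add: "x \<in> commutant \<Longrightarrow> y \<in> commutant \<Longrightarrow> x + y \<in> commutant"
  and commutant_diff: "x \<in> commutant \<Longrightarrow> y \<in> commutant \<Longrightarrow> x - y \<in> commutant"
  and commutant_mult: "x \<in> commutant \<Longrightarrow> y \<in> commutant \<Longrightarrow> x ** y \<in> commutant"
  and commutant_smc: "x \<in> commutant \<Longrightarrow> mat_smult a x \<in> commutant"
  and commutant_1: "mat 1 \<in> commutant"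
  by (auto simp: commutant_def intro!: commute_intros[THEN commute_sym] dest: commute_sym)

end

section \<open>Weight spaces, and the Casimir operator on them\<close>

context three_strings
begin

definition D :: nat where "D = d1 + d2 + d3"

text \<open>A weight space, indexed by the number of lowering steps from the top weight, so that
  inductions run over natural numbers.\<close>

definition level :: "nat \<Rightarrow> complex^'N \<Rightarrow> bool" where
  "level n v \<longleftrightarrow> (\<forall>i j k. i + j + k \<noteq> n \<longrightarrow> c v i j k = 0)"

definition wt :: "nat \<Rightarrow> int" where "wt n = int D - 2 * int n"

definition hw :: "nat \<Rightarrow> complex^'N \<Rightarrow> bool" where
  "hw n v \<longleftrightarrow> level n v \<and> E *v v = 0"

lemma level_add: "level n v \<Longrightarrow> level n w \<Longrightarrow> level n (v + w)"
  and level_diff: "level n v \<Longrightarrow> level n w \<Longrightarrow> level n (v - w)"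
  and level_scale: "level n v \<Longrightarrow> level n (a *s v)"
  and level_0: "level n 0"
  by (simp_all add: level_def c_lin)

lemma level_big: "level n v \<Longrightarrow> n > D \<Longrightarrow> v = 0"
proof (rule c_inj)
  fix i j k assume "level n v" "n > D"
  then show "c v i j k = 0"
    by (cases "i + j + k = n") (auto simp: level_def D_def intro!: c_out)
qed

lemma s_powi_nz [simp]: "s powi m \<noteq> 0" using s_nz by simp
lemma q_powi_nz [simp]: "q powi m \<noteq> 0" using q_nz by simp

lemma wt_split: "wt (i + j + k) = (int d1 - 2 * int i) + ((int d2 - 2 * int j) + (int d3 - 2 * int k))"
  by (simp add: wt_def D_def)

lemma c_K: "c (K *v v) i j k = s powi (wt (i + j + k)) * c v i j k"
  unfolding K_def by (simp add: mv_simps c_gen wt_split power_int_add s_nz)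

lemma c_L: "c (L *v v) i j k = s powi (- wt (i + j + k)) * c v i j k"
proof -
  have "- wt (i + j + k) = (2 * int i - int d1) + ((2 * int j - int d2) + (2 * int k - int d3))"
    by (simp add: wt_split)
  then show ?thesis
    unfolding L_def by (simp add: mv_simps c_gen power_int_add s_nz)
qed

lemma K_level: "level n v \<Longrightarrow> K *v v = s powi (wt n) *s v"
  apply (rule c_eqI)
  subgoal for i j k by (cases "i + j + k = n") (auto simp: c_K c_scale level_def)
  done

lemma L_level: "level n v \<Longrightarrow> L *v v = s powi (- wt n) *s v"
  apply (rule c_eqI)
  subgoal for i j k by (cases "i + j + k = n") (auto simp: c_L c_scale level_def)
  done

lemma level_if_K: "K *v v = s powi (wt n) *s v \<Longrightarrow> level n v"
  unfolding level_def
proof (intro allI impI)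
  fix i j k assume *: "K *v v = s powi (wt n) *s v" and ne: "i + j + k \<noteq> n"
  have "s powi (wt (i + j + k)) * c v i j k = s powi (wt n) * c v i j k"
    using arg_cong[OF *, of "\<lambda>v. c v i j k"] by (simp add: c_K c_scale)
  moreover have "s powi (wt (i + j + k)) \<noteq> s powi (wt n)"
  proof
    assume "s powi (wt (i + j + k)) = s powi (wt n)"
    \<comment> \<open>Squaring passes from \<open>s\<close> to \<open>q\<close>, whose integer
      powers are known to be distinct.\<close>
    then have "(s powi (wt (i + j + k)))^2 = (s powi (wt n))^2" by simp
    then have "s powi (2 * wt (i + j + k)) = s powi (2 * wt n)"
      by (simp add: power_int_mult mult.commute[of 2])
    then have "wt (i + j + k) = wt n" by (simp add: s_powi_double q_powi_inject)
    then show False using ne by (simp add: wt_def)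
  qed
  ultimately show "c v i j k = 0" by simp
qed

lemma level_commutant: "z \<in> commutant \<Longrightarrow> level n v \<Longrightarrow> level n (z *v v)"
  by (rule level_if_K) (metis (no_types, lifting) K_level commutant_def commuteD mem_Collect_eq vec.scale)

lemma hw_commutant: "z \<in> commutant \<Longrightarrow> hw n v \<Longrightarrow> hw n (z *v v)"
  unfolding hw_def by (metis (no_types, lifting) level_commutant commutant_def commuteD mem_Collect_eq vec.zero)

lemma hw_add: "hw n v \<Longrightarrow> hw n w \<Longrightarrow> hw n (v + w)"
  and hw_diff: "hw n v \<Longrightarrow> hw n w \<Longrightarrow> hw n (v - w)"
  and hw_scale: "hw n v \<Longrightarrow> hw n (a *s v)"
  and hw_0: "hw n 0"
  by (simp_all add: hw_def level_add level_diff level_scale level_0 mv_simps)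

text \<open>At n = 0 the truncated subtraction is harmless, because \<open>E\<close> then kills
  \<open>v\<close>.\<close>

lemma E_level: "level n v \<Longrightarrow> level (n - 1) (E *v v)"
  unfolding level_def E_def by (auto simp: mv_simps c_lin c_gen)

lemma E_level_0: "level 0 v \<Longrightarrow> E *v v = 0"
  unfolding level_def E_def by (auto simp: mv_simps c_lin c_gen intro!: c_inj)

lemma F_level: "level n v \<Longrightarrow> level (Suc n) (F *v v)"
  unfolding level_def F_def
  apply (intro allI impI)
  subgoal for i j k
    by (cases i; cases j; cases k) (auto simp: mv_simps c_lin c_gen g1 g2 g3)
  done

lemma s_powi_square: "s powi m * s powi m = q powi m"
  using s_nz by (simp add: power_int_add[symmetric] s_powi_double[symmetric])

lemma K_K_level: "level n v \<Longrightarrow> K *v (K *v v) = q powi (wt n) *s v"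
  and L_L_level: "level n v \<Longrightarrow> L *v (L *v v) = q powi (- wt n) *s v"
  by (simp_all add: K_level L_level vec.scale vector_smult_assoc s_powi_square)

text \<open>On a weight space the two normal forms predict different eigenvalues: a vector killed by
  \<open>E\<close> has \<open>chi q (wt n)\<close>, one killed by \<open>F\<close> has, by
  \<open>C_EF\<close>, \<open>chi q (wt n - 2)\<close>. Since \<open>C\<close> is constant along a
  string, the contrast shows where strings can end.\<close>

lemma C_FE: 
  assumes "level n v"
  shows "C *v v = lam^2 *s (F *v (E *v v)) + chi q (wt n) *s v"
proof -
  have "chi q (wt n) = q * q powi (wt n) + inverse q * q powi (- wt n)"
    using q_nz by (simp add: chi_def power_int_add power_int_diff field_simps)
  then show ?thesis
    using K_K_level[OF assms] L_L_level[OF assms]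
    by (simp add: C_def cas_def mv_simps vector_smult_assoc vector_sadd_rdistrib add.assoc)
qed

lemma C_EF: 
  assumes "level n v"
  shows "C *v v = lam^2 *s (E *v (F *v v)) + chi q (wt n - 2) *s v"
proof -
  have "wt n - 2 + 1 = wt n - 1" "- (wt n - 2) - 1 = - wt n + 1" by simp_all
  then have "chi q (wt n - 2) = inverse q * q powi (wt n) + q * q powi (- wt n)"
    using q_nz unfolding chi_def by (simp only:) (simp add: power_int_add power_int_diff power_int_minus field_simps)
  then show ?thesis
    using K_K_level[OF assms] L_L_level[OF assms]
    by (simp add: C_def cas_EF[OF q_nz q2_ne_1 uq'] vector_smult_assoc vector_sadd_rdistrib add.assoc)
qed

end

text \<open>Polynomials are given by their list of roots, so that eigenvalues are inserted factor by
  factor. The head of the list is the factor that acts last.\<close>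

definition root_poly :: "complex^'n^'n \<Rightarrow> complex list \<Rightarrow> complex^'n^'n" where
  "root_poly X as = foldr (\<lambda>a M. (X - mat_smult a (mat 1)) ** M) as (mat 1)"

lemma root_poly_Nil [simp]: "root_poly X [] *v v = v"
  and root_poly_Cons [simp]: "root_poly X (a # as) *v v = X *v (root_poly X as *v v) - a *s (root_poly X as *v v)"
  by (simp_all add: root_poly_def mv_simps)

lemma root_poly_append: "root_poly X (as @ bs) *v v = root_poly X as *v (root_poly X bs *v v)"
  by (induction as) simp_all

lemma commute_root_poly: "commute Y X \<Longrightarrow> commute Y (root_poly X as)"
  by (induction as) (auto simp: root_poly_def intro!: commute_intros)

lemma root_poly_eigen:
  "X *v v = a *s v \<Longrightarrow> root_poly X as *v v = (\<Prod>b\<leftarrow>as. a - b) *s v"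
proof (induction as)
  case (Cons b as)
  then show ?case by (simp add: vec.scale vector_smult_assoc) (simp add: vec_eq_iff algebra_simps)
qed simp

section \<open>Strings, the highest weight projector, and the separation of the commutant\<close>

context three_strings
begin

lemma commutant_root_poly: "X \<in> commutant \<Longrightarrow> root_poly X as \<in> commutant"
  by (induction as) (auto simp: root_poly_def intro!: commutant_mult commutant_diff commutant_smc commutant_1)

lemma C_commute: "z \<in> commutant \<Longrightarrow> C *v (z *v v) = z *v (C *v v)"
proof -
  assume "z \<in> commutant"
  then have "commute z C" unfolding C_def cas_def commutant_def
    by (auto intro!: commute_intros)
  then show ?thesis by (rule commuteD[symmetric])
qed

lemma C_E: "C *v (E *v v) = E *v (C *v v)" and C_F: "C *v (F *v v) = F *v (C *v v)"
  using C_commutant by (auto simp: commutant_def commuteD)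

lemma lam_sq_nz: "lam^2 \<noteq> 0" using q_diff_nz by simp

lemma C_hw: "hw n v \<Longrightarrow> C *v v = chi q (wt n) *s v"
  using C_FE[of n v] by (simp add: hw_def)

lemma scale_eq_imp: "a *s v = b *s v \<Longrightarrow> v \<noteq> (0 :: complex^'N) \<Longrightarrow> a = b"
  by (simp add: vector_mul_rcancel)

text \<open>If the weight were negative, no lowering step could give zero, and the string would
  reach levels that do not exist.\<close>

lemma hw_nonneg:
  assumes "hw n v" "v \<noteq> 0" shows "2 * n \<le> D"
proof (rule ccontr)
  assume neg: "\<not> 2 * n \<le> D"
  let ?f = "\<lambda>r. ((*v) F ^^ r) v"
  have "?f r \<noteq> 0 \<and> level (n + r) (?f r) \<and> C *v ?f r = chi q (wt n) *s ?f r" for r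
  proof (induction r)
    case 0 then show ?case using assms C_hw by (simp add: hw_def)
  next
    case (Suc r)
    have "F *v ?f r \<noteq> 0"
    proof
      assume "F *v ?f r = 0"
      \<comment> \<open>By \<open>chi_eq_iff\<close> this forces \<open>wt n = int r\<close>, which
        is impossible for a negative weight.\<close>
      then have "chi q (wt n) = chi q (wt (n + r) - 2)"
        using C_EF[of "n + r" "?f r"] Suc by (auto intro: scale_eq_imp)
      then show False using neg by (simp add: chi_eq_iff wt_def)
    qed
    then show ?case using Suc F_level[of "n + r" "?f r"] by (simp add: C_F vec.scale)
  qed
  moreover have "D < n + Suc D" by simp
  ultimately show False using level_big by blast
qed

text \<open>The mirror image of \<open>hw_nonneg\<close>: a vector of positive weight killed by
  \<open>F\<close> would have nonzero images under all powers of \<open>E\<close> up to the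
  (n+1)-st, but \<open>E\<close> vanishes on level 0.\<close>

lemma F_inj:
  assumes "level n y" "2 * n < D" "F *v y = 0" shows "y = 0"
proof (rule ccontr)
  assume nz: "y \<noteq> 0"
  let ?f = "\<lambda>r. ((*v) E ^^ r) y"
  have Cy: "C *v y = chi q (wt n - 2) *s y" using C_EF[OF assms(1)] assms(3) by simp
  have step: "E *v ?f r \<noteq> 0" if "level (n - r) (?f r)" "?f r \<noteq> 0" "C *v ?f r = chi q (wt n - 2) *s ?f r" "r \<le> n" for r
  proof
    assume "E *v ?f r = 0"
    then have "chi q (wt n - 2) = chi q (wt (n - r))"
      using C_FE[OF that(1)] that by (auto intro: scale_eq_imp)
    then show False using assms(2) that(4) by (simp add: chi_eq_iff wt_def)
  qed
  have "r \<le> n \<Longrightarrow> ?f r \<noteq> 0 \<and> level (n - r) (?f r) \<and> C *v ?f r = chi q (wt n - 2) *s ?f r" for r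
  proof (induction r)
    case 0 then show ?case using assms nz Cy by simp
  next
    case (Suc r)
    then show ?case using step[of r] E_level[of "n - r" "?f r"] by (simp add: C_E vec.scale)
  qed
  from this[of n] step[of n] E_level_0[of "?f n"] show False by auto
qed

lemma E_pow_level: "level n x \<Longrightarrow> level (n - t) (((*v) E ^^ t) x)"
proof (induction t)
  case (Suc t)
  then show ?case using E_level[of "n - t" "((*v) E ^^ t) x"] by simp
qed simp

text \<open>The factor with index r, moved behind the r-th power of \<open>E\<close>, acts on level
  n - r, where \<open>C_FE\<close> turns it into \<open>lam^2\<close> times \<open>F E\<close>. The
  bound on r keeps the subtraction n - r exact for every factor.\<close>

lemma root_poly_C_FE:
  "level n x \<Longrightarrow> r \<le> Suc n \<Longrightarrow>
    root_poly C (map (\<lambda>i. chi q (wt n + 2 * int i)) [0..<r]) *v x = lam ^ (2 * r) *s ((*v) F ^^ r) (((*v) E ^^ r) x)"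
proof (induction r arbitrary: x)
  case (Suc r)
  let ?y = "C *v x - chi q (wt n + 2 * int r) *s x"
  note levE = E_pow_level[OF Suc.prems(1)]
  have lin: "((*v) X ^^ t) (a *s u - b *s w) = a *s ((*v) X ^^ t) u - b *s ((*v) X ^^ t) w" for X :: "complex^'N^'N" and t a b u w
    by (induction t) (simp_all add: mv_simps)
  have lin1: "((*v) X ^^ t) (u - b *s w) = ((*v) X ^^ t) u - b *s ((*v) X ^^ t) w" for X :: "complex^'N^'N" and t b u w
    using lin[of t X 1 u b w] by simp
  have lin2: "((*v) X ^^ t) (a *s u) = a *s ((*v) X ^^ t) u" for X :: "complex^'N^'N" and t a u
    using lin[of t X a u 0 0] by simp
  have CE: "((*v) E ^^ t) (C *v u) = C *v (((*v) E ^^ t) u)" for t u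
    by (induction t) (simp_all add: C_E)
  have yl: "level n ?y" using Suc.prems level_commutant[OF C_commutant] by (auto intro!: level_diff level_scale)
  have "wt (n - r) = wt n + 2 * int r" using Suc.prems by (simp add: wt_def)
  then have "((*v) E ^^ r) ?y = lam^2 *s (F *v (E *v ((*v) E ^^ r) x))"
    using C_FE[OF levE[of r]] Suc.prems by (simp add: lin1 CE)
  then have "lam ^ (2 * r) *s ((*v) F ^^ r) (((*v) E ^^ r) ?y)
      = lam ^ (2 * Suc r) *s ((*v) F ^^ Suc r) (((*v) E ^^ Suc r) x)"
    by (simp add: lin2 vector_smult_assoc funpow_swap1 power_add[symmetric] mult.commute)
  then show ?case using Suc.IH[OF yl] Suc.prems by (simp add: root_poly_append)
qed simp

text \<open>
  On a weight space of weight \<open>w\<close> the product of \<open>C - \<chi>(w + 2 i)\<close> over \<open>i < r\<close> is a multiple of \<open>F\<^sup>r E\<^sup>r\<close>. Leaving out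
  the factor \<open>i = 0\<close> gives a polynomial in \<open>C\<close> that projects onto the highest weight vectors, up to a scalar.
\<close>

definition hw_proj :: "nat \<Rightarrow> complex^'N^'N" where
  "hw_proj n = root_poly C (map (\<lambda>i. chi q (wt n + 2 * int i)) [1..<Suc n])"

text \<open>Restoring the factor i = 0 gives a multiple of \<open>F E\<close> powers of exponent n +
  1, which vanish on level n. So \<open>C\<close> has eigenvalue \<open>chi q (wt n)\<close> on the
  projected vector, whence \<open>F E\<close> kills it, and injectivity of \<open>F\<close> one
  level up leaves \<open>E\<close> alone.\<close>

lemma hw_proj_hw:
  assumes "level n x" "2 * n \<le> D" shows "hw n (hw_proj n *v x)"
proof -
  let ?y = "hw_proj n *v x"
  have yl: "level n ?y" unfolding hw_proj_def by (rule level_commutant[OF commutant_root_poly[OF C_commutant] assms(1)])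
  from E_pow_level[OF assms(1), of n] have "((*v) E ^^ Suc n) x = 0" using E_level_0[of "((*v) E ^^ n) x"] by simp
  moreover have "((*v) F ^^ t) 0 = 0" for t by (induction t) simp_all
  ultimately have "root_poly C (map (\<lambda>i. chi q (wt n + 2 * int i)) [0..<Suc n]) *v x = 0"
    using root_poly_C_FE[OF assms(1), of "Suc n"] by (simp del: upt_Suc)
  moreover have "[0..<Suc n] = 0 # [1..<Suc n]" using upt_conv_Cons[of 0 "Suc n"] by (simp del: upt_Suc)
  ultimately have "C *v ?y = chi q (wt n) *s ?y" by (simp add: hw_proj_def del: upt_Suc)
  then have "lam^2 *s (F *v (E *v ?y)) = 0" using C_FE[OF yl] by simp
  then have FE0: "F *v (E *v ?y) = 0" using lam_sq_nz by (simp add: vec.scale_eq_0_iff)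
  have "E *v ?y = 0"
  proof (cases n)
    case 0 then show ?thesis using yl E_level_0 by simp
  next
    case (Suc m)
    then have "2 * (n - 1) < D" using assms(2) by simp
    with F_inj[OF E_level[OF yl] _ FE0] show ?thesis by blast
  qed
  then show ?thesis using yl by (simp add: hw_def)
qed

text \<open>The scalar is a product of differences of \<open>chi q (wt n)\<close> and
  \<open>chi q (wt n + 2 i)\<close> with i positive; for a nonnegative weight neither case of
  \<open>chi_eq_iff\<close> occurs.\<close>

lemma hw_proj_scale:
  assumes "2 * n \<le> D"
  obtains a where "a \<noteq> 0" "\<And>h. hw n h \<Longrightarrow> hw_proj n *v h = a *s h"
proof
  let ?a = "\<Prod>b\<leftarrow>map (\<lambda>i. chi q (wt n + 2 * int i)) [1..<Suc n]. chi q (wt n) - b"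
  show "?a \<noteq> 0" using assms
    by (auto simp: prod_list_zero_iff chi_eq_iff wt_def simp del: upt_Suc)
  show "hw_proj n *v h = ?a *s h" if "hw n h" for h
    unfolding hw_proj_def by (rule root_poly_eigen[OF C_hw[OF that]])
qed

lemma basis_vec:
  assumes "i \<le> d1" "j \<le> d2" "k \<le> d3"
  obtains e where "level (i + j + k) e" "\<And>v i' j' k'. c e i' j' k' = (if i' = i \<and> j' = j \<and> k' = k then 1 else 0)"
proof -
  obtain v where v: "\<forall>i' j' k'. c v i' j' k' = (if i' = i \<and> j' = j \<and> k' = k then 1 else 0)"
    using c_surj[OF assms] by blast
  then have "level (i + j + k) v" by (auto simp: level_def)
  with v that show thesis by blast
qed

text \<open>The vectors dual to the coordinates are weight vectors, and every vector is their
  combination.\<close>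

lemma level_span:
  assumes "\<And>n v. level n v \<Longrightarrow> M *v v = 0"
  shows "M = 0"
proof -
  have "\<exists>f. \<forall>i j k. i \<le> d1 \<longrightarrow> j \<le> d2 \<longrightarrow> k \<le> d3 \<longrightarrow> level (i + j + k) (f i j k) \<and>
      (\<forall>i' j' k'. c (f i j k) i' j' k' = (if i' = i \<and> j' = j \<and> k' = k then 1 else 0))"
  proof -
    have "\<exists>e. i \<le> d1 \<longrightarrow> j \<le> d2 \<longrightarrow> k \<le> d3 \<longrightarrow> level (i + j + k) e \<and>
      (\<forall>i' j' k'. c e i' j' k' = (if i' = i \<and> j' = j \<and> k' = k then 1 else 0))" for i j k
      using basis_vec[of i j k] by metis
    then show ?thesis by metis
  qed
  then obtain f where f: "\<And>i j k. i \<le> d1 \<Longrightarrow> j \<le> d2 \<Longrightarrow> k \<le> d3 \<Longrightarrow> level (i + j + k) (f i j k) \<and>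
      (\<forall>i' j' k'. c (f i j k) i' j' k' = (if i' = i \<and> j' = j \<and> k' = k then 1 else 0))" by blast
  have csum: "c (sum h S) i j k = (\<Sum>x\<in>S. c (h x) i j k)" for h :: "nat \<times> nat \<times> nat \<Rightarrow> _" and S i j k
    by (induction S rule: infinite_finite_induct) (simp_all add: c_add)
  have "M *v v = 0" for v
  proof -
    let ?S = "{..d1} \<times> {..d2} \<times> {..d3}"
    have "v = (\<Sum>(i, j, k)\<in>?S. c v i j k *s f i j k)"
    proof (rule c_eqI)
      fix i' j' k'
      have "c (\<Sum>(i, j, k)\<in>?S. c v i j k *s f i j k) i' j' k' = (\<Sum>p\<in>?S. if p = (i', j', k') then c v i' j' k' else 0)"
        unfolding csum by (rule sum.cong) (auto simp: c_scale f split: if_splits)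
      also have "\<dots> = c v i' j' k'" using c_out[of i' j' k' v] by auto
      finally show "c v i' j' k' = c (\<Sum>(i, j, k)\<in>?S. c v i j k *s f i j k) i' j' k'" by simp
    qed
    moreover have "M *v (\<Sum>(i, j, k)\<in>?S. c v i j k *s f i j k) = 0"
    proof -
      have "M *v f i j k = 0" if "i \<le> d1" "j \<le> d2" "k \<le> d3" for i j k
        using f[OF that] assms by blast
      then show ?thesis by (auto simp: vec.sum vec.scale intro!: sum.neutral)
    qed
    ultimately show ?thesis by metis
  qed
  then show ?thesis by (simp add: matrix_eq)
qed

text \<open>Induction on the level. If \<open>z\<close> vanishes one level up, \<open>z v\<close> is
  itself a highest weight vector, so the projector only rescales it; but the projector commutes with
  \<open>z\<close> and can be applied to \<open>v\<close> instead. Generation by highest weight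
  vectors is thereby avoided.\<close>

lemma commutant_eq_0:
  assumes z: "z \<in> commutant" and H: "\<And>n v. hw n v \<Longrightarrow> z *v v = 0"
  shows "z = 0"
proof (rule level_span)
  have "level n v \<Longrightarrow> z *v v = 0" for n v
  proof (induction n arbitrary: v)
    case 0
    then show ?case using H[of 0 v] E_level_0 by (simp add: hw_def)
  next
    case (Suc n)
    have "E *v (z *v v) = z *v (E *v v)" using z commuteD[of z E v] by (simp add: commutant_def)
    also have "\<dots> = 0" using Suc.IH E_level[OF Suc.prems] by simp
    finally have hz: "hw (Suc n) (z *v v)" using level_commutant[OF z Suc.prems] by (simp add: hw_def)
    show ?case
    proof (rule ccontr)
      assume nz: "z *v v \<noteq> 0"
      then have le: "2 * Suc n \<le> D" using hw_nonneg hz by blast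
      obtain a where a: "a \<noteq> 0" "\<And>h. hw (Suc n) h \<Longrightarrow> hw_proj (Suc n) *v h = a *s h" using hw_proj_scale[OF le] by blast
      have "commute z (hw_proj (Suc n))"
        unfolding hw_proj_def using C_commute[OF z] by (intro commute_root_poly) (simp add: commute_vec)
      \<comment> \<open>The projector is moved across \<open>z\<close>: on \<open>z v\<close> it is
        a nonzero scalar, on \<open>v\<close> it produces a highest weight vector.\<close>
      then have "a *s (z *v v) = z *v (hw_proj (Suc n) *v v)" using a(2)[OF hz] commuteD[of z "hw_proj (Suc n)" v] by simp
      also have "\<dots> = 0" by (rule H[OF hw_proj_hw[OF Suc.prems le]])
      finally show False using a nz by (simp add: vec.scale_eq_0_iff)
    qed
  qed
  then show "level n v \<Longrightarrow> z *v v = 0" for n v .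
qed

end

section \<open>Bidiagonal models of the Askey--Wilson relations\<close>

text \<open>The coefficient of \<open>x i\<close> in the cubic relation below; \<open>t\<close> and
  \<open>y\<close> are diagonal entries of \<open>A\<close> and \<open>B\<close>, and
  \<open>Z\<close>, \<open>Z'\<close> the products of opposite off-diagonal entries on either side.
  After removal of a factor q - p, an expansion in \<open>x1\<close> and \<open>x3\<close> leaves
  one identity per monomial: \<open>c13\<close>, \<open>c1\<close>, \<open>c3\<close> and
  \<open>c0\<close>.\<close>

lemma aw_diagonal_identity:
  fixes q p b b' X X' Y Y' x1 x3 :: complex
  assumes qp: "q * p = 1" and bb: "b * b' = 1" and XX: "X * X' = 1" and YY: "Y * Y' = 1"
    and x2: "x2 = b + b'" and C: "C = X * Y * b' + X' * Y' * b"
    and t: "t = X + X'" and y: "y = Y + Y'" 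
    and Z: "Z = (x1 - (b * p * X' + X * b' * q)) * (x3 - (b * q * Y' + Y * b' * p))"
    and Z': "Z' = (x1 - (b * q * X' + X * b' * p)) * (x3 - (b * p * Y' + Y * b' * q))"
  shows "(q^2 - p^2)^2 * t + (q - p)^2 * (x1 * x3 + x2 * C) * y
    - ((q^2 + p^2) * (y * (t * y + Z) + Z' * y) - (y^2 * t + Z' * (y + (q^2 * Y + p^2 * Y')))
        - (t * y^2 + Z * ((p^2 * Y + q^2 * Y') + y)))
    = (q - p)^2 * (q + p) * (x1 * x2 + x3 * C)"
proof -
  \<comment> \<open>Chosen so that the neighbouring diagonal entries of \<open>B\<close> are a
    common multiple of \<open>y\<close> minus (q - p) times \<open>u\<close> or \<open>u'\<close>,
    which exposes the common factor q - p.\<close>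
  define u u' where "u = q * Y' - p * Y" and "u' = q * Y - p * Y'"
  have Q: "q^2 + p^2 = (q - p)^2 + 2" using qp by (simp add: power2_eq_square algebra_simps)
  have QQ: "(q^2 - p^2)^2 = (q - p)^2 * (q + p)^2" by (simp add: power2_eq_square algebra_simps)
  have qp': "q * (p * z) = z" "p * (q * z) = z" for z
    using qp by (simp_all add: mult.assoc[symmetric] mult.commute[of p])
  have 1: "q^2 * Y + p^2 * Y' = ((q - p)^2 + 1) * y - (q - p) * u"
    "p^2 * Y + q^2 * Y' = ((q - p)^2 + 1) * y - (q - p) * u'"
    unfolding y u_def u'_def using qp by (simp_all add: power2_eq_square algebra_simps qp')
  have 2: "(q^2 - p^2)^2 * t + (q - p)^2 * (x1 * x3 + x2 * C) * y
    - ((q^2 + p^2) * (y * (t * y + Z) + Z' * y) - (y^2 * t + Z' * (y + (q^2 * Y + p^2 * Y')))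
        - (t * y^2 + Z * ((p^2 * Y + q^2 * Y') + y)))
    = (q - p) * ((q - p) * (t * ((q + p)^2 - y^2)) + (q - p) * (x1 * x3 + x2 * C) * y - Z' * u - Z * u')"
    unfolding 1 Q QQ by (simp add: power2_eq_square algebra_simps)
  have c13: "(q - p) * y = u + u'" unfolding y u_def u'_def by (simp add: algebra_simps)
  have c1: "(b * p * Y' + Y * b' * q) * u + (b * q * Y' + Y * b' * p) * u' = (q - p) * (q + p) * x2"
  proof -
    have "(b * p * Y' + Y * b' * q) * u + (b * q * Y' + Y * b' * p) * u' - (q - p) * (q + p) * x2
      = (Y * Y' - 1) * (q - p) * (q + p) * x2"
      unfolding u_def u'_def x2 by (simp add: algebra_simps)
    then show ?thesis using YY by simp
  qed
  have c3: "(b * q * X' + X * b' * p) * u + (b * p * X' + X * b' * q) * u' = (q - p) * (q + p) * C"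
    unfolding u_def u'_def C by (simp add: algebra_simps)
  have nz: "q \<noteq> 0" "b \<noteq> 0" "X \<noteq> 0" "Y \<noteq> 0" using assms by auto
  have inv: "p = 1/q" "b' = 1/b" "X' = 1/X" "Y' = 1/Y" using assms nz by (simp_all add: field_simps)
  have c0: "(b * q * X' + X * b' * p) * (b * p * Y' + Y * b' * q) * u
     + (b * p * X' + X * b' * q) * (b * q * Y' + Y * b' * p) * u'
    = (q - p) * (t * ((q + p)^2 - y^2)) + (q - p) * (x2 * C) * y"
    unfolding u_def u'_def C t x2 y inv using nz by (simp add: field_simps power2_eq_square)
  have "Z' * u + Z * u' = x1 * x3 * ((q - p) * y) - x1 * ((q - p) * (q + p) * x2) - x3 * ((q - p) * (q + p) * C)
     + ((q - p) * (t * ((q + p)^2 - y^2)) + (q - p) * (x2 * C) * y)"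
    unfolding Z Z' c0[symmetric] c1[symmetric] c3[symmetric] c13 by (simp add: algebra_simps)
  then have "(q - p) * (t * ((q + p)^2 - y^2)) + (q - p) * (x1 * x3 + x2 * C) * y - Z' * u - Z * u'
     = (q - p) * (q + p) * (x1 * x2 + x3 * C)"
    by (simp add: algebra_simps)
  then show ?thesis unfolding 2 by (simp add: power2_eq_square mult.assoc)
qed

text \<open>The coefficient of the superdiagonal neighbour. In an expansion in \<open>x1\<close> and
  \<open>x3\<close> the linear terms cancel by the three-term recurrences \<open>P\<close>; what
  remains is free of \<open>x1\<close> and \<open>x3\<close>.\<close>

lemma aw_upper_identity:
  fixes q p b b' X X' Y Y' x1 x3 :: complex
  assumes qp: "q * p = 1" and bb: "b * b' = 1" and XX: "X * X' = 1" and YY: "Y * Y' = 1"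
    and x2: "x2 = b + b'" and C: "C = X * Y * b' + X' * Y' * b"
    and t: "t = X + X'" "t' = p^2 * X + q^2 * X'" and y: "y = Y + Y'" "y' = q^2 * Y + p^2 * Y'"
    and Z: "Z0 = (x1 - (b * p * X' + X * b' * q)) * (x3 - (b * q * Y' + Y * b' * p))"
      "Z1 = (x1 - (b * q * X' + X * b' * p)) * (x3 - (b * p * Y' + Y * b' * q))"
      "Z2 = (x1 - (b * q^3 * X' + X * b' * p^3)) * (x3 - (b * p^3 * Y' + Y * b' * q^3))"
  shows "(q - p)^2 * (x1 * x3 + x2 * C)
    = (q^2 + p^2) * (y * t + t' * y' + Z1) - (y + y') * (t + t') - Z2 - Z0"
proof -
  have nz: "q \<noteq> 0" "b \<noteq> 0" "X \<noteq> 0" "Y \<noteq> 0" using assms by auto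
  have inv: "p = 1/q" "b' = 1/b" "X' = 1/X" "Y' = 1/Y" using assms nz by (simp_all add: field_simps)
  have P: "(q^2 + p^2) * (b * q * X' + X * b' * p) = (b * q^3 * X' + X * b' * p^3) + (b * p * X' + X * b' * q)"
    "(q^2 + p^2) * (b * p * Y' + Y * b' * q) = (b * p^3 * Y' + Y * b' * q^3) + (b * q * Y' + Y * b' * p)"
    unfolding inv using nz by (simp_all add: field_simps power2_eq_square power3_eq_cube)
  have Q: "q^2 + p^2 = (q - p)^2 + 2" using qp by (simp add: power2_eq_square algebra_simps)
  have c0: "(q^2 + p^2) * ((b * q * X' + X * b' * p) * (b * p * Y' + Y * b' * q))
    - (b * q^3 * X' + X * b' * p^3) * (b * p^3 * Y' + Y * b' * q^3) - (b * p * X' + X * b' * q) * (b * q * Y' + Y * b' * p)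
    + (q^2 + p^2) * (y * t + t' * y') - (y + y') * (t + t') = (q - p)^2 * (x2 * C)"
    unfolding t y x2 C inv using nz by (simp add: field_simps power2_eq_square power3_eq_cube)
  define u1 u2 u3 v1 v2 v3 where "u1 = b * p * X' + X * b' * q" "u2 = b * q * X' + X * b' * p" "u3 = b * q^3 * X' + X * b' * p^3"
    "v1 = b * q * Y' + Y * b' * p" "v2 = b * p * Y' + Y * b' * q" "v3 = b * p^3 * Y' + Y * b' * q^3"
  note P = P[folded this] and c0 = c0[folded this] and Z = Z[folded this]
  have "(q^2 + p^2) * Z1 - Z2 - Z0 = (q^2 + p^2 - 2) * (x1 * x3) - x1 * ((q^2 + p^2) * v2 - v3 - v1) - x3 * ((q^2 + p^2) * u2 - u3 - u1)
     + ((q^2 + p^2) * (u2 * v2) - u3 * v3 - u1 * v1)"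
    unfolding Z by (simp add: algebra_simps)
  also have "\<dots> = (q - p)^2 * (x1 * x3) + ((q^2 + p^2) * (u2 * v2) - u3 * v3 - u1 * v1)"
    unfolding P using Q by simp
  finally have S: "(q^2 + p^2) * Z1 - Z2 - Z0 = (q - p)^2 * (x1 * x3) + ((q^2 + p^2) * (u2 * v2) - u3 * v3 - u1 * v1)" .
  have "(q^2 + p^2) * (y * t + t' * y' + Z1) - (y + y') * (t + t') - Z2 - Z0
    = ((q^2 + p^2) * Z1 - Z2 - Z0) + ((q^2 + p^2) * (y * t + t' * y') - (y + y') * (t + t'))"
    by (simp add: algebra_simps)
  also have "\<dots> = (q - p)^2 * (x1 * x3) + ((q^2 + p^2) * (u2 * v2) - u3 * v3 - u1 * v1
      + (q^2 + p^2) * (y * t + t' * y') - (y + y') * (t + t'))"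
    unfolding S by simp
  also have "\<dots> = (q - p)^2 * (x1 * x3 + x2 * C)" unfolding c0 by (simp add: algebra_simps)
  finally show ?thesis by simp
qed

text \<open>The quadratic relation between adjacent eigenvalues of Askey--Wilson type; it makes the
  coefficient of the subdiagonal neighbour vanish.\<close>

lemma aw_neighbour_identity:
  fixes q p X X' :: complex
  assumes qp: "q * p = 1" and XX: "X * X' = 1"
  shows "(q^2 + p^2) * ((X + X') * (p^2 * X + q^2 * X')) = (X + X')^2 + (p^2 * X + q^2 * X')^2 + (q^2 - p^2)^2"
proof -
  have nz: "q \<noteq> 0" "X \<noteq> 0" using assms by auto
  have inv: "p = 1/q" "X' = 1/X" using assms nz by (simp_all add: field_simps)
  show ?thesis unfolding inv using nz by (simp add: field_simps power2_eq_square)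
qed

definition opA :: "(int \<Rightarrow> complex) \<Rightarrow> (int \<Rightarrow> complex) \<Rightarrow> (int \<Rightarrow> complex) \<Rightarrow> int \<Rightarrow> complex" where
  "opA t A_sub x j = t j * x j + A_sub j * x (j - 1)"

definition opB :: "(int \<Rightarrow> complex) \<Rightarrow> (int \<Rightarrow> complex) \<Rightarrow> (int \<Rightarrow> complex) \<Rightarrow> int \<Rightarrow> complex" where
  "opB y B_super x j = y j * x j + B_super j * x (j + 1)"

text \<open>The sequences are indexed by integers so that no boundary cases arise; \<open>Z j\<close> is the product
  of an entry of \<open>A\<close> and the transposed entry of \<open>B\<close>, and \<open>C\<close> is a scalar.\<close>

context
  fixes q p b b' X X' Y Y' x1 x2 x3 C :: complex and i :: int
    and t A_sub y B_super Z :: "int \<Rightarrow> complex"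
  assumes qp: "q * p = 1" and bb: "b * b' = 1" and XX: "X * X' = 1" and YY: "Y * Y' = 1"
    and x2: "x2 = b + b'" and C: "C = X * Y * b' + X' * Y' * b"
    and t: "t i = X + X'" "t (i + 1) = p^2 * X + q^2 * X'" "t (i - 1) = q^2 * X + p^2 * X'" 
    and y: "y i = Y + Y'" "y (i + 1) = q^2 * Y + p^2 * Y'" "y (i - 1) = p^2 * Y + q^2 * Y'" 
    and Z: "Z i = (x1 - (b * p * X' + X * b' * q)) * (x3 - (b * q * Y' + Y * b' * p))"
      "Z (i + 1) = (x1 - (b * q * X' + X * b' * p)) * (x3 - (b * p * Y' + Y * b' * q))"
    and phps: "A_sub i * B_super (i - 1) = Z i" "A_sub (i + 1) * B_super i = Z (i + 1)"
begin

text \<open>The words involved reach only from position i - 1 to i + 2, with coefficients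
  \<open>cm\<close>, \<open>c0\<close>, \<open>c1\<close>, \<open>c2\<close> that are settled
  separately. The product formula at i + 2 is required only after multiplication by
  \<open>B_super i\<close>: beyond the edge of the range the entries need not satisfy it.\<close>

lemma aw_sequence_relation_A:
  assumes t2: "t (i + 2) = p^4 * X + q^4 * X'" 
    and Z2: "Z (i + 2) = (x1 - (b * q^3 * X' + X * b' * p^3)) * (x3 - (b * p^3 * Y' + Y * b' * q^3))"
      "B_super i * (A_sub (i + 2) * B_super (i + 1)) = B_super i * Z (i + 2)"
  shows "(q^2 - p^2)^2 * opA t A_sub x i + (q - p)^2 * (x1 * x3 + x2 * C) * opB y B_super x i
     - ((q^2 + p^2) * opB y B_super (opA t A_sub (opB y B_super x)) i - opB y B_super (opB y B_super (opA t A_sub x)) i - opA t A_sub (opB y B_super (opB y B_super x)) i)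
    = (q - p)^2 * (q + p) * (x1 * x2 + x3 * C) * x i"
proof -
  have i2: "i + 1 + 1 = i + 2" by simp
  define c0 cm c1 c2 where 
    "c0 = (q^2 - p^2)^2 * t i + (q - p)^2 * (x1 * x3 + x2 * C) * y i
    - ((q^2 + p^2) * (y i * (t i * y i + Z i) + Z (i + 1) * y i) - ((y i)^2 * t i + Z (i + 1) * (y i + y (i + 1)))
        - (t i * (y i)^2 + Z i * (y (i - 1) + y i)))"
    and "cm = (q^2 - p^2)^2 - ((q^2 + p^2) * (y i * y (i - 1)) - (y i)^2 - (y (i - 1))^2)"
    and "c1 = (q - p)^2 * (x1 * x3 + x2 * C)
       - ((q^2 + p^2) * (y i * t i + t (i + 1) * y (i + 1) + Z (i + 1)) - (y i + y (i + 1)) * (t i + t (i + 1)) - A_sub (i + 2) * B_super (i + 1) - Z i)"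
    and "c2 = (q^2 + p^2) * t (i + 1) - t (i + 2) - t i"
  have "c0 = (q - p)^2 * (q + p) * (x1 * x2 + x3 * C)"
    unfolding c0_def y(2,3) by (rule aw_diagonal_identity[OF qp bb XX YY x2 C t(1) y(1) Z])
  moreover have "cm = 0"
    unfolding cm_def y(1,3) using aw_neighbour_identity[OF qp YY] by simp
  moreover have "c1 * B_super i = 0"
    using Z2(2) unfolding c1_def aw_upper_identity[OF qp bb XX YY x2 C t(1,2) y(1,2) Z Z2(1)]
    by (simp add: ring_distribs mult_ac)
  moreover have "c2 = 0"
  proof -
    have qp': "q * (p * z) = z" "p * (q * z) = z" for z
      using qp by (simp_all add: mult.assoc[symmetric] mult.commute[of p])
    show ?thesis unfolding c2_def t t2 by (simp add: power2_eq_square power4_eq_xxxx algebra_simps qp' qp[unfolded mult.commute[of q]])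
  qed
  moreover have "(q^2 - p^2)^2 * opA t A_sub x i + (q - p)^2 * (x1 * x3 + x2 * C) * opB y B_super x i
     - ((q^2 + p^2) * opB y B_super (opA t A_sub (opB y B_super x)) i - opB y B_super (opB y B_super (opA t A_sub x)) i - opA t A_sub (opB y B_super (opB y B_super x)) i)
    = c0 * x i + cm * (A_sub i * x (i - 1)) + c1 * B_super i * x (i + 1) - c2 * (B_super i * B_super (i + 1) * x (i + 2))"
    unfolding opA_def opB_def c0_def cm_def c1_def c2_def phps[symmetric]
    by (simp add: i2 power2_eq_square algebra_simps)
  ultimately show ?thesis by simp
qed

text \<open>The mirror image: reversing the direction of the index exchanges \<open>A\<close> with
  \<open>B\<close>, \<open>X\<close> with \<open>Y\<close> and \<open>x1\<close> with
  \<open>x3\<close>, so the same three identities apply.\<close>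

lemma aw_sequence_relation_B:
  assumes y2: "y (i - 2) = p^4 * Y + q^4 * Y'" 
    and Z2: "Z (i - 1) = (x1 - (b * p^3 * X' + X * b' * q^3)) * (x3 - (b * q^3 * Y' + Y * b' * p^3))"
      "A_sub i * (A_sub (i - 1) * B_super (i - 2)) = A_sub i * Z (i - 1)"
  shows "(q^2 - p^2)^2 * opB y B_super x i + (q - p)^2 * (x1 * x3 + x2 * C) * opA t A_sub x i
     - ((q^2 + p^2) * opA t A_sub (opB y B_super (opA t A_sub x)) i - opA t A_sub (opA t A_sub (opB y B_super x)) i - opB y B_super (opA t A_sub (opA t A_sub x)) i)
    = (q - p)^2 * (q + p) * (x2 * x3 + x1 * C) * x i"
proof -
  have i2: "i - 1 - 1 = i - 2" by simp
  define c0 cm c1 c2 where 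
    "c0 = (q^2 - p^2)^2 * y i + (q - p)^2 * (x1 * x3 + x2 * C) * t i
    - ((q^2 + p^2) * (t i * (y i * t i + Z (i + 1)) + Z i * t i) - ((t i)^2 * y i + Z i * (t i + t (i - 1)))
        - (y i * (t i)^2 + Z (i + 1) * (t (i + 1) + t i)))"
    and "cm = (q^2 - p^2)^2 - ((q^2 + p^2) * (t i * t (i + 1)) - (t i)^2 - (t (i + 1))^2)"
    and "c1 = (q - p)^2 * (x1 * x3 + x2 * C)
       - ((q^2 + p^2) * (y i * t i + t (i - 1) * y (i - 1) + Z i) - (y i + y (i - 1)) * (t i + t (i - 1)) - A_sub (i - 1) * B_super (i - 2) - Z (i + 1))"
    and "c2 = (q^2 + p^2) * y (i - 1) - y (i - 2) - y i"
  have C': "C = Y * X * b' + Y' * X' * b" using C by (simp add: mult.commute)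
  have "c0 = (q - p)^2 * (q + p) * (x3 * x2 + x1 * C)"
    unfolding c0_def t(2,3) mult.commute[of x1 x3]
    by (rule aw_diagonal_identity[OF qp bb YY XX x2 C' y(1) t(1)]) (simp_all add: Z mult.commute)
  moreover have "cm = 0"
    unfolding cm_def t(1,2) using aw_neighbour_identity[OF qp XX] by simp
  moreover have "c1 * A_sub i = 0"
  proof -
    have Zm: "Z (i + 1) = (x3 - (b * p * Y' + Y * b' * q)) * (x1 - (b * q * X' + X * b' * p))"
      "Z i = (x3 - (b * q * Y' + Y * b' * p)) * (x1 - (b * p * X' + X * b' * q))"
      "Z (i - 1) = (x3 - (b * q^3 * Y' + Y * b' * p^3)) * (x1 - (b * p^3 * X' + X * b' * q^3))"
      using Z Z2(1) by (simp_all add: mult.commute)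
    show ?thesis
      using Z2(2) unfolding c1_def mult.commute[of x1 x3]
        aw_upper_identity[OF qp bb YY XX x2 C' y(1,3) t(1,3) Zm]
      by (simp add: ring_distribs mult_ac)
  qed
  moreover have "c2 = 0"
  proof -
    have qp': "q * (p * z) = z" "p * (q * z) = z" for z
      using qp by (simp_all add: mult.assoc[symmetric] mult.commute[of p])
    show ?thesis unfolding c2_def y y2 by (simp add: power2_eq_square power4_eq_xxxx algebra_simps qp' qp[unfolded mult.commute[of q]])
  qed
  moreover have "(q^2 - p^2)^2 * opB y B_super x i + (q - p)^2 * (x1 * x3 + x2 * C) * opA t A_sub x i
     - ((q^2 + p^2) * opA t A_sub (opB y B_super (opA t A_sub x)) i - opA t A_sub (opA t A_sub (opB y B_super x)) i - opB y B_super (opA t A_sub (opA t A_sub x)) i)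
    = c0 * x i + cm * (B_super i * x (i + 1)) + c1 * A_sub i * x (i - 1) - c2 * (A_sub i * A_sub (i - 1) * x (i - 2))"
    unfolding opA_def opB_def c0_def cm_def c1_def c2_def phps[symmetric]
    by (simp add: i2 power2_eq_square algebra_simps)
  ultimately show ?thesis by (simp add: mult.commute)
qed

end

section \<open>Bidiagonal coordinates of highest weight vectors\<close>

context three_strings
begin

text \<open>
  A highest weight vector \<open>v\<close> of level \<open>n\<close> is determined by its coordinates \<open>c v i 0 (n - i)\<close>. In these
  coordinates \<open>A\<close> and \<open>B\<close> are bidiagonal in opposite directions, because \<open>E *v v = 0\<close> turns \<open>E12\<close> into a
  multiple of \<open>E3\<close> and \<open>E23\<close> into a multiple of \<open>E1\<close>, while \<open>F2\<close> does not contribute when the middle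
  index is \<open>0\<close>.
\<close>

definition split_coord :: "nat \<Rightarrow> complex^'N \<Rightarrow> int \<Rightarrow> complex" where
  "split_coord n v i = (if 0 \<le> i \<and> i \<le> int n then c v (nat i) 0 (nat (int n - i)) else 0)"

definition A_diag :: "int \<Rightarrow> complex" where "A_diag i = chi q (int d1 + int d2 - 2 * i)"
definition B_diag :: "nat \<Rightarrow> int \<Rightarrow> complex" where "B_diag n i = chi q (int d2 + int d3 - 2 * int n + 2 * i)"
definition A_sub :: "nat \<Rightarrow> int \<Rightarrow> complex" where
  "A_sub n i = - (lam^2) * s powi (int d1 + int d3 - 2 * int n + 2) * g1 (nat i) * g3 (nat (int n + 1 - i))"
definition B_super :: "nat \<Rightarrow> int \<Rightarrow> complex" where
  "B_super n i = - (lam^2) * s powi (2 * int n - 2 - int d1 - int d3) * g1 (nat (i + 1)) * g3 (nat (int n - i))"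

lemma s_powi_mult: "s powi x * s powi y = s powi (x + y)"
  using s_nz by (simp add: power_int_add)

lemma split_coord_lin: "split_coord n (v + w) i = split_coord n v i + split_coord n w i" "split_coord n (v - w) i = split_coord n v i - split_coord n w i"
  "split_coord n (a *s v) i = a * split_coord n v i"
  by (simp_all add: split_coord_def c_lin)

lemma c_F12: "c (F12 *v v) i j k = g1 i * s powi (2 * int j - int d2) * c v (i - 1) j k
    + s powi (int d1 - 2 * int i) * g2 j * c v i (j - 1) k"
  and c_F23: "c (F23 *v v) i j k = g2 j * s powi (2 * int k - int d3) * c v i (j - 1) k
    + s powi (int d2 - 2 * int j) * g3 k * c v i j (k - 1)"
  by (simp_all add: F12_def F23_def mv_simps c_lin c_gen)

lemma c_A: "c (A *v v) i j k = lam^2 * c (F12 *v (E12 *v v)) i j k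
    + chi q (int d1 + int d2 - 2 * int i - 2 * int j) * c v i j k"
proof -
  define m where "m = int d1 + int d2 - 2 * int i - 2 * int j"
  have m: "m = (int d1 - 2 * int i) + (int d2 - 2 * int j)" by (simp add: m_def)
  have K: "c (K12 *v w) i j k = s powi m * c w i j k" for w
    by (simp add: m K12_def mv_simps c_gen power_int_add s_nz)
  define m' where "m' = (2 * int i - int d1) + (2 * int j - int d2)"
  have "m' = - m" by (simp add: m'_def m_def)
  moreover have "c (L12 *v w) i j k = s powi m' * c w i j k" for w
    by (simp add: m'_def L12_def mv_simps c_gen power_int_add s_nz)
  ultimately have L: "c (L12 *v w) i j k = s powi (- m) * c w i j k" for w by simp
  have "chi q m = q * (s powi m * s powi m) + inverse q * (s powi (- m) * s powi (- m))"
    unfolding s_powi_square using q_nz by (simp add: chi_def power_int_add power_int_diff field_simps)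
  then show ?thesis
    unfolding A_def cas_def by (simp add: mv_simps c_lin K L m_def[symmetric] ring_distribs)
qed

lemma c_B: "c (B *v v) i j k = lam^2 * c (F23 *v (E23 *v v)) i j k
    + chi q (int d2 + int d3 - 2 * int j - 2 * int k) * c v i j k"
proof -
  define m where "m = int d2 + int d3 - 2 * int j - 2 * int k"
  have m: "m = (int d2 - 2 * int j) + (int d3 - 2 * int k)" by (simp add: m_def)
  have K: "c (K23 *v w) i j k = s powi m * c w i j k" for w
    by (simp add: m K23_def mv_simps c_gen power_int_add s_nz)
  define m' where "m' = (2 * int j - int d2) + (2 * int k - int d3)"
  have "m' = - m" by (simp add: m'_def m_def)
  moreover have "c (L23 *v w) i j k = s powi m' * c w i j k" for w
    by (simp add: m'_def L23_def mv_simps c_gen power_int_add s_nz)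
  ultimately have L: "c (L23 *v w) i j k = s powi (- m) * c w i j k" for w by simp
  have "chi q m = q * (s powi m * s powi m) + inverse q * (s powi (- m) * s powi (- m))"
    unfolding s_powi_square using q_nz by (simp add: chi_def power_int_add power_int_diff field_simps)
  then show ?thesis
    unfolding B_def cas_def by (simp add: mv_simps c_lin K L m_def[symmetric] ring_distribs)
qed

lemma hw_E12:
  assumes "hw n v"
  shows "c (E12 *v v) i j k = - (s powi (int d3 - 2 * int k) * s powi (int d1 - 2 * int i) * s powi (int d2 - 2 * int j) * g3 (Suc k)) * c v i j (Suc k)"
proof -
  have "E *v v = L3 *v (E12 *v v) + K12 *v (E3 *v v)"
    using commute_slots(2)[of E1 E2 L3] commute_slots(2)[of K1 E2 L3] commute_slots(3)[of E1 L2 L3] commute_slots(3)[of E1 E2 L3]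
    unfolding E_split(1) E12_def by (simp add: mv_simps commute_vec)
  then have "0 = c (L3 *v (E12 *v v) + K12 *v (E3 *v v)) i j k" using assms by (simp add: hw_def)
  also have "\<dots> = s powi (2 * int k - int d3) * c (E12 *v v) i j k
      + s powi (int d1 - 2 * int i) * s powi (int d2 - 2 * int j) * g3 (Suc k) * c v i j (Suc k)"
    by (simp add: K12_def mv_simps c_lin c_gen)
  finally have *: "s powi (2 * int k - int d3) * c (E12 *v v) i j k
      = - (s powi (int d1 - 2 * int i) * s powi (int d2 - 2 * int j) * g3 (Suc k)) * c v i j (Suc k)"
    by (simp add: eq_neg_iff_add_eq_0 add.commute)
  have "s powi (int d3 - 2 * int k) * s powi (2 * int k - int d3) = 1"
    using s_nz by (simp add: power_int_add[symmetric])
  then have "c (E12 *v v) i j k = s powi (int d3 - 2 * int k) * (s powi (2 * int k - int d3) * c (E12 *v v) i j k)"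
    by (simp add: mult.assoc[symmetric])
  then show ?thesis unfolding * by simp
qed

lemma hw_E23:
  assumes "hw n v"
  shows "c (E23 *v v) i j k = - (s powi (2 * int i - int d1) * s powi (2 * int j - int d2) * s powi (2 * int k - int d3) * g1 (Suc i)) * c v (Suc i) j k"
proof -
  have "0 = c (E1 *v (L23 *v v) + K1 *v (E23 *v v)) i j k" using assms by (simp add: hw_def E_split(2) mv_simps)
  also have "\<dots> = g1 (Suc i) * s powi (2 * int j - int d2) * s powi (2 * int k - int d3) * c v (Suc i) j k
      + s powi (int d1 - 2 * int i) * c (E23 *v v) i j k"
    by (simp add: L23_def mv_simps c_lin c_gen)
  finally have *: "s powi (int d1 - 2 * int i) * c (E23 *v v) i j k
      = - (g1 (Suc i) * s powi (2 * int j - int d2) * s powi (2 * int k - int d3)) * c v (Suc i) j k"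
    by (simp add: eq_neg_iff_add_eq_0 add.commute)
  have "s powi (2 * int i - int d1) * s powi (int d1 - 2 * int i) = 1"
    using s_nz by (simp add: power_int_add[symmetric])
  then have "c (E23 *v v) i j k = s powi (2 * int i - int d1) * (s powi (int d1 - 2 * int i) * c (E23 *v v) i j k)"
    by (simp add: mult.assoc[symmetric])
  then show ?thesis unfolding * by simp
qed

lemma split_coord_A:
  assumes "hw n v" shows "split_coord n (A *v v) i = A_diag i * split_coord n v i + A_sub n i * split_coord n v (i - 1)"
proof (cases "0 \<le> i \<and> i \<le> int n")
  case True
  define m where "m = nat i"
  have i: "i = int m" "m \<le> n" using True by (auto simp: m_def)
  then have k: "nat (int n - i) = n - m" by simp
  have "lam^2 * c (F12 *v (E12 *v v)) m 0 (n - m) = A_sub n i * split_coord n v (i - 1)"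
  proof (cases m)
    case 0
    then show ?thesis by (simp add: c_F12 g1 g2 A_sub_def i split_coord_def)
  next
    case (Suc l)
    then have l: "l < n" "Suc (n - m) = n - l" "nat (int n + 1 - int m) = n - l" "nat (int n - int l) = n - l" "nat (1 + int l) = Suc l" using i by auto
    \<comment> \<open>As m = l + 1, the position drops out of the exponent, which leaves the power
      of \<open>s\<close> in \<open>A_sub\<close>.\<close>
    have e: "s powi (2 * int 0 - int d2) * (s powi (int d3 - 2 * int (n - m)) * s powi (int d1 - 2 * int l) * s powi (int d2 - 2 * int 0))
       = s powi (int d1 + int d3 - 2 * int n + 2)"
      unfolding s_powi_mult using Suc i(2) by (intro arg_cong[of _ _ "(powi) s"]) (simp add: of_nat_diff)
    have "lam^2 * c (F12 *v (E12 *v v)) m 0 (n - m) = - (lam^2) * g1 m * (s powi (2 * int 0 - int d2) * (s powi (int d3 - 2 * int (n - m)) * s powi (int d1 - 2 * int l) * s powi (int d2 - 2 * int 0)))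
       * g3 (Suc (n - m)) * c v l 0 (Suc (n - m))"
      unfolding c_F12 hw_E12[OF assms] Suc by (simp add: g2)
    also have "\<dots> = A_sub n i * split_coord n v (i - 1)"
      unfolding e using l Suc by (simp add: A_sub_def split_coord_def i)
    finally show ?thesis .
  qed
  then show ?thesis using True i k by (simp add: split_coord_def[of n "A *v v"] split_coord_def[of n v "int m"] c_A A_diag_def)
next
  case False
  \<comment> \<open>The only entry that could bring a coordinate in from inside the range sits at i
    = n + 1, and it contains \<open>g3 0 = 0\<close>.\<close>
  then have "i = int n + 1 \<or> split_coord n v (i - 1) = 0" by (auto simp: split_coord_def)
  then have "A_sub n i * split_coord n v (i - 1) = 0" by (auto simp: A_sub_def g3)
  then show ?thesis using False by (auto simp: split_coord_def[of n "A *v v" i] split_coord_def[of n v i])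
qed

lemma split_coord_B:
  assumes "hw n v" shows "split_coord n (B *v v) i = B_diag n i * split_coord n v i + B_super n i * split_coord n v (i + 1)"
proof (cases "0 \<le> i \<and> i \<le> int n")
  case True
  define m where "m = nat i"
  have i: "i = int m" "m \<le> n" using True by (auto simp: m_def)
  then have k: "nat (int n - i) = n - m" by simp
  have "lam^2 * c (F23 *v (E23 *v v)) m 0 (n - m) = B_super n i * split_coord n v (i + 1)"
  proof (cases "m = n")
    case True
    then show ?thesis by (simp add: c_F23 g2 g3 B_super_def i split_coord_def)
  next
    case False
    then have l: "m < n" "n - m - 1 = n - Suc m" "nat (int n - int m) = n - m" "nat (int n - (int m + 1)) = n - Suc m" "nat (int m + 1) = Suc m" using i by auto
    have e: "s powi (int d2 - 2 * int 0) * (s powi (2 * int m - int d1) * s powi (2 * int 0 - int d2) * s powi (2 * int (n - Suc m) - int d3))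
       = s powi (2 * int n - 2 - int d1 - int d3)"
      unfolding s_powi_mult using l(1) by (intro arg_cong[of _ _ "(powi) s"]) (simp add: of_nat_diff)
    have "lam^2 * c (F23 *v (E23 *v v)) m 0 (n - m) = - (lam^2) * (s powi (int d2 - 2 * int 0) * (s powi (2 * int m - int d1) * s powi (2 * int 0 - int d2) * s powi (2 * int (n - Suc m) - int d3)))
       * g1 (Suc m) * g3 (n - m) * c v (Suc m) 0 (n - Suc m)"
      unfolding c_F23 hw_E23[OF assms] l(2) by (simp add: g2)
    also have "\<dots> = B_super n i * split_coord n v (i + 1)"
      unfolding e using l by (simp add: B_super_def split_coord_def i)
    finally show ?thesis .
  qed
  moreover have "int d2 + int d3 - 2 * int n + 2 * int m = int d2 + int d3 - 2 * int 0 - 2 * int (n - m)" using i by simp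
  ultimately show ?thesis using True i k by (simp add: split_coord_def[of n "B *v v"] split_coord_def[of n v "int m"] c_B B_diag_def algebra_simps)
next
  case False
  \<comment> \<open>Likewise the entry at i = - 1 contains \<open>g1 0 = 0\<close>.\<close>
  then have "i = - 1 \<or> split_coord n v (i + 1) = 0" by (auto simp: split_coord_def)
  then have "B_super n i * split_coord n v (i + 1) = 0" by (auto simp: B_super_def g1)
  then show ?thesis using False by (auto simp: split_coord_def[of n "B *v v" i] split_coord_def[of n v i])
qed

lemma g_nz: "0 < k \<Longrightarrow> k \<le> d1 \<Longrightarrow> g1 k \<noteq> 0" "0 < k \<Longrightarrow> k \<le> d2 \<Longrightarrow> g2 k \<noteq> 0" "0 < k \<Longrightarrow> k \<le> d3 \<Longrightarrow> g3 k \<noteq> 0"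
  using g1(3)[of k] g2(3)[of k] g3(3)[of k] by (auto simp: q_int_eq_0_iff)

text \<open>Induction on the middle index: the equation \<open>E v = 0\<close> expresses a
  coordinate with middle index j + 1 through coordinates with middle index j, since
  \<open>g2\<close> is nonzero within the range.\<close>

lemma split_coord_inj:
  assumes "hw n v" "\<And>i. split_coord n v i = 0" shows "v = 0"
proof -
  have "c v i j k = 0" for i j k
  proof (induction j arbitrary: i k)
    case 0
    show ?case
    proof (cases "i + k = n")
      case True
      then have "nat (int n - int i) = k" by simp
      with True show ?thesis using assms(2)[of "int i"] by (simp add: split_coord_def split: if_splits)
    next
      case False
      then show ?thesis using assms(1) by (simp add: hw_def level_def)
    qed
  next
    case (Suc j)
    have "0 = c (E *v v) i j k" using assms(1) by (simp add: hw_def)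
    also have "\<dots> = s powi (int d1 - 2 * int i) * g2 (Suc j) * s powi (2 * int k - int d3) * c v i (Suc j) k"
      by (simp add: E_def mv_simps c_lin c_gen Suc)
    finally have "g2 (Suc j) * c v i (Suc j) k = 0" using s_nz by simp
    then show ?case using g_nz(2)[of "Suc j"] c_out[of i "Suc j" k v] by (cases "Suc j \<le> d2") auto
  qed
  then show ?thesis by (rule c_inj)
qed

text \<open>\<open>lam^4\<close> times the q-integers of i, d1 + 1 - i, n + 1 - i and d3 - n + i, in
  the expanded form supplied by \<open>q_int_mult\<close>.\<close>

definition AB_product :: "nat \<Rightarrow> int \<Rightarrow> complex" where
  "AB_product n i = (chi q d1 - (q powi (2 * i - int d1 - 1) + q powi (int d1 + 1 - 2 * i))) *
     (chi q d3 - (q powi (2 * (int n + 1 - i) - int d3 - 1) + q powi (int d3 + 1 - 2 * (int n + 1 - i))))"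

lemma q_int_mult: "lam^2 * (q_int q k * q_int q (d + 1 - k)) = chi q d - (q powi (2 * k - d - 1) + q powi (d + 1 - 2 * k))"
proof -
  have "lam^2 * (q_int q k * q_int q (d + 1 - k)) = (q powi k - q powi (- k)) * (q powi (d + 1 - k) - q powi (- (d + 1 - k)))"
    using q_diff_nz by (simp add: q_int_def power2_eq_square)
  also have "\<dots> = q powi (k + (d + 1 - k)) + q powi (- k + - (d + 1 - k)) - q powi (k + - (d + 1 - k)) - q powi (- k + (d + 1 - k))"
    using q_nz by (simp only: power_int_add simp_thms) (simp add: algebra_simps)
  also have "k + (d + 1 - k) = d + 1" by simp
  also have "- k + - (d + 1 - k) = - d - 1" by simp
  also have "k + - (d + 1 - k) = 2 * k - d - 1" by simp
  also have "- k + (d + 1 - k) = d + 1 - 2 * k" by simp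
  finally show ?thesis by (simp add: chi_def)
qed

text \<open>The powers of \<open>s\<close> are inverse to each other and \<open>g1\<close>,
  \<open>g3\<close> occur squared, so the choice of square roots disappears. The hypotheses are the
  ranges in which those squares are known.\<close>

lemma A_sub_B_super:
  assumes "0 \<le> i" "i \<le> int d1 + 1" "i \<le> int n + 1" "int n \<le> int d3 + i"
  shows "A_sub n i * B_super n (i - 1) = AB_product n i"
proof -
  have "s powi (int d1 + int d3 - 2 * int n + 2) * s powi (2 * int n - 2 - int d1 - int d3) = 1"
    using s_nz by (simp add: power_int_add[symmetric])
  then have "A_sub n i * B_super n (i - 1) = (lam^2 * (g1 (nat i))^2) * (lam^2 * (g3 (nat (int n + 1 - i)))^2)"
    by (simp add: A_sub_def B_super_def power2_eq_square algebra_simps)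
  also have "(g1 (nat i))^2 = q_int q i * q_int q (int d1 + 1 - i)"
    using g1(3)[of "nat i"] assms by simp
  also have "(g3 (nat (int n + 1 - i)))^2 = q_int q (int n + 1 - i) * q_int q (int d3 + 1 - (int n + 1 - i))"
    using g3(3)[of "nat (int n + 1 - i)"] assms by simp
  finally show ?thesis unfolding q_int_mult AB_product_def .
qed

text \<open>The dictionary to the abstract identities: \<open>b\<close> carries the middle spin,
  \<open>X\<close> and \<open>Y\<close> the diagonal entries of \<open>A\<close> and
  \<open>B\<close> at i, and the weight of the level is encoded in their product with
  \<open>b'\<close>. Every item is a comparison of exponents of \<open>q\<close>.\<close>

lemma relation_context:
  fixes n :: nat and i :: int
  assumes i: "0 \<le> i" "i \<le> int n" "i \<le> int d1" "int n \<le> int d3 + i"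
  defines "b \<equiv> q powi (int d2 + 1)" and "b' \<equiv> q powi (- int d2 - 1)"
    and "X \<equiv> q powi (int d1 + int d2 - 2 * i + 1)" and "X' \<equiv> q powi (- int d1 - int d2 + 2 * i - 1)"
    and "Y \<equiv> q powi (int d2 + int d3 - 2 * int n + 2 * i + 1)" and "Y' \<equiv> q powi (- int d2 - int d3 + 2 * int n - 2 * i - 1)"
    and "p \<equiv> q powi (- 1)"
  shows "q * p = 1" "b * b' = 1" "X * X' = 1" "Y * Y' = 1" "chi q d2 = b + b'"
    "chi q (wt n) = X * Y * b' + X' * Y' * b"
    "A_diag i = X + X'" "A_diag (i + 1) = p^2 * X + q^2 * X'" "A_diag (i - 1) = q^2 * X + p^2 * X'"
    "B_diag n i = Y + Y'" "B_diag n (i + 1) = q^2 * Y + p^2 * Y'" "B_diag n (i - 1) = p^2 * Y + q^2 * Y'"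
    "AB_product n i = (chi q d1 - (b * p * X' + X * b' * q)) * (chi q d3 - (b * q * Y' + Y * b' * p))"
    "AB_product n (i + 1) = (chi q d1 - (b * q * X' + X * b' * p)) * (chi q d3 - (b * p * Y' + Y * b' * q))"
    "A_diag (i + 2) = p^4 * X + q^4 * X'" "B_diag n (i - 2) = p^4 * Y + q^4 * Y'"
    "AB_product n (i + 2) = (chi q d1 - (b * q^3 * X' + X * b' * p^3)) * (chi q d3 - (b * p^3 * Y' + Y * b' * q^3))"
    "AB_product n (i - 1) = (chi q d1 - (b * p^3 * X' + X * b' * q^3)) * (chi q d3 - (b * q^3 * Y' + Y * b' * p^3))"
proof -
  have qq: "q = q powi 1" "q^2 = q powi 2" "q^3 = q powi 3" "q^4 = q powi 4" by simp_all
  have pp: "p^2 = q powi (- 2)" "p^3 = q powi (- 3)" "p^4 = q powi (- 4)"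
    using power_int_mult[of q "- 1" 2] power_int_mult[of q "- 1" 3] power_int_mult[of q "- 1" 4] by (simp_all add: p_def)
  have add: "q powi x * q powi y = q powi (x + y)" for x y using q_nz by (simp add: power_int_add)
  note defs = b_def b'_def X_def X'_def Y_def Y'_def
  show "q * p = 1" using q_nz by (simp add: p_def)
  show "b * b' = 1" "X * X' = 1" "Y * Y' = 1" unfolding defs add by simp_all
  show "chi q d2 = b + b'" "A_diag i = X + X'" "B_diag n i = Y + Y'"
    unfolding defs chi_def A_diag_def B_diag_def by (simp_all add: algebra_simps)
  show "chi q (wt n) = X * Y * b' + X' * Y' * b"
    unfolding defs add chi_def wt_def D_def by (simp add: algebra_simps)
  show "A_diag (i + 1) = p^2 * X + q^2 * X'" "A_diag (i - 1) = q^2 * X + p^2 * X'" "A_diag (i + 2) = p^4 * X + q^4 * X'"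
    unfolding defs chi_def A_diag_def qq(2,4) pp add by (simp_all add: algebra_simps)
  show "B_diag n (i + 1) = q^2 * Y + p^2 * Y'" "B_diag n (i - 1) = p^2 * Y + q^2 * Y'" "B_diag n (i - 2) = p^4 * Y + q^4 * Y'"
    unfolding defs chi_def B_diag_def qq(2,4) pp add by (simp_all add: algebra_simps)
  have zz': "AB_product n j = (chi q d1 - x) * (chi q d3 - y)"
    if "x = q powi (2 * j - int d1 - 1) + q powi (int d1 + 1 - 2 * j)"
     "y = q powi (2 * (int n + 1 - j) - int d3 - 1) + q powi (int d3 + 1 - 2 * (int n + 1 - j))" for j x y
    unfolding AB_product_def that ..
  have bq: "b * q * z = b * z * q powi 1" "z * b' * q = z * b' * q powi 1" "b * p * z = b * z * q powi (- 1)" "z * b' * p = z * b' * q powi (- 1)" for z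
    by (simp_all add: p_def)
  have bq3: "b * q^3 * z = b * z * q powi 3" "z * b' * q^3 = z * b' * q powi 3" "b * p^3 * z = b * z * q powi (- 3)" "z * b' * p^3 = z * b' * q powi (- 3)" for z
    by (simp_all add: pp)
  show "AB_product n i = (chi q d1 - (b * p * X' + X * b' * q)) * (chi q d3 - (b * q * Y' + Y * b' * p))"
    "AB_product n (i + 1) = (chi q d1 - (b * q * X' + X * b' * p)) * (chi q d3 - (b * p * Y' + Y * b' * q))"
    by (rule zz'; unfold bq, unfold defs add, simp add: algebra_simps)+
  show "AB_product n (i + 2) = (chi q d1 - (b * q^3 * X' + X * b' * p^3)) * (chi q d3 - (b * p^3 * Y' + Y * b' * q^3))"
    "AB_product n (i - 1) = (chi q d1 - (b * p^3 * X' + X * b' * q^3)) * (chi q d3 - (b * q^3 * Y' + Y * b' * p^3))"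
    by (rule zz'; unfold bq3, unfold defs add, simp add: algebra_simps)+
qed

text \<open>Within the commutant a relation has to be tested only on highest weight vectors, and
  there only on the coordinates that can be nonzero.\<close>

lemma hw_rel_zero:
  fixes M :: "complex^'N^'N"
  assumes "M \<in> commutant"
    and "\<And>n i v. hw n v \<Longrightarrow> 0 \<le> i \<Longrightarrow> i \<le> int n \<Longrightarrow> i \<le> int d1 \<Longrightarrow> int n \<le> int d3 + i \<Longrightarrow> split_coord n (M *v v) i = 0"
  shows "M = 0"
proof (rule commutant_eq_0[OF assms(1)])
  fix n v assume v: "hw n v"
  show "M *v v = 0"
  proof (rule split_coord_inj[OF hw_commutant[OF assms(1) v]])
    show "split_coord n (M *v v) i = 0" for i
    proof (cases "0 \<le> i \<and> i \<le> int n \<and> i \<le> int d1 \<and> int n \<le> int d3 + i")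
      case True
      then show ?thesis using assms(2)[OF v] by blast
    next
      case False
      then show ?thesis by (auto simp: split_coord_def intro!: c_out)
    qed
  qed
qed

text \<open>The first Askey--Wilson relation after elimination of the generator D by the third one
  and multiplication by the square of q^2 - q^(-2); \<open>relB\<close> comes from the second in the
  same way.\<close>

definition "relA = mat_smult ((q^2 - (q powi (- 1))^2)^2) A + (mat_smult ((q - q powi (- 1))^2 * (chi q d1 * chi q d3)) B + mat_smult ((q - q powi (- 1))^2 * chi q d2) (C ** B))
  - (mat_smult (q^2 + (q powi (- 1))^2) (B ** A ** B) - B ** B ** A - A ** B ** B)
  - (mat_smult ((q - q powi (- 1))^2 * (q + q powi (- 1)) * (chi q d1 * chi q d2)) (mat 1) + mat_smult ((q - q powi (- 1))^2 * (q + q powi (- 1)) * chi q d3) C)"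

definition "relB = mat_smult ((q^2 - (q powi (- 1))^2)^2) B + (mat_smult ((q - q powi (- 1))^2 * (chi q d1 * chi q d3)) A + mat_smult ((q - q powi (- 1))^2 * chi q d2) (C ** A))
  - (mat_smult (q^2 + (q powi (- 1))^2) (A ** B ** A) - A ** A ** B - B ** A ** A)
  - (mat_smult ((q - q powi (- 1))^2 * (q + q powi (- 1)) * (chi q d2 * chi q d3)) (mat 1) + mat_smult ((q - q powi (- 1))^2 * (q + q powi (- 1)) * chi q d1) C)"

lemmas commutant_intros = commutant_add commutant_diff commutant_mult commutant_smc commutant_1 A_commutant B_commutant C_commutant

lemma split_coord_A_fun: "hw n v \<Longrightarrow> split_coord n (A *v v) = opA A_diag (A_sub n) (split_coord n v)"
  and split_coord_B_fun: "hw n v \<Longrightarrow> split_coord n (B *v v) = opB (B_diag n) (B_super n) (split_coord n v)"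
  by (simp_all add: opA_def opB_def split_coord_A split_coord_B fun_eq_iff)

lemma relA_zero: "relA = 0"
proof (rule hw_rel_zero)
  show "relA \<in> commutant" unfolding relA_def by (intro commutant_intros)
  fix n i v assume v: "hw n v" and i: "0 \<le> i" "i \<le> int n" "i \<le> int d1" "int n \<le> int d3 + i"
  note rc = relation_context[OF i]
  have p1: "A_sub n i * B_super n (i - 1) = AB_product n i" using i by (intro A_sub_B_super) auto
  have p2: "A_sub n (i + 1) * B_super n i = AB_product n (i + 1)" using i A_sub_B_super[of "i + 1" n] by simp
  \<comment> \<open>A nonzero \<open>B_super n i\<close> excludes i = d1 and i = n, so position i +
    2 still lies where the product formula holds.\<close>
  have p3: "B_super n i * (A_sub n (i + 2) * B_super n (i + 1)) = B_super n i * AB_product n (i + 2)"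
  proof (cases "B_super n i = 0")
    case False
    have "nat (i + 1) = Suc d1" if "i = int d1" using that by simp
    with False have "i \<noteq> int d1" "i \<noteq> int n" by (auto simp: B_super_def g1 g3)
    then show ?thesis using i A_sub_B_super[of "i + 2" n] by (simp add: add.commute)
  qed simp
  have hwA: "hw n w \<Longrightarrow> hw n (A *v w)" and hwB: "hw n w \<Longrightarrow> hw n (B *v w)" for w
    using hw_commutant A_commutant B_commutant by blast+
  show "split_coord n (relA *v v) i = 0"
    using aw_sequence_relation_A[OF rc(1-12) rc(13,14) p1 p2 rc(15) rc(17) p3, of "split_coord n v"]
    by (simp add: relA_def mv_simps split_coord_lin C_hw[OF v] C_hw[OF hwB[OF v]] split_coord_A_fun split_coord_B_fun v hwA hwB ring_distribs mult_ac)
qed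

lemma relB_zero: "relB = 0"
proof (rule hw_rel_zero)
  show "relB \<in> commutant" unfolding relB_def by (intro commutant_intros)
  fix n i v assume v: "hw n v" and i: "0 \<le> i" "i \<le> int n" "i \<le> int d1" "int n \<le> int d3 + i"
  note rc = relation_context[OF i]
  have p1: "A_sub n i * B_super n (i - 1) = AB_product n i" using i by (intro A_sub_B_super) auto
  have p2: "A_sub n (i + 1) * B_super n i = AB_product n (i + 1)" using i A_sub_B_super[of "i + 1" n] by simp
  \<comment> \<open>A nonzero \<open>A_sub n i\<close> excludes i = 0 and n = d3 + i, so position i
    - 1 is still admissible.\<close>
  have p3: "A_sub n i * (A_sub n (i - 1) * B_super n (i - 2)) = A_sub n i * AB_product n (i - 1)"
  proof (cases "A_sub n i = 0")
    case False
    have "nat (int n + 1 - i) = Suc d3" if "int n = int d3 + i" using that by simp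
    with False have "i \<noteq> 0" "int n \<noteq> int d3 + i" by (auto simp: A_sub_def g1 g3)
    then show ?thesis using i A_sub_B_super[of "i - 1" n] by simp
  qed simp
  have hwA: "hw n w \<Longrightarrow> hw n (A *v w)" and hwB: "hw n w \<Longrightarrow> hw n (B *v w)" for w
    using hw_commutant A_commutant B_commutant by blast+
  show "split_coord n (relB *v v) i = 0"
    using aw_sequence_relation_B[OF rc(1-12) rc(13,14) p1 p2 rc(16) rc(18) p3, of "split_coord n v"]
    by (simp add: relB_def mv_simps split_coord_lin C_hw[OF v] C_hw[OF hwA[OF v]] split_coord_A_fun split_coord_B_fun v hwA hwB ring_distribs mult_ac)
qed

end

section \<open>The contravariant form and the generators of the commutant\<close>

text \<open>A linear space of functionals that separates the span of \<open>S\<close> contains the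
  dual basis of \<open>S\<close>, by elimination on one basis vector at a time. The functionals form
  an abstract set closed under sums and multiples, so that they may be parametrised by an
  algebra.\<close>

lemma dual_family:
  fixes S :: "(complex^'n) set" and \<Phi> :: "(complex^'n \<Rightarrow> complex) set"
  assumes "finite S" "vec.independent S"
    and lin: "\<And>f v w a. f \<in> \<Phi> \<Longrightarrow> f (v + w) = f v + f w \<and> f (a *s v) = a * f v"
    and add: "\<And>f g. f \<in> \<Phi> \<Longrightarrow> g \<in> \<Phi> \<Longrightarrow> (\<lambda>v. f v + g v) \<in> \<Phi>"
    and scale: "\<And>f a. f \<in> \<Phi> \<Longrightarrow> (\<lambda>v. a * f v) \<in> \<Phi>"
    and sep: "\<And>v. v \<in> vec.span S \<Longrightarrow> (\<And>f. f \<in> \<Phi> \<Longrightarrow> f v = 0) \<Longrightarrow> v = 0"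
  shows "\<exists>f. \<forall>h\<in>S. f h \<in> \<Phi> \<and> (\<forall>h'\<in>S. f h h' = (if h' = h then 1 else 0))"
  using assms(1,2) sep
proof (induction S rule: finite_induct)
  case (insert x S)
  have indS: "vec.independent S" and x: "x \<notin> vec.span S"
    using insert.prems(1) insert.hyps(2) by (auto simp: vec.independent_insert)
  have "vec.span S \<subseteq> vec.span (insert x S)" by (rule vec.span_mono) auto
  then obtain f where f: "\<And>h. h \<in> S \<Longrightarrow> f h \<in> \<Phi>" "\<And>h h'. h \<in> S \<Longrightarrow> h' \<in> S \<Longrightarrow> f h h' = (if h' = h then 1 else 0)"
  proof -
    have "\<exists>f. \<forall>h\<in>S. f h \<in> \<Phi> \<and> (\<forall>h'\<in>S. f h h' = (if h' = h then 1 else 0))"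
      by (rule insert.IH[OF indS], rule insert.prems(2)) (use \<open>vec.span S \<subseteq> _\<close> in auto)
    then show ?thesis using that by blast
  qed
  have lin_sum: "g (sum F T) = (\<Sum>t\<in>T. g (F t))" if "g \<in> \<Phi>" for g T and F :: "complex^'n \<Rightarrow> complex^'n"
  proof -
    have gl: "g (v + w) = g v + g w" "g (a *s v) = a * g v" for v w a using lin[OF that] by blast+
    have "g 0 = 0" using gl(2)[of 0 0] by simp
    then show ?thesis by (induction T rule: infinite_finite_induct) (simp_all add: gl(1))
  qed
  \<comment> \<open>The new vector minus its part seen by the duals already found; it is nonzero by
    independence, hence detected by some functional.\<close>
  define y where "y = x - (\<Sum>h\<in>S. f h x *s h)"
  have "(\<Sum>h\<in>S. f h x *s h) \<in> vec.span S" by (intro vec.span_sum vec.span_scale vec.span_base)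
  then have "y \<noteq> 0" using x by (auto simp: y_def)
  moreover have "y \<in> vec.span (insert x S)" unfolding y_def
    by (intro vec.span_diff vec.span_sum vec.span_scale vec.span_base) auto
  ultimately obtain g where g: "g \<in> \<Phi>" "g y \<noteq> 0" using insert.prems(2)[of y] by blast
  have gl: "g (v + w) = g v + g w" "g (a *s v) = a * g v" for v w a using lin[OF g(1)] by blast+
  have sumcl: "(\<lambda>v. a * g v + (\<Sum>h\<in>T. k h * f h v)) \<in> \<Phi>" if "finite T" "T \<subseteq> S" for T k and a
    using that
  proof (induction T rule: finite_induct)
    case empty then show ?case using scale[OF g(1)] by simp
  next
    case (insert t T)
    then have "(\<lambda>v. a * g v + (\<Sum>h\<in>T. k h * f h v)) \<in> \<Phi>" "f t \<in> \<Phi>" using f(1) by auto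
    then have "(\<lambda>v. (a * g v + (\<Sum>h\<in>T. k h * f h v)) + k t * f t v) \<in> \<Phi>"
      using add scale by blast
    then show ?case using insert by (simp add: algebra_simps)
  qed
  \<comment> \<open>The correction removes the values on \<open>S\<close>; by linearity the value at
    \<open>x\<close> is then \<open>g y / g y\<close>.\<close>
  define g' where "g' = (\<lambda>v. (1 / g y) * g v + (\<Sum>h\<in>S. (- g h / g y) * f h v))"
  have g': "g' \<in> \<Phi>" unfolding g'_def by (rule sumcl) (use insert in auto)
  have lin_diff: "g (v - w) = g v - g w" for v w
    using gl(1)[of "v - w" w] by simp
  have "g y = g x - (\<Sum>h\<in>S. f h x * g h)"
    unfolding y_def lin_diff lin_sum[OF g(1)] gl(2) by simp
  then have "g' x = 1" using g(2) by (simp add: g'_def sum_divide_distrib[symmetric] sum_negf diff_divide_distrib[symmetric] mult.commute)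
  moreover have "g' h = 0" if "h \<in> S" for h
  proof -
    have "(\<Sum>h'\<in>S. (- g h' / g y) * f h' h) = (\<Sum>h'\<in>S. if h' = h then - g h / g y else 0)"
      using f(2) that by (intro sum.cong) auto
    then show ?thesis using that insert.hyps(1) by (simp add: g'_def)
  qed
  ultimately have g'v: "g' x = 1" "\<And>h. h \<in> S \<Longrightarrow> g' h = 0" by auto
  \<comment> \<open>The old duals are corrected so that they vanish at \<open>x\<close>.\<close>
  define F where "F = (\<lambda>h. if h = x then g' else (\<lambda>v. f h v + (- f h x) * g' v))"
  have "F h \<in> \<Phi>" if "h \<in> insert x S" for h
  proof (cases "h = x")
    case True
    then show ?thesis using g' by (simp add: F_def)
  next
    case False
    then have "F h = (\<lambda>v. f h v + (- f h x) * g' v)" by (simp add: F_def)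
    moreover have "f h \<in> \<Phi>" using False that f(1) by blast
    ultimately show ?thesis using add[OF _ scale[OF g', of "- f h x"], of "f h"] by simp
  qed
  moreover have "F h h' = (if h' = h then 1 else 0)" if "h \<in> insert x S" "h' \<in> insert x S" for h h'
    using that f(2) g'v insert.hyps(2) by (auto simp: F_def)
  ultimately show ?case by blast
qed simp

inductive_set gen_alg :: "(complex^'n^'n) set \<Rightarrow> (complex^'n^'n) set" for S where
  base: "x \<in> S \<Longrightarrow> x \<in> gen_alg S"
| one: "mat 1 \<in> gen_alg S"
| add: "x \<in> gen_alg S \<Longrightarrow> y \<in> gen_alg S \<Longrightarrow> x + y \<in> gen_alg S"
| mult: "x \<in> gen_alg S \<Longrightarrow> y \<in> gen_alg S \<Longrightarrow> x ** y \<in> gen_alg S"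
| mat_smult: "x \<in> gen_alg S \<Longrightarrow> mat_smult a x \<in> gen_alg S"

lemma gen_alg_0: "(0 :: complex^'n^'n) \<in> gen_alg S"
proof -
  have "mat_smult 0 (mat 1) = (0 :: complex^'n^'n)" by (simp add: matrix_eq mat_smult_vec)
  then show ?thesis using gen_alg.mat_smult[OF gen_alg.one, of 0 S] by simp
qed

lemma gen_alg_diff: "x \<in> gen_alg S \<Longrightarrow> y \<in> gen_alg S \<Longrightarrow> x - y \<in> gen_alg S"
proof -
  assume "x \<in> gen_alg S" "y \<in> gen_alg S"
  then have "x + mat_smult (- 1) y \<in> gen_alg S" by (intro gen_alg.add gen_alg.mat_smult)
  moreover have "x + mat_smult (- 1) y = x - y" by (simp add: matrix_eq mv_simps)
  ultimately show ?thesis by simp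
qed

lemma gen_alg_sum: "(\<And>t. t \<in> T \<Longrightarrow> f t \<in> gen_alg S) \<Longrightarrow> sum f T \<in> gen_alg S"
  by (induction T rule: infinite_finite_induct) (auto intro: gen_alg_0 gen_alg.add)

lemma gen_alg_root_poly: "X \<in> gen_alg S \<Longrightarrow> root_poly X as \<in> gen_alg S"
  by (induction as) (auto simp: root_poly_def intro!: gen_alg.one gen_alg.mult gen_alg.mat_smult gen_alg_diff)

lemma sum_mv: "sum f T *v v = (\<Sum>t\<in>T. f t *v (v :: complex^'n))"
  by (induction T rule: infinite_finite_induct) (simp_all add: mv_simps)

text \<open>A shift of the summation index. The two zero end values of \<open>g\<close> remove the
  boundary terms, and \<open>g 0 = 0\<close> also absorbs the truncated
  \<open>i - 1\<close>.\<close>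

lemma sum_shift_adjoint:
  fixes g u w :: "nat \<Rightarrow> complex"
  assumes "g 0 = 0" "g (Suc d) = 0"
  shows "(\<Sum>i\<le>d. g (Suc i) * u (Suc i) * w i) = (\<Sum>i\<le>d. u i * (g i * w (i - 1)))"
proof -
  let ?f = "\<lambda>i. u i * (g i * w (i - 1))"
  have "(\<Sum>i\<le>d. ?f i) = (\<Sum>i\<le>Suc d. ?f i)" using assms by simp
  also have "\<dots> = ?f 0 + (\<Sum>i\<le>d. ?f (Suc i))" by (rule sum.atMost_Suc_shift)
  finally show ?thesis using assms by (simp add: algebra_simps)
qed

lemma sum_rotate:
  "(\<Sum>i\<in>I. \<Sum>j\<in>J. \<Sum>k\<in>K. f i j k) = (\<Sum>j\<in>J. \<Sum>k\<in>K. \<Sum>i\<in>I. f i j k)"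
  by (rule trans[OF sum.swap]) (intro sum.cong refl sum.swap)

context three_strings
begin

text \<open>Bilinear without conjugation, as \<open>q\<close> is an arbitrary complex number. The
  chosen coordinates are orthonormal for it, so adjoints are transposes and \<open>E\<close> and
  \<open>F\<close> of each slot are adjoint.\<close>

definition form :: "complex^'N \<Rightarrow> complex^'N \<Rightarrow> complex" where
  "form v w = (\<Sum>i\<le>d1. \<Sum>j\<le>d2. \<Sum>k\<le>d3. c v i j k * c w i j k)"

definition adj :: "complex^'N^'N \<Rightarrow> complex^'N^'N \<Rightarrow> bool" where
  "adj M N \<longleftrightarrow> (\<forall>v w. form (M *v v) w = form v (N *v w))"

lemma form_sym: "form v w = form w v"
  by (simp add: form_def mult.commute)

lemma form_add: "form (v + v') w = form v w + form v' w" "form w (v + v') = form w v + form w v'"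
  and form_diff: "form (v - v') w = form v w - form v' w" "form w (v - v') = form w v - form w v'"
  and form_scale: "form (a *s v) w = a * form v w" "form w (a *s v) = a * form w v"
  by (simp_all add: form_def c_lin sum.distrib sum_subtractf sum_distrib_left algebra_simps)

lemma adj_sym: "adj M N \<Longrightarrow> adj N M"
  unfolding adj_def using form_sym by metis

lemma adj_add: "adj M N \<Longrightarrow> adj M' N' \<Longrightarrow> adj (M + M') (N + N')"
  and adj_diff: "adj M N \<Longrightarrow> adj M' N' \<Longrightarrow> adj (M - M') (N - N')"
  and adj_mult: "adj M N \<Longrightarrow> adj M' N' \<Longrightarrow> adj (M ** M') (N' ** N)"
  and adj_smc: "adj M N \<Longrightarrow> adj (mat_smult a M) (mat_smult a N)"
  and adj_one: "adj (mat 1) (mat 1)"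
  by (simp_all add: adj_def mv_simps form_add form_diff form_scale)

lemma adj_EF: "adj E1 F1" "adj E2 F2" "adj E3 F3"
proof -
  show "adj E1 F1"
    unfolding adj_def form_def cE1 cF1
    by (intro allI, rule trans[OF sum_rotate trans[OF _ sum_rotate[symmetric]]])
       (intro sum.cong refl sum_shift_adjoint g1)
  show "adj E2 F2"
    unfolding adj_def form_def cE2 cF2
    by (intro allI, rule sum.cong[OF refl], rule trans[OF sum.swap trans[OF _ sum.swap]])
       (intro sum.cong refl sum_shift_adjoint g2)
  show "adj E3 F3"
    unfolding adj_def form_def cE3 cF3 by (intro allI sum.cong refl sum_shift_adjoint g3)
qed

lemma adj_KL: "adj K1 K1" "adj K2 K2" "adj K3 K3" "adj L1 L1" "adj L2 L2" "adj L3 L3"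
  by (simp_all add: adj_def form_def c_gen mult_ac)

lemma adj_cas: "adj X Y \<Longrightarrow> adj Z Z \<Longrightarrow> adj W W \<Longrightarrow> adj (cas q X Y Z W) (cas q X Y Z W)"
  unfolding cas_def by (intro adj_add adj_smc adj_mult) (auto intro: adj_sym)

text \<open>Taking adjoints exchanges \<open>E\<close> and \<open>F\<close> and reverses products;
  the reversal is invisible because different slots commute. Hence \<open>E12\<close> and
  \<open>F12\<close> are adjoint, and the Casimir of the pair is self-adjoint.\<close>

lemma adj_A: "adj A A"
proof -
  have "adj E12 (L2 ** F1 + F2 ** K1)" unfolding E12_def by (intro adj_add adj_mult adj_EF adj_KL)
  also have "L2 ** F1 + F2 ** K1 = F12"
    using commute_slots(1)[of F1 L2 E3] commute_slots(1)[of K1 F2 E3] by (simp add: F12_def commute_def)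
  finally have "adj E12 F12" .
  moreover have "adj K12 (K2 ** K1)" "adj L12 (L2 ** L1)" unfolding K12_def L12_def by (intro adj_mult adj_KL)+
  moreover have "K2 ** K1 = K12" "L2 ** L1 = L12"
    using commute_slots(1)[of K1 K2 E3] commute_slots(1)[of L1 L2 E3] by (simp_all add: K12_def L12_def commute_def)
  ultimately show ?thesis unfolding A_def by (intro adj_cas) simp_all
qed

lemma adj_B: "adj B B"
proof -
  have "adj E23 (L3 ** F2 + F3 ** K2)" unfolding E23_def by (intro adj_add adj_mult adj_EF adj_KL)
  also have "L3 ** F2 + F3 ** K2 = F23"
    using commute_slots(3)[of E1 F2 L3] commute_slots(3)[of E1 K2 F3] by (simp add: F23_def commute_def)
  finally have "adj E23 F23" .
  moreover have "adj K23 (K3 ** K2)" "adj L23 (L3 ** L2)" unfolding K23_def L23_def by (intro adj_mult adj_KL)+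
  moreover have "K3 ** K2 = K23" "L3 ** L2 = L23"
    using commute_slots(3)[of E1 K2 K3] commute_slots(3)[of E1 L2 L3] by (simp_all add: K23_def L23_def commute_def)
  ultimately show ?thesis unfolding B_def by (intro adj_cas) simp_all
qed

lemma adj_C: "adj C C"
proof -
  have "adj E (L3 ** (L2 ** F1) + L3 ** (F2 ** K1) + F3 ** (K2 ** K1))"
    unfolding E_def by (intro adj_add adj_mult adj_EF adj_KL)
  moreover have "L3 ** (L2 ** F1) + L3 ** (F2 ** K1) + F3 ** (K2 ** K1) = F"
    using commute_slots(1)[of F1 L2 E3] commute_slots(1)[of K1 F2 E3] commute_slots(1)[of K1 K2 E3]
      commute_slots(2)[of F1 L2 L3] commute_slots(2)[of K1 L2 L3] commute_slots(2)[of K1 L2 F3] 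
      commute_slots(3)[of E1 L2 L3] commute_slots(3)[of E1 F2 L3] commute_slots(3)[of E1 K2 F3]
    by (intro matrix_eqI) (simp add: F_def mv_simps commute_vec)
  moreover have "adj K (K3 ** (K2 ** K1))" "adj L (L3 ** (L2 ** L1))"
    unfolding K_def L_def by (intro adj_mult adj_KL)+
  moreover have "K3 ** (K2 ** K1) = K" "L3 ** (L2 ** L1) = L"
    by (auto intro!: matrix_eqI c_eqI simp: K_def L_def mv_simps c_gen)
  ultimately show ?thesis unfolding C_def by (intro adj_cas) simp_all
qed

lemma adj_root_poly:
  assumes "adj X X"
  shows "adj (root_poly X as) (root_poly X as)"
proof (induction as)
  case (Cons b as)
  have "commute X (root_poly X as)" by (intro commute_root_poly) (simp add: commute_def)
  then have "root_poly X (b # as) = (X - mat_smult b (mat 1)) ** root_poly X as" "root_poly X (b # as) = root_poly X as ** (X - mat_smult b (mat 1))"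
    by (auto intro!: matrix_eqI simp: mv_simps commute_vec)
  then show ?case using adj_mult[of "X - mat_smult b (mat 1)" "X - mat_smult b (mat 1)" "root_poly X as" "root_poly X as"] Cons assms
    by (simp add: adj_diff adj_smc adj_one)
qed (simp add: root_poly_def adj_one)

text \<open>The form is nondegenerate on each whole weight space, and the projector, a polynomial in
  the self-adjoint \<open>C\<close>, moves across it: pairing \<open>h\<close> with any vector of
  level n is, up to a nonzero factor, pairing it with a highest weight vector.\<close>

lemma form_nondegenerate:
  assumes h: "hw n h" and "\<And>h'. hw n h' \<Longrightarrow> form h h' = 0"
  shows "h = 0"
proof (rule ccontr)
  assume "h \<noteq> 0"
  then have n: "2 * n \<le> D" using hw_nonneg h by blast
  obtain a where a: "a \<noteq> 0" "\<And>h. hw n h \<Longrightarrow> hw_proj n *v h = a *s h" using hw_proj_scale[OF n] by blast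
  have P: "form (hw_proj n *v x) y = form x (hw_proj n *v y)" for x y
    using adj_root_poly[OF adj_C] unfolding hw_proj_def adj_def by blast
  have "form h x = 0" if "level n x" for x
  proof -
    have "a * form h x = form (hw_proj n *v h) x" by (simp add: a(2)[OF h] form_scale)
    also have "\<dots> = 0" unfolding P by (intro assms(2) hw_proj_hw that n)
    finally show ?thesis using a by simp
  qed
  note bfz = this
  have "h = 0"
  proof (rule c_inj)
    fix i j k
    show "c h i j k = 0"
    proof (cases "i \<le> d1 \<and> j \<le> d2 \<and> k \<le> d3 \<and> i + j + k = n")
      case True
      then obtain e where e: "level (i + j + k) e" "\<And>i' j' k'. c e i' j' k' = (if i' = i \<and> j' = j \<and> k' = k then 1 else 0)"
        using basis_vec[of i j k] by (metis (no_types, lifting))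
      have "form h e = (\<Sum>i'\<le>d1. \<Sum>j'\<le>d2. \<Sum>k'\<le>d3. if k' = k then if j' = j then if i' = i then c h i j k else 0 else 0 else 0)"
        unfolding form_def e(2) by (intro sum.cong refl) auto
      also have "\<dots> = c h i j k" using True by simp
      finally show ?thesis using bfz[of e] e(1) True by simp
    next
      case False
      then show ?thesis using h c_out[of i j k h] by (auto simp: hw_def level_def)
    qed
  qed
  with \<open>h \<noteq> 0\<close> show False by simp
qed

end

section \<open>Rank one operators, and generation of the commutant\<close>

context three_strings
begin

abbreviation "ABC_alg \<equiv> gen_alg {A, B, C}"

lemma gen_alg_commutant: "x \<in> ABC_alg \<Longrightarrow> x \<in> commutant"
  by (induction rule: gen_alg.induct) (auto intro: commutant_intros)

text \<open>Here the induction runs over the first index: the coordinates with i = 0 determine a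
  highest weight vector, and for n > d2 + d3 none of them is in range. The bound is what makes the
  leading eigenvalue of \<open>A\<close> simple.\<close>

lemma hw_level_bound:
  assumes "hw n v" "v \<noteq> 0" shows "n \<le> d2 + d3"
proof (rule ccontr)
  assume n: "\<not> n \<le> d2 + d3"
  have "c v i j k = 0" for i j k
  proof (induction i arbitrary: j k)
    case 0
    show ?case
    proof (cases "j + k = n")
      case True
      then show ?thesis using n by (intro c_out) auto
    next
      case False
      then show ?thesis using assms(1) by (simp add: hw_def level_def)
    qed
  next
    case (Suc i)
    have "0 = c (E *v v) i j k" using assms(1) by (simp add: hw_def)
    also have "\<dots> = g1 (Suc i) * s powi (2 * int j - int d2) * s powi (2 * int k - int d3) * c v (Suc i) j k"
      by (simp add: E_def mv_simps c_lin c_gen Suc)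
    finally have "g1 (Suc i) * c v (Suc i) j k = 0" using s_nz by simp
    then show ?case using g_nz(1)[of "Suc i"] c_out[of "Suc i" j k v] by (cases "Suc i \<le> d1") auto
  qed
  then show False using c_inj assms(2) by blast
qed

text \<open>
  The coordinate \<open>lead n\<close> with the least possible index \<open>lead_index n\<close> is a left eigenvector of \<open>A\<close> on the highest
  weight vectors of level \<open>n\<close> and is cyclic for \<open>B\<close>. A polynomial in \<open>A\<close> therefore acts there with rank one.
\<close>

definition lead_index :: "nat \<Rightarrow> int" where "lead_index n = max 0 (int n - int d3)"

definition lead :: "nat \<Rightarrow> complex^'N \<Rightarrow> complex" where "lead n v = split_coord n v (lead_index n)"

text \<open>The roots are the diagonal entries after the leading one, up to index d1. The reversal
  makes the smallest index act first, the order in which coordinates get killed.\<close>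

definition A_poly :: "nat \<Rightarrow> complex^'N^'N" where
  "A_poly n = root_poly A (map (\<lambda>r. A_diag (lead_index n + 1 + int r)) (rev [0..<nat (int d1 - lead_index n)]))"

text \<open>At the least possible index one of the end values \<open>g1 0\<close> and
  \<open>g3 (Suc d3)\<close> is a factor, so nothing flows into the leading coordinate.\<close>

lemma A_sub_lead_index: "A_sub n (lead_index n) = 0"
proof (cases "n \<le> d3")
  case False
  then have "nat (int n + 1 - (int n - int d3)) = Suc d3" by simp
  with False show ?thesis by (simp add: A_sub_def lead_index_def g3)
qed (simp add: A_sub_def lead_index_def g1)

lemma lead_A: "hw n v \<Longrightarrow> lead n (A *v v) = A_diag (lead_index n) * lead n v"
  by (simp add: lead_def split_coord_A A_sub_lead_index)

lemma lead_root_poly: "hw n v \<Longrightarrow> lead n (root_poly A as *v v) = (\<Prod>b\<leftarrow>as. A_diag (lead_index n) - b) * lead n v"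
proof (induction as)
  case (Cons b as)
  have "hw n (root_poly A as *v v)" using Cons.prems A_commutant commutant_root_poly hw_commutant by blast
  then have "lead n (root_poly A (b # as) *v v) = (A_diag (lead_index n) - b) * lead n (root_poly A as *v v)"
    using lead_A[of n "root_poly A as *v v"] by (simp add: lead_def split_coord_lin algebra_simps)
  then show ?case using Cons by simp
qed simp

lemma split_coord_out: "i < lead_index n \<or> i > int d1 \<or> i > int n \<Longrightarrow> split_coord n v i = 0"
  by (auto simp: split_coord_def lead_index_def intro!: c_out split: if_splits)

text \<open>In the lower bidiagonal action, r factors clear the coordinates up to
  \<open>lead_index n + r\<close>: the next factor kills the first surviving diagonal term, whose
  subdiagonal contribution is already zero.\<close>

lemma A_poly_kernel:
  assumes "hw n v" "lead n v = 0"
  shows "A_poly n *v v = 0"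
proof -
  let ?w = "\<lambda>r. root_poly A (map (\<lambda>r. A_diag (lead_index n + 1 + int r)) (rev [0..<r])) *v v"
  have hw: "hw n (?w r)" for r using assms(1) A_commutant commutant_root_poly hw_commutant by blast
  have "\<forall>i \<le> lead_index n + int r. split_coord n (?w r) i = 0" for r
  proof (induction r)
    case 0
    then show ?case using assms(2) split_coord_out[of _ n v] by (auto simp: lead_def le_less)
  next
    case (Suc r)
    have "split_coord n (?w (Suc r)) i = (A_diag i - A_diag (lead_index n + 1 + int r)) * split_coord n (?w r) i + A_sub n i * split_coord n (?w r) (i - 1)" for i
      using split_coord_A[OF hw[of r]] by (simp add: split_coord_lin algebra_simps)
    moreover have "split_coord n (?w r) (i - 1) = 0" if "i \<le> lead_index n + int (Suc r)" for i using Suc that by simp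
    moreover have "(A_diag i - A_diag (lead_index n + 1 + int r)) * split_coord n (?w r) i = 0" if "i \<le> lead_index n + int (Suc r)" for i
      using Suc that by (cases "i = lead_index n + 1 + int r") auto
    ultimately show ?case by simp
  qed
  from this[of "nat (int d1 - lead_index n)"] have "split_coord n (A_poly n *v v) i = 0" for i
    using split_coord_out[of i n "A_poly n *v v"] by (cases "i \<le> int d1") (auto simp: A_poly_def split: if_splits)
  then show ?thesis using split_coord_inj[of n "A_poly n *v v"] hw by (simp add: A_poly_def)
qed

text \<open>The superdiagonal entries of \<open>B\<close> are nonzero inside the range, so the next
  coordinate of each iterate can be recovered from the current coordinate of that iterate and of its
  successor.\<close>

lemma lead_B_cyclic:
  assumes "hw n v" "\<And>k. lead n (((*v) B ^^ k) v) = 0"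
  shows "v = 0"
proof -
  have hw: "hw n (((*v) B ^^ k) v)" for k
    by (induction k) (use assms(1) B_commutant hw_commutant in auto)
  have "split_coord n (((*v) B ^^ k) v) (lead_index n + int r) = 0" for k r
  proof (induction r arbitrary: k)
    case 0 then show ?case using assms(2)[of k] by (simp add: lead_def)
  next
    case (Suc r)
    let ?i = "lead_index n + int r"
    let ?w = "((*v) B ^^ k) v"
    have "B_super n ?i * split_coord n ?w (?i + 1) = 0"
      using split_coord_B[OF hw[of k], of ?i] Suc[of k] Suc[of "Suc k"] by simp
    moreover have "B_super n ?i \<noteq> 0" if "?i + 1 \<le> int d1" "?i + 1 \<le> int n"
    proof -
      have "0 \<le> ?i" "int n - ?i \<le> int d3" by (auto simp: lead_index_def)
      then have "g1 (nat (?i + 1)) \<noteq> 0" "g3 (nat (int n - ?i)) \<noteq> 0" using that g_nz(1)[of "nat (?i + 1)"] g_nz(3)[of "nat (int n - ?i)"] by auto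
      then show ?thesis using lam_sq_nz s_nz by (simp add: B_super_def)
    qed
    ultimately have "split_coord n ?w (?i + 1) = 0"
      using split_coord_out[of "?i + 1" n ?w] by (cases "?i + 1 \<le> int d1 \<and> ?i + 1 \<le> int n") auto
    then show ?case by (simp add: algebra_simps)
  qed
  from this[of 0] have z: "split_coord n v (lead_index n + int r) = 0" for r by simp
  have "split_coord n v i = 0" for i
    using z[of "nat (i - lead_index n)"] split_coord_out[of i n v] by (cases "i < lead_index n") auto
  then show ?thesis using split_coord_inj assms(1) by blast
qed

text \<open>Two diagonal entries of \<open>A\<close> at distinct indices coincide only if the
  indices add up to d1 + d2 + 1. The later index is at most d1 and, by
  \<open>hw_level_bound\<close>, the leading one is at most d2, so the leading eigenvalue is
  simple.\<close>

lemma A_poly_lead: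
  assumes "hw n v0" "v0 \<noteq> 0"
  obtains a where "a \<noteq> 0" "\<And>v. hw n v \<Longrightarrow> lead n (A_poly n *v v) = a * lead n v"
proof
  let ?a = "\<Prod>b\<leftarrow>map (\<lambda>r. A_diag (lead_index n + 1 + int r)) (rev [0..<nat (int d1 - lead_index n)]). A_diag (lead_index n) - b"
  have "n \<le> d2 + d3" using hw_level_bound assms by blast
  then have ne: "A_diag (lead_index n) \<noteq> A_diag (lead_index n + 1 + int r)" if "int r < int d1 - lead_index n" for r
    using that by (auto simp: A_diag_def chi_eq_iff lead_index_def max_def split: if_splits)
  show "?a \<noteq> 0"
  proof
    assume "?a = 0"
    then obtain r where "r < nat (int d1 - lead_index n)" "A_diag (lead_index n) = A_diag (lead_index n + 1 + int r)"
      unfolding prod_list_zero_iff by auto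
    then show False using ne[of r] by simp
  qed
  show "hw n v \<Longrightarrow> lead n (A_poly n *v v) = ?a * lead n v" for v unfolding A_poly_def by (rule lead_root_poly)
qed

lemma B_pow_gen: "\<exists>b \<in> ABC_alg. \<forall>v. b *v v = ((*v) B ^^ k) v"
proof (induction k)
  case 0
  then show ?case using gen_alg.one by (intro bexI[of _ "mat 1"]) auto
next
  case (Suc k)
  then obtain b where "b \<in> ABC_alg" "\<forall>v. b *v v = ((*v) B ^^ k) v" by blast
  then show ?case
    by (intro bexI[of _ "B ** b"]) (auto simp: mv_simps intro: gen_alg.mult gen_alg.base)
qed

lemma lead_lin: "lead n (v + w) = lead n v + lead n w" "lead n (a *s v) = a * lead n v" "lead n (v - w) = lead n v - lead n w"
  by (simp_all add: lead_def split_coord_lin)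

text \<open>Any operator is a sum of rank one operators: \<open>A_poly n\<close> supplies one of
  them, multiplication on the right moves its functional to any dual basis element, and
  multiplication on the left moves its vector \<eta> to any highest weight vector.\<close>

lemma commutant_on_hw:
  assumes z: "z \<in> commutant"
  shows "\<exists>e \<in> ABC_alg. \<forall>v. hw n v \<longrightarrow> e *v v = z *v v"
proof (cases "\<forall>v. hw n v \<longrightarrow> v = 0")
  case True
  then show ?thesis using gen_alg_0 by (intro bexI[of _ 0]) auto
next
  case False
  then obtain w where w: "hw n w" "w \<noteq> 0" by blast
  then obtain k where k: "lead n (((*v) B ^^ k) w) \<noteq> 0" using lead_B_cyclic by blast
  have hwB: "hw n v \<Longrightarrow> hw n (((*v) B ^^ k) v)" for k v
    by (induction k) (use B_commutant hw_commutant in auto)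
  define v0 where "v0 = (1 / lead n (((*v) B ^^ k) w)) *s ((*v) B ^^ k) w"
  have v0: "hw n v0" "lead n v0 = 1" using k hwB[OF w(1)] by (auto simp: v0_def lead_lin intro: hw_scale)
  obtain a where a: "a \<noteq> 0" "\<And>v. hw n v \<Longrightarrow> lead n (A_poly n *v v) = a * lead n v" using A_poly_lead[OF w] by blast
  define \<eta> where "\<eta> = A_poly n *v v0"
  have A_poly_gen: "A_poly n \<in> ABC_alg" unfolding A_poly_def by (intro gen_alg_root_poly gen_alg.base) simp
  have \<eta>: "hw n \<eta>" "lead n \<eta> \<noteq> 0" using a v0 hw_commutant[OF gen_alg_commutant[OF A_poly_gen] v0(1)] by (auto simp: \<eta>_def)
  \<comment> \<open>Subtracting the multiple of \<open>v0\<close> annihilates the leading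
    coordinate, so the difference lies in the kernel of \<open>A_poly n\<close>.\<close>
  have A_poly: "A_poly n *v v = lead n v *s \<eta>" if "hw n v" for v
  proof -
    have "A_poly n *v (v - lead n v *s v0) = 0"
      by (intro A_poly_kernel hw_diff hw_scale that v0) (simp add: lead_lin v0)
    then show ?thesis by (simp add: mv_simps \<eta>_def)
  qed
  have adj_pA: "form (A_poly n *v x) y = form x (A_poly n *v y)" for x y
    using adj_root_poly[OF adj_A] unfolding A_poly_def adj_def by blast
  \<comment> \<open>Self-adjointness of a rank one operator ties its vector to its functional:
    pairing with \<eta> is a multiple of \<open>lead n\<close>.\<close>
  have form\<eta>: "form \<eta> v = form v0 \<eta> * lead n v" if "hw n v" for v
    using adj_pA[of v0 v] A_poly[OF v0(1)] A_poly[OF that] v0(2) by (simp add: form_scale)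
  \<comment> \<open>The factor is nonzero, since otherwise \<eta> would be orthogonal to all highest
    weight vectors.\<close>
  have \<kappa>: "form v0 \<eta> \<noteq> 0"
  proof
    assume "form v0 \<eta> = 0"
    then have "\<eta> = 0" using form_nondegenerate[OF \<eta>(1)] form\<eta> by simp
    then show False using \<eta>(2) lead_lin(2)[of n 0 0] by simp
  qed
  have sub: "vec.subspace {v. hw n v}"
    by (auto simp: vec.subspace_def hw_0 hw_add hw_scale)
  obtain S where S: "S \<subseteq> {v. hw n v}" "vec.independent S" "{v. hw n v} \<subseteq> vec.span S"
    using vec.basis_exists by metis
  have fin: "finite S" using S(2) vec.finiteI_independent by blast
  have span: "v \<in> vec.span S \<longleftrightarrow> hw n v" for v
    using S vec.span_minimal[OF S(1) sub] by auto
  \<comment> \<open>Both families separate highest weight vectors by cyclicity of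
    \<open>lead n\<close> under \<open>B\<close>; for the second, \<open>B\<close> is moved across
    the form onto \<open>v\<close>.\<close>
  let ?\<Phi> = "{\<lambda>v. lead n (x *v v) | x. x \<in> ABC_alg}" and ?\<Psi> = "{\<lambda>v. form (x *v \<eta>) v | x. x \<in> ABC_alg}"
  have "\<exists>f. \<forall>h\<in>S. f h \<in> ?\<Phi> \<and> (\<forall>h'\<in>S. f h h' = (if h' = h then 1 else 0))"
  proof (rule dual_family[OF fin S(2)])
    fix v assume v: "v \<in> vec.span S" and *: "\<And>f. f \<in> ?\<Phi> \<Longrightarrow> f v = 0"
    have "lead n (((*v) B ^^ k) v) = 0" for k
    proof -
      obtain b where "b \<in> ABC_alg" "\<forall>v. b *v v = ((*v) B ^^ k) v" using B_pow_gen by blast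
      then have "(\<lambda>v. lead n (b *v v)) \<in> ?\<Phi>" by blast
      from *[OF this] \<open>\<forall>v. b *v v = _ v\<close> show ?thesis by simp
    qed
    then show "v = 0" using lead_B_cyclic v span by blast
  next
    fix f g assume "f \<in> ?\<Phi>" "g \<in> ?\<Phi>"
    then obtain x y where "f = (\<lambda>v. lead n (x *v v))" "g = (\<lambda>v. lead n (y *v v))" "x \<in> ABC_alg" "y \<in> ABC_alg" by blast
    then show "(\<lambda>v. f v + g v) \<in> ?\<Phi>"
      by (auto intro!: exI[of _ "x + y"] gen_alg.add simp: mv_simps lead_lin)
  next
    fix f and a :: complex assume "f \<in> ?\<Phi>"
    then obtain x where "f = (\<lambda>v. lead n (x *v v))" "x \<in> ABC_alg" by blast
    then show "(\<lambda>v. a * f v) \<in> ?\<Phi>"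
      by (auto intro!: exI[of _ "mat_smult a x"] gen_alg.mat_smult simp: mv_simps lead_lin)
  qed (auto simp: mv_simps lead_lin)
  then obtain f where f: "\<forall>h\<in>S. f h \<in> ?\<Phi> \<and> (\<forall>h'\<in>S. f h h' = (if h' = h then 1 else 0))" by blast
  then have "\<forall>h\<in>S. \<exists>x\<in>ABC_alg. \<forall>h'\<in>S. lead n (x *v h') = (if h' = h then 1 else 0)"
    by (smt (verit, best) mem_Collect_eq)
  then obtain X where X: "\<And>h. h \<in> S \<Longrightarrow> X h \<in> ABC_alg" "\<And>h h'. h \<in> S \<Longrightarrow> h' \<in> S \<Longrightarrow> lead n (X h *v h') = (if h' = h then 1 else 0)"
    by metis
  have "\<exists>f. \<forall>h\<in>S. f h \<in> ?\<Psi> \<and> (\<forall>h'\<in>S. f h h' = (if h' = h then 1 else 0))"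
  proof (rule dual_family[OF fin S(2)])
    fix v assume v: "v \<in> vec.span S" and *: "\<And>f. f \<in> ?\<Psi> \<Longrightarrow> f v = 0"
    have "lead n (((*v) B ^^ k) v) = 0" for k
    proof -
      obtain b where b: "b \<in> ABC_alg" "\<forall>v. b *v v = ((*v) B ^^ k) v" using B_pow_gen by blast
      then have "(\<lambda>v. form (b *v \<eta>) v) \<in> ?\<Psi>" by blast
      from *[OF this] have "form (b *v \<eta>) v = 0" .
      moreover have "form (((*v) B ^^ k) x) y = form x (((*v) B ^^ k) y)" for x y
        using adj_B by (induction k arbitrary: x y) (auto simp: adj_def funpow_swap1)
      ultimately have "0 = form \<eta> (((*v) B ^^ k) v)" using b(2) by simp
      also have "\<dots> = form v0 \<eta> * lead n (((*v) B ^^ k) v)" using form\<eta> hwB v span by blast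
      finally show ?thesis using \<kappa> by simp
    qed
    then show "v = 0" using lead_B_cyclic v span by blast
  next
    fix f g assume "f \<in> ?\<Psi>" "g \<in> ?\<Psi>"
    then obtain x y where "f = (\<lambda>v. form (x *v \<eta>) v)" "g = (\<lambda>v. form (y *v \<eta>) v)" "x \<in> ABC_alg" "y \<in> ABC_alg" by blast
    then show "(\<lambda>v. f v + g v) \<in> ?\<Psi>"
      by (auto intro!: exI[of _ "x + y"] gen_alg.add simp: mv_simps form_add)
  next
    fix f and a :: complex assume "f \<in> ?\<Psi>"
    then obtain x where "f = (\<lambda>v. form (x *v \<eta>) v)" "x \<in> ABC_alg" by blast
    then show "(\<lambda>v. a * f v) \<in> ?\<Psi>"
      by (auto intro!: exI[of _ "mat_smult a x"] gen_alg.mat_smult simp: mv_simps form_scale)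
  qed (auto simp: form_add form_scale)
  then obtain f' where f': "\<And>h. h \<in> S \<Longrightarrow> f' h \<in> ?\<Psi>"
      "\<And>h h'. h \<in> S \<Longrightarrow> h' \<in> S \<Longrightarrow> f' h h' = (if h' = h then 1 else 0)" by blast
  have "\<forall>h\<in>S. \<exists>x\<in>ABC_alg. \<forall>h'\<in>S. form (x *v \<eta>) h' = (if h' = h then 1 else 0)"
  proof
    fix h assume h: "h \<in> S"
    then obtain x where "x \<in> ABC_alg" "f' h = (\<lambda>v. form (x *v \<eta>) v)" using f'(1) by blast
    then show "\<exists>x\<in>ABC_alg. \<forall>h'\<in>S. form (x *v \<eta>) h' = (if h' = h then 1 else 0)"
      using f'(2)[OF h] by (intro bexI[of _ x]) auto
  qed
  then obtain Y where Y: "\<And>h. h \<in> S \<Longrightarrow> Y h \<in> ABC_alg" "\<And>h h'. h \<in> S \<Longrightarrow> h' \<in> S \<Longrightarrow> form (Y h *v \<eta>) h' = (if h' = h then 1 else 0)"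
    by metis
  have gen\<eta>: "\<exists>x\<in>ABC_alg. x *v \<eta> = y" if y: "hw n y" for y
  proof (intro bexI)
    \<comment> \<open>The coefficients \<open>form y h\<close> make the image of \<eta> pair with
      each basis vector as \<open>y\<close> does; nondegeneracy turns this into equality.\<close>
    let ?x = "\<Sum>h\<in>S. mat_smult (form y h) (Y h)"
    show x: "?x \<in> ABC_alg" by (intro gen_alg_sum gen_alg.mat_smult Y)
    have "form (?x *v \<eta> - y) h = 0" if h: "hw n h" for h
    proof -
      have bs: "form (sum F T) h = (\<Sum>t\<in>T. form (F t) h)" for F :: "complex^'N \<Rightarrow> _" and T h
        using form_scale(1)[of 0 0] by (induction T rule: infinite_finite_induct) (simp_all add: form_add)
      have "form (?x *v \<eta> - y) h' = 0" if "h' \<in> S" for h'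
      proof -
        have "form (?x *v \<eta>) h' = (\<Sum>h\<in>S. if h' = h then form y h else 0)"
          unfolding sum_mv bs by (intro sum.cong) (simp_all add: mat_smult_vec form_scale Y that)
        then show ?thesis using that fin by (simp add: form_diff)
      qed
      moreover have "vec.subspace {h. form (?x *v \<eta> - y) h = 0}"
        using form_scale(2)[of "?x *v \<eta> - y" 0 0] by (auto simp: vec.subspace_def form_add form_scale)
      ultimately have "vec.span S \<subseteq> {h. form (?x *v \<eta> - y) h = 0}" by (intro vec.span_minimal) auto
      then show ?thesis using h span by blast
    qed
    moreover have "hw n (?x *v \<eta> - y)" using x \<eta> y hw_commutant gen_alg_commutant hw_diff by blast
    ultimately show "?x *v \<eta> = y" using form_nondegenerate by fastforce
  qed
  have "\<forall>h\<in>S. \<exists>x\<in>ABC_alg. x *v \<eta> = z *v h"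
    using gen\<eta> hw_commutant[OF z] S(1) by blast
  then obtain W where W: "\<And>h. h \<in> S \<Longrightarrow> W h \<in> ABC_alg" "\<And>h. h \<in> S \<Longrightarrow> W h *v \<eta> = z *v h" by metis
  \<comment> \<open>The summand for \<open>h\<close> reads off the \<open>h\<close>-coefficient,
    creates that multiple of \<eta>, and sends \<eta> to \<open>z h\<close>.\<close>
  let ?e = "\<Sum>h\<in>S. W h ** A_poly n ** X h"
  have e: "?e \<in> ABC_alg" by (intro gen_alg_sum gen_alg.mult W X A_poly_gen)
  have "?e *v h = z *v h" if h: "h \<in> S" for h
  proof -
    have "?e *v h = (\<Sum>h'\<in>S. if h = h' then z *v h else 0)"
      unfolding sum_mv
    proof (intro sum.cong refl)
      fix h' assume h': "h' \<in> S"
      have "hw n (X h' *v h)" using h S(1) hw_commutant gen_alg_commutant X(1)[OF h'] by blast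
      then show "(W h' ** A_poly n ** X h') *v h = (if h = h' then z *v h else 0)"
        using h h' by (auto simp: mv_simps A_poly X(2) W(2))
    qed
    then show ?thesis using h fin by simp
  qed
  then have "S \<subseteq> {v. ?e *v v = z *v v}" by blast
  moreover have "vec.subspace {v. ?e *v v = z *v v}" by (auto simp: vec.subspace_def mv_simps)
  ultimately have "vec.span S \<subseteq> {v. ?e *v v = z *v v}" by (rule vec.span_minimal)
  then show ?thesis using e span by blast
qed

text \<open>The approximants of single levels are glued by interpolation polynomials in
  \<open>C\<close>. The result agrees with \<open>z\<close> on all highest weight vectors, hence
  everywhere.\<close>

theorem commutant_subset_gen_alg: "commutant \<subseteq> ABC_alg"
proof
  fix z assume z: "z \<in> commutant"
  obtain e where e: "\<And>n. e n \<in> ABC_alg" "\<And>n v. hw n v \<Longrightarrow> e n *v v = z *v v"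
    using commutant_on_hw[OF z] by metis
  define N where "N = {n. 2 * n \<le> D}"
  have fN: "finite N" unfolding N_def by (rule finite_subset[of _ "{..D}"]) auto
  define roots where "roots = (\<lambda>n. map (\<lambda>m. chi q (wt m)) (filter (\<lambda>m. m \<noteq> n \<and> m \<in> N) [0..<Suc D]))"
  define T where "T = (\<lambda>n. mat_smult (1 / (\<Prod>b\<leftarrow>roots n. chi q (wt n) - b)) (root_poly C (roots n)))"
  \<comment> \<open>Both weights are nonnegative for levels in \<open>N\<close>, which excludes the
    reflected case of \<open>chi_eq_iff\<close>.\<close>
  have chi_inj: "chi q (wt m) = chi q (wt n) \<longleftrightarrow> m = n" if "m \<in> N" "n \<in> N" for m n
    using that by (auto simp: chi_eq_iff wt_def N_def)
  have T: "T n *v v = (if m = n then v else 0)" if "hw m v" "m \<in> N" "n \<in> N" for m n v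
  proof -
    have "T n *v v = ((1 / (\<Prod>b\<leftarrow>roots n. chi q (wt n) - b)) * (\<Prod>b\<leftarrow>roots n. chi q (wt m) - b)) *s v"
      using root_poly_eigen[OF C_hw[OF that(1)], of "roots n"] by (simp add: T_def mat_smult_vec vector_smult_assoc)
    moreover have "(\<Prod>b\<leftarrow>roots n. chi q (wt n) - b) \<noteq> 0"
      using chi_inj that by (auto simp: roots_def prod_list_zero_iff simp del: upt_Suc)
    moreover have "(\<Prod>b\<leftarrow>roots n. chi q (wt m) - b) = 0" if "m \<noteq> n"
      using \<open>m \<in> N\<close> that by (auto simp: roots_def prod_list_zero_iff N_def simp del: upt_Suc)
    ultimately show ?thesis by auto
  qed
  define a where "a = (\<Sum>n\<in>N. e n ** T n)"
  have a: "a \<in> ABC_alg" unfolding a_def T_def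
    by (intro gen_alg_sum gen_alg.mult gen_alg.mat_smult gen_alg_root_poly gen_alg.base e) simp
  have "z - a = 0"
  proof (rule commutant_eq_0)
    show "z - a \<in> commutant" using z a gen_alg_commutant commutant_diff by blast
    fix m v assume v: "hw m v"
    show "(z - a) *v v = 0"
    proof (cases "v = 0")
      case False
      then have m: "m \<in> N" using v hw_nonneg by (simp add: N_def)
      have "a *v v = (\<Sum>n\<in>N. if m = n then z *v v else 0)"
        unfolding a_def sum_mv
        by (intro sum.cong refl) (use T[OF v m] e(2) v in \<open>auto simp: mv_simps\<close>)
      then show ?thesis using m fN by (simp add: mv_simps)
    qed simp
  qed
  then show "z \<in> ABC_alg" using a by simp
qed

end

section \<open>Noncommutative algebras with explicit carriers\<close>

text \<open>As the product need not commute, compatibility with scalars is required in each factor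
  separately.\<close>

locale calg = ring A for A :: "(complex, 'a) module" (structure) +
  assumes smult_closed [simp, intro]: "x \<in> carrier A \<Longrightarrow> c \<odot> x \<in> carrier A"
    and smult_add_left: "x \<in> carrier A \<Longrightarrow> (c + d) \<odot> x = c \<odot> x \<oplus> d \<odot> x"
    and smult_add_right: "x \<in> carrier A \<Longrightarrow> y \<in> carrier A \<Longrightarrow> c \<odot> (x \<oplus> y) = c \<odot> x \<oplus> c \<odot> y"
    and smult_smult: "x \<in> carrier A \<Longrightarrow> c \<odot> (d \<odot> x) = (c * d) \<odot> x"
    and smult_one [simp]: "x \<in> carrier A \<Longrightarrow> 1 \<odot> x = x"
    and smult_mult_left: "x \<in> carrier A \<Longrightarrow> y \<in> carrier A \<Longrightarrow> (c \<odot> x) \<otimes> y = c \<odot> (x \<otimes> y)"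
    and smult_mult_right: "x \<in> carrier A \<Longrightarrow> y \<in> carrier A \<Longrightarrow> x \<otimes> (c \<odot> y) = c \<odot> (x \<otimes> y)"
begin

lemma smult_zero_left [simp]:
  assumes "x \<in> carrier A" shows "0 \<odot> x = \<zero>"
proof -
  have "0 \<odot> x \<oplus> 0 \<odot> x = (0 + 0) \<odot> x" by (rule smult_add_left[OF assms, symmetric])
  also have "(0 + 0 :: complex) = 0" by simp
  finally show ?thesis by (rule iffD1[OF add.l_cancel_one[OF smult_closed[OF assms] smult_closed[OF assms]]])
qed

lemma smult_zero_right [simp]: "c \<odot> \<zero> = \<zero>"
proof -
  have "c \<odot> \<zero> \<oplus> c \<odot> \<zero> = c \<odot> (\<zero> \<oplus> \<zero>)" by (rule smult_add_right[OF zero_closed zero_closed, symmetric])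
  also have "\<zero> \<oplus> \<zero> = \<zero>" by simp
  finally show ?thesis by (rule iffD1[OF add.l_cancel_one[OF smult_closed[OF zero_closed] smult_closed[OF zero_closed]]])
qed

lemma smult_minus_one: "x \<in> carrier A \<Longrightarrow> (- 1) \<odot> x = \<ominus> x"
proof -
  assume x: "x \<in> carrier A"
  have "x \<oplus> (- 1) \<odot> x = \<zero>" using smult_add_left[OF x, of 1 "- 1"] x by simp
  then show ?thesis using x by (metis minus_equality a_comm smult_closed)
qed

lemma smult_finsum:
  assumes "f \<in> S \<rightarrow> carrier A" shows "c \<odot> (\<Oplus>x\<in>S. f x) = (\<Oplus>x\<in>S. c \<odot> f x)"
  using assms
proof (induction S rule: infinite_finite_induct)
  case (insert x S)
  then have "f x \<in> carrier A" "f \<in> S \<rightarrow> carrier A" by auto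
  then show ?case using insert.IH insert.hyps by (simp add: finsum_insert smult_add_right Pi_iff)
qed (auto simp: finsum_infinite)

end

lemma alg_homD:
  assumes "h \<in> alg_hom A B"
  shows "x \<in> carrier A \<Longrightarrow> h x \<in> carrier B"
    and "x \<in> carrier A \<Longrightarrow> y \<in> carrier A \<Longrightarrow> h (x \<otimes>\<^bsub>A\<^esub> y) = h x \<otimes>\<^bsub>B\<^esub> h y"
    and "x \<in> carrier A \<Longrightarrow> y \<in> carrier A \<Longrightarrow> h (x \<oplus>\<^bsub>A\<^esub> y) = h x \<oplus>\<^bsub>B\<^esub> h y"
    and "h \<one>\<^bsub>A\<^esub> = \<one>\<^bsub>B\<^esub>"
    and "x \<in> carrier A \<Longrightarrow> h (c \<odot>\<^bsub>A\<^esub> x) = c \<odot>\<^bsub>B\<^esub> h x"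
  using assms by (auto simp: alg_hom_def ring_hom_def)

lemma alg_homI:
  assumes "\<And>x. x \<in> carrier A \<Longrightarrow> h x \<in> carrier B"
    and "\<And>x y. x \<in> carrier A \<Longrightarrow> y \<in> carrier A \<Longrightarrow> h (x \<otimes>\<^bsub>A\<^esub> y) = h x \<otimes>\<^bsub>B\<^esub> h y"
    and "\<And>x y. x \<in> carrier A \<Longrightarrow> y \<in> carrier A \<Longrightarrow> h (x \<oplus>\<^bsub>A\<^esub> y) = h x \<oplus>\<^bsub>B\<^esub> h y"
    and "h \<one>\<^bsub>A\<^esub> = \<one>\<^bsub>B\<^esub>"
    and "\<And>c x. x \<in> carrier A \<Longrightarrow> h (c \<odot>\<^bsub>A\<^esub> x) = c \<odot>\<^bsub>B\<^esub> h x"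
  shows "h \<in> alg_hom A B"
  using assms by (auto simp: alg_hom_def ring_hom_def)

lemma alg_hom_comp: "f \<in> alg_hom A B \<Longrightarrow> g \<in> alg_hom B C \<Longrightarrow> g \<circ> f \<in> alg_hom A C"
  by (rule alg_homI) (simp_all add: alg_homD)

lemma alg_hom_minus:
  assumes "h \<in> alg_hom A B" "calg A" "calg B" "x \<in> carrier A" "y \<in> carrier A"
  shows "h (x \<ominus>\<^bsub>A\<^esub> y) = h x \<ominus>\<^bsub>B\<^esub> h y"
proof -
  interpret A: calg A by fact
  interpret B: calg B by fact
  have "h (\<ominus>\<^bsub>A\<^esub> y) = \<ominus>\<^bsub>B\<^esub> h y"
    using assms alg_homD[OF assms(1)] by (simp add: A.smult_minus_one[symmetric] B.smult_minus_one[symmetric])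
  then show ?thesis using assms alg_homD[OF assms(1)] by (simp add: a_minus_def)
qed

lemma alg_hom_zero:
  assumes "h \<in> alg_hom A B" "calg A" "calg B" shows "h \<zero>\<^bsub>A\<^esub> = \<zero>\<^bsub>B\<^esub>"
proof -
  interpret A: calg A by fact
  interpret B: calg B by fact
  show ?thesis using alg_homD(5)[OF assms(1), of "\<zero>\<^bsub>A\<^esub>" 0] alg_homD(1)[OF assms(1), of "\<zero>\<^bsub>A\<^esub>"] by simp
qed

section \<open>Finitely supported functions and monoid algebras\<close>

abbreviation "pm_keys \<equiv> Poly_Mapping.keys"
abbreviation "pm_lookup \<equiv> Poly_Mapping.lookup"
abbreviation "pm_single \<equiv> Poly_Mapping.single"

lemma pm_decompose: "f = (\<Sum>x\<in>pm_keys f. pm_single x (pm_lookup f x))"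
proof (rule poly_mapping_eqI)
  fix k
  show "pm_lookup f k = pm_lookup (\<Sum>x\<in>pm_keys f. pm_single x (pm_lookup f x)) k"
    by (auto simp: lookup_sum lookup_single when_def in_keys_iff)
qed

lemma pm_induct [consumes 1, case_names zero single add]:
  fixes f :: "'a \<Rightarrow>\<^sub>0 complex"
  assumes "pm_keys f \<subseteq> S" "P 0" "\<And>x a. x \<in> S \<Longrightarrow> P (pm_single x a)"
    "\<And>f g. pm_keys f \<subseteq> S \<Longrightarrow> pm_keys g \<subseteq> S \<Longrightarrow> P f \<Longrightarrow> P g \<Longrightarrow> P (f + g)"
  shows "P f"
proof -
  have "pm_keys (\<Sum>x\<in>T. pm_single x (pm_lookup f x)) \<subseteq> S \<and> P (\<Sum>x\<in>T. pm_single x (pm_lookup f x))"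
    if "finite T" "T \<subseteq> S" for T
    using that
  proof (induction T rule: finite_induct)
    case (insert x T)
    have x: "x \<in> S" and T: "T \<subseteq> S" using insert.prems by auto
    let ?f = "pm_single x (pm_lookup f x)" and ?g = "\<Sum>x\<in>T. pm_single x (pm_lookup f x)"
    have f: "pm_keys ?f \<subseteq> S" using x by simp
    have g: "pm_keys ?g \<subseteq> S" "P ?g" using insert.IH[OF T] by blast+
    have "pm_keys (?f + ?g) \<subseteq> S" by (rule order_trans[OF keys_add Un_least[OF f g(1)]])
    moreover have "P (?f + ?g)" by (rule assms(4)[OF f g(1) assms(3)[OF x] g(2)])
    ultimately show ?case by (simp only: sum.insert[OF insert.hyps] simp_thms)
  qed (simp add: assms(2))
  from this[OF finite_keys assms(1)] show ?thesis by (simp only: pm_decompose[symmetric])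
qed

definition mmul :: "('a \<Rightarrow> 'a \<Rightarrow> 'a) \<Rightarrow> ('a \<Rightarrow>\<^sub>0 complex) \<Rightarrow> ('a \<Rightarrow>\<^sub>0 complex) \<Rightarrow> ('a \<Rightarrow>\<^sub>0 complex)" where
  "mmul m f g = (\<Sum>x\<in>pm_keys f. \<Sum>y\<in>pm_keys g. pm_single (m x y) (pm_lookup f x * pm_lookup g y))"

text \<open>Supports change under addition because of cancellation; summing over a common finite
  superset makes the product visibly bilinear.\<close>

lemma mmul_superset:
  assumes "finite S" "pm_keys f \<subseteq> S" "finite T" "pm_keys g \<subseteq> T"
  shows "mmul m f g = (\<Sum>x\<in>S. \<Sum>y\<in>T. pm_single (m x y) (pm_lookup f x * pm_lookup g y))"
proof -
  have "mmul m f g = (\<Sum>x\<in>pm_keys f. \<Sum>y\<in>T. pm_single (m x y) (pm_lookup f x * pm_lookup g y))"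
    unfolding mmul_def using assms by (intro sum.cong[OF refl], intro sum.mono_neutral_left) (auto simp: not_in_keys_iff_lookup_eq_zero)
  also have "\<dots> = (\<Sum>x\<in>S. \<Sum>y\<in>T. pm_single (m x y) (pm_lookup f x * pm_lookup g y))"
    using assms by (intro sum.mono_neutral_left) (auto simp: not_in_keys_iff_lookup_eq_zero)
  finally show ?thesis .
qed

lemma mmul_add_left: "mmul m (f + f') g = mmul m f g + mmul m f' g"
proof -
  let ?S = "pm_keys f \<union> pm_keys f' \<union> pm_keys (f + f')"
  show ?thesis
    by (subst (1 2 3) mmul_superset[of ?S _ "pm_keys g"])
      (auto simp: lookup_add ring_distribs single_add sum.distrib)
qed

lemma mmul_add_right: "mmul m g (f + f') = mmul m g f + mmul m g f'"
proof -
  let ?S = "pm_keys f \<union> pm_keys f' \<union> pm_keys (f + f')"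
  show ?thesis
    by (subst (1 2 3) mmul_superset[of "pm_keys g" _ ?S])
      (auto simp: lookup_add ring_distribs single_add sum.distrib)
qed

lemma mmul_zero [simp]: "mmul m 0 g = 0" "mmul m f 0 = 0"
  by (simp_all add: mmul_def)

lemma mmul_single: "mmul m (pm_single x a) (pm_single y b) = pm_single (m x y) (a * b)"
  by (subst mmul_superset[of "{x}" _ "{y}"]) auto

lemma mmul_keys: "pm_keys (mmul m f g) \<subseteq> {m x y | x y. x \<in> pm_keys f \<and> y \<in> pm_keys g}"
proof -
  have "pm_keys (mmul m f g) \<subseteq> (\<Union>x\<in>pm_keys f. \<Union>y\<in>pm_keys g. pm_keys (pm_single (m x y) (pm_lookup f x * pm_lookup g y)))"
    unfolding mmul_def by (rule order_trans[OF keys_sum]) (intro UN_mono order_refl keys_sum)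
  also have "\<dots> \<subseteq> {m x y | x y. x \<in> pm_keys f \<and> y \<in> pm_keys g}" by auto
  finally show ?thesis .
qed

abbreviation "pm_scale c \<equiv> Poly_Mapping.map ((*) (c :: complex))"

lemma lookup_pm_scale: "pm_lookup (pm_scale c f) k = c * pm_lookup f k"
  by (simp add: map.rep_eq when_def)

lemma pm_scale_add: "pm_scale c (f + g) = pm_scale c f + pm_scale c g"
  and pm_scale_add_left: "pm_scale (c + d) f = pm_scale c f + pm_scale d f"
  and pm_scale_scale: "pm_scale c (pm_scale d f) = pm_scale (c * d) f"
  and pm_scale_one: "pm_scale 1 f = f"
  and pm_scale_zero: "pm_scale c 0 = 0"
  and pm_scale_single: "pm_scale c (pm_single x a) = pm_single x (c * a)"
  by (auto intro!: poly_mapping_eqI simp: lookup_pm_scale lookup_add ring_distribs lookup_single when_def)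

lemma pm_scale_keys: "pm_keys (pm_scale c f) \<subseteq> pm_keys f"
  by (auto simp: in_keys_iff lookup_pm_scale)

lemma monoid_algebra_simps:
  "carrier (monoid_algebra M) = {f. pm_keys f \<subseteq> carrier M}"
  "mult (monoid_algebra M) = mmul (mult M)"
  "\<one>\<^bsub>monoid_algebra M\<^esub> = pm_single \<one>\<^bsub>M\<^esub> 1"
  "\<zero>\<^bsub>monoid_algebra M\<^esub> = 0"
  "add (monoid_algebra M) = (+)"
  "module.smult (monoid_algebra M) = (\<lambda>c f. pm_scale c f)"
  by (auto simp: monoid_algebra_def mmul_def fun_eq_iff)

lemma pm_keys_add_subset: "pm_keys f \<subseteq> S \<Longrightarrow> pm_keys g \<subseteq> S \<Longrightarrow> pm_keys (f + g) \<subseteq> S"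
  using keys_add[of f g] by blast

text \<open>By biadditivity, associativity and the unit laws reduce to single terms, where they are
  those of the monoid.\<close>

lemma calg_monoid_algebra:
  assumes "Group.monoid M"
  shows "calg (monoid_algebra M)"
proof -
  interpret M: Group.monoid M by fact
  let ?m = "mult M"
  let ?C = "{f. pm_keys f \<subseteq> carrier M}"
  have closed: "mmul ?m f g \<in> ?C" if "f \<in> ?C" "g \<in> ?C" for f g
    using mmul_keys[of ?m f g] that by force
  have assoc: "mmul ?m (mmul ?m f g) h = mmul ?m f (mmul ?m g h)" if f: "f \<in> ?C" and g: "g \<in> ?C" and h: "h \<in> ?C" for f g h
  proof -
    have f': "pm_keys f \<subseteq> carrier M" and g': "pm_keys g \<subseteq> carrier M" and h': "pm_keys h \<subseteq> carrier M" using f g h by auto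
    from f' show ?thesis
    proof (induction f rule: pm_induct)
      case (single x a)
      from g' show ?case
      proof (induction g rule: pm_induct)
        case (single y b)
        from h' show ?case
          by (induction h rule: pm_induct)
            (use \<open>x \<in> carrier M\<close> \<open>y \<in> carrier M\<close> in \<open>simp_all add: mmul_single mmul_add_right M.m_assoc mult.assoc\<close>)
      qed (simp_all add: mmul_add_left mmul_add_right)
    qed (simp_all add: mmul_add_left)
  qed
  have one: "mmul ?m (pm_single \<one>\<^bsub>M\<^esub> 1) f = f" "mmul ?m f (pm_single \<one>\<^bsub>M\<^esub> 1) = f" if "f \<in> ?C" for f
  proof -
    have f': "pm_keys f \<subseteq> carrier M" using that by simp
    then show "mmul ?m (pm_single \<one>\<^bsub>M\<^esub> 1) f = f"
      by (induction f rule: pm_induct) (simp_all add: mmul_single mmul_add_right)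
    from f' show "mmul ?m f (pm_single \<one>\<^bsub>M\<^esub> 1) = f"
      by (induction f rule: pm_induct) (simp_all add: mmul_single mmul_add_left)
  qed
  have sm: "mmul ?m (pm_scale c f) g = pm_scale c (mmul ?m f g)" "mmul ?m f (pm_scale c g) = pm_scale c (mmul ?m f g)" for c f g
  proof -
    have "mmul ?m (pm_scale c f) g = (\<Sum>x\<in>pm_keys f. \<Sum>y\<in>pm_keys g. pm_scale c (pm_single (?m x y) (pm_lookup f x * pm_lookup g y)))"
      by (subst mmul_superset[of "pm_keys f" _ "pm_keys g"]) (auto simp: lookup_pm_scale pm_scale_keys pm_scale_single mult.assoc)
    moreover have "mmul ?m f (pm_scale c g) = (\<Sum>x\<in>pm_keys f. \<Sum>y\<in>pm_keys g. pm_scale c (pm_single (?m x y) (pm_lookup f x * pm_lookup g y)))"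
      by (subst mmul_superset[of "pm_keys f" _ "pm_keys g"]) (auto simp: lookup_pm_scale pm_scale_keys pm_scale_single mult.left_commute)
    moreover have "pm_scale c (sum F S) = (\<Sum>s\<in>S. pm_scale c (F s))" for F :: "'b \<Rightarrow> 'a \<Rightarrow>\<^sub>0 complex" and S
      by (induction S rule: infinite_finite_induct) (simp_all add: pm_scale_add pm_scale_zero)
    moreover have "pm_scale c (sum F S) = (\<Sum>s\<in>S. pm_scale c (F s))" for F :: "'a \<Rightarrow> 'a \<Rightarrow>\<^sub>0 complex" and S
      by (induction S rule: infinite_finite_induct) (simp_all add: pm_scale_add pm_scale_zero)
    ultimately show "mmul ?m (pm_scale c f) g = pm_scale c (mmul ?m f g)" "mmul ?m f (pm_scale c g) = pm_scale c (mmul ?m f g)"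
      by (simp_all add: mmul_def)
  qed
  have "ring (monoid_algebra M)"
  proof (rule ringI)
    show "abelian_group (monoid_algebra M)"
    proof (rule abelian_groupI)
      fix x assume "x \<in> carrier (monoid_algebra M)"
      then show "\<exists>y\<in>carrier (monoid_algebra M). y \<oplus>\<^bsub>monoid_algebra M\<^esub> x = \<zero>\<^bsub>monoid_algebra M\<^esub>"
        by (intro bexI[of _ "- x"]) (auto simp: monoid_algebra_simps)
    qed (auto simp: monoid_algebra_simps pm_keys_add_subset add_ac intro: pm_keys_add_subset[THEN subsetD])
    show "Group.monoid (monoid_algebra M)"
      using closed assoc one by (intro monoidI) (auto simp: monoid_algebra_simps simp del: Collect_cong)
  qed (simp_all add: monoid_algebra_simps mmul_add_left mmul_add_right)
  then show ?thesis
  proof (intro calg.intro calg_axioms.intro)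
    fix x c assume "x \<in> carrier (monoid_algebra M)"
    then show "c \<odot>\<^bsub>monoid_algebra M\<^esub> x \<in> carrier (monoid_algebra M)"
      using pm_scale_keys[of c x] by (auto simp: monoid_algebra_simps)
  qed (simp_all add: monoid_algebra_simps pm_scale_add pm_scale_add_left pm_scale_scale pm_scale_one sm)
qed

lemma smult_a_minus:
  assumes "calg A" "x \<in> carrier A" "y \<in> carrier A"
  shows "c \<odot>\<^bsub>A\<^esub> (x \<ominus>\<^bsub>A\<^esub> y) = c \<odot>\<^bsub>A\<^esub> x \<ominus>\<^bsub>A\<^esub> c \<odot>\<^bsub>A\<^esub> y"
proof -
  interpret A: calg A by fact
  have "c \<odot>\<^bsub>A\<^esub> (\<ominus>\<^bsub>A\<^esub> y) = c \<odot>\<^bsub>A\<^esub> ((- 1) \<odot>\<^bsub>A\<^esub> y)" by (simp only: A.smult_minus_one[OF assms(3)])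
  also have "\<dots> = (- 1) \<odot>\<^bsub>A\<^esub> (c \<odot>\<^bsub>A\<^esub> y)" by (simp only: A.smult_smult[OF assms(3)] mult.commute)
  also have "\<dots> = \<ominus>\<^bsub>A\<^esub> (c \<odot>\<^bsub>A\<^esub> y)" using assms(3) by (intro A.smult_minus_one) simp
  finally show ?thesis
    unfolding a_minus_def using assms(2,3) A.smult_add_right[of x "\<ominus>\<^bsub>A\<^esub> y" c] by simp
qed

section \<open>Linear extension of a map on basis elements\<close>

lemma lin_ext_superset:
  assumes "calg B" "finite S" "pm_keys f \<subseteq> S" "h \<in> S \<rightarrow> carrier B"
  shows "lin_ext B h f = (\<Oplus>\<^bsub>B\<^esub>x\<in>S. pm_lookup f x \<odot>\<^bsub>B\<^esub> h x)"
proof -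
  interpret B: calg B by fact
  have "(\<Oplus>\<^bsub>B\<^esub>x\<in>pm_keys f. pm_lookup f x \<odot>\<^bsub>B\<^esub> h x) = (\<Oplus>\<^bsub>B\<^esub>x\<in>S. pm_lookup f x \<odot>\<^bsub>B\<^esub> h x)"
    using assms by (intro B.add.finprod_mono_neutral_cong_left) (auto simp: not_in_keys_iff_lookup_eq_zero Pi_iff)
  then show ?thesis by (simp add: lin_ext_def)
qed

lemma lin_ext_cong:
  assumes "calg B" "\<And>x. x \<in> pm_keys f \<Longrightarrow> h x = h' x" "\<And>x. x \<in> pm_keys f \<Longrightarrow> h' x \<in> carrier B"
  shows "lin_ext B h f = lin_ext B h' f"
proof -
  interpret B: calg B by fact
  show ?thesis unfolding lin_ext_def using assms(2,3) by (intro B.finsum_cong') auto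
qed

context
  fixes B :: "(complex, 'b) module" and h :: "'a \<Rightarrow> 'b" and S :: "'a set"
  assumes B: "calg B" and h: "\<And>x. x \<in> S \<Longrightarrow> h x \<in> carrier B"
begin

interpretation B: calg B by (rule B)

lemma lin_ext_closed: "pm_keys f \<subseteq> S \<Longrightarrow> lin_ext B h f \<in> carrier B"
  unfolding lin_ext_def using h by (intro B.finsum_closed) auto

lemma lin_ext_add:
  assumes "pm_keys f \<subseteq> S" "pm_keys g \<subseteq> S"
  shows "lin_ext B h (f + g) = lin_ext B h f \<oplus>\<^bsub>B\<^esub> lin_ext B h g"
proof -
  let ?T = "pm_keys f \<union> pm_keys g"
  have T: "h x \<in> carrier B" if "x \<in> ?T" for x using that h assms by blast
  have "lin_ext B h (f + g) = (\<Oplus>\<^bsub>B\<^esub>x\<in>?T. pm_lookup (f + g) x \<odot>\<^bsub>B\<^esub> h x)"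
    using T by (intro lin_ext_superset[OF B] keys_add) auto
  also have "\<dots> = (\<Oplus>\<^bsub>B\<^esub>x\<in>?T. pm_lookup f x \<odot>\<^bsub>B\<^esub> h x \<oplus>\<^bsub>B\<^esub> pm_lookup g x \<odot>\<^bsub>B\<^esub> h x)"
    using T by (intro B.finsum_cong' refl) (auto simp: lookup_add B.smult_add_left)
  also have "\<dots> = (\<Oplus>\<^bsub>B\<^esub>x\<in>?T. pm_lookup f x \<odot>\<^bsub>B\<^esub> h x) \<oplus>\<^bsub>B\<^esub> (\<Oplus>\<^bsub>B\<^esub>x\<in>?T. pm_lookup g x \<odot>\<^bsub>B\<^esub> h x)"
    using T by (intro B.finsum_addf) auto
  also have "\<dots> = lin_ext B h f \<oplus>\<^bsub>B\<^esub> lin_ext B h g"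
    using T by (subst (1 2) lin_ext_superset[OF B, of ?T]) auto
  finally show ?thesis .
qed

lemma lin_ext_scale:
  assumes "pm_keys f \<subseteq> S" shows "lin_ext B h (pm_scale c f) = c \<odot>\<^bsub>B\<^esub> lin_ext B h f"
proof -
  have T: "h x \<in> carrier B" if "x \<in> pm_keys f" for x using that h assms by blast
  have "lin_ext B h (pm_scale c f) = (\<Oplus>\<^bsub>B\<^esub>x\<in>pm_keys f. c \<odot>\<^bsub>B\<^esub> (pm_lookup f x \<odot>\<^bsub>B\<^esub> h x))"
    using T pm_scale_keys[of c f]
    by (subst lin_ext_superset[OF B, of "pm_keys f"]) (auto simp: lookup_pm_scale B.smult_smult intro!: B.finsum_cong')
  also have "\<dots> = c \<odot>\<^bsub>B\<^esub> lin_ext B h f"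
    unfolding lin_ext_def using T by (intro B.smult_finsum[symmetric]) auto
  finally show ?thesis .
qed

lemma lin_ext_single: "x \<in> S \<Longrightarrow> lin_ext B h (pm_single x a) = a \<odot>\<^bsub>B\<^esub> h x"
  using h by (subst lin_ext_superset[OF B, of "{x}"]) (auto simp: B.finsum_singleton)

lemma lin_ext_zero: "lin_ext B h 0 = \<zero>\<^bsub>B\<^esub>"
  by (simp add: lin_ext_def B.finsum_empty)

lemma lin_ext_mult_right:
  assumes f: "pm_keys f \<subseteq> S" and u: "u \<in> carrier B"
  shows "lin_ext B (\<lambda>x. h x \<otimes>\<^bsub>B\<^esub> u) f = lin_ext B h f \<otimes>\<^bsub>B\<^esub> u"
proof -
  have T: "h x \<in> carrier B" if "x \<in> pm_keys f" for x using that h f by blast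
  have "lin_ext B (\<lambda>x. h x \<otimes>\<^bsub>B\<^esub> u) f = (\<Oplus>\<^bsub>B\<^esub>x\<in>pm_keys f. (pm_lookup f x \<odot>\<^bsub>B\<^esub> h x) \<otimes>\<^bsub>B\<^esub> u)"
    unfolding lin_ext_def using T u by (intro B.finsum_cong') (auto simp: B.smult_mult_left)
  also have "\<dots> = lin_ext B h f \<otimes>\<^bsub>B\<^esub> u"
    unfolding lin_ext_def using T u by (intro B.finsum_ldistr[symmetric]) auto
  finally show ?thesis .
qed

end

lemma lin_ext_alg_hom:
  assumes M: "Group.monoid M" and B: "calg B"
    and h: "\<And>x. x \<in> carrier M \<Longrightarrow> h x \<in> carrier B"
    and mult: "\<And>x y. x \<in> carrier M \<Longrightarrow> y \<in> carrier M \<Longrightarrow> h (x \<otimes>\<^bsub>M\<^esub> y) = h x \<otimes>\<^bsub>B\<^esub> h y"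
    and one: "h \<one>\<^bsub>M\<^esub> = \<one>\<^bsub>B\<^esub>"
  shows "lin_ext B h \<in> alg_hom (monoid_algebra M) B"
proof (rule alg_homI)
  interpret M: Group.monoid M by fact
  interpret B: calg B by fact
  note l = lin_ext_add[OF B h] lin_ext_single[OF B h] lin_ext_zero[OF B h] lin_ext_closed[OF B h]
  fix f g assume f: "f \<in> carrier (monoid_algebra M)" and g: "g \<in> carrier (monoid_algebra M)"
  have f': "pm_keys f \<subseteq> carrier M" and g': "pm_keys g \<subseteq> carrier M" using f g by (auto simp: monoid_algebra_simps)
  have cl: "pm_keys (mmul (mult M) x y) \<subseteq> carrier M" if "pm_keys x \<subseteq> carrier M" "pm_keys y \<subseteq> carrier M" for x y
    using mmul_keys[of "mult M" x y] that by force
  from f' have "lin_ext B h (mmul (mult M) f g) = lin_ext B h f \<otimes>\<^bsub>B\<^esub> lin_ext B h g"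
  proof (induction f rule: pm_induct)
    case zero then show ?case using g' by (simp add: l)
  next
    case (single x a)
    from g' show ?case
    proof (induction g rule: pm_induct)
      case zero then show ?case using single h by (simp add: l)
    next
      case (single y b)
      then show ?case using \<open>x \<in> carrier M\<close> h
        by (simp add: mmul_single l mult B.smult_mult_left B.smult_mult_right B.smult_smult mult.commute)
    next
      case (add g g')
      then show ?case using \<open>x \<in> carrier M\<close> cl[of "pm_single x a"] h by (simp add: mmul_add_right l B.r_distr)
    qed
  next
    case (add f f')
    then show ?case using g' cl by (simp add: mmul_add_left l B.l_distr)
  qed
  then show "lin_ext B h (f \<otimes>\<^bsub>monoid_algebra M\<^esub> g) = lin_ext B h f \<otimes>\<^bsub>B\<^esub> lin_ext B h g" by (simp add: monoid_algebra_simps)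
next
  interpret M: Group.monoid M by fact
  interpret B: calg B by fact
  show "lin_ext B h \<one>\<^bsub>monoid_algebra M\<^esub> = \<one>\<^bsub>B\<^esub>"
    using lin_ext_single[OF B h M.one_closed, where a = 1] one by (simp add: monoid_algebra_simps)
qed (use lin_ext_closed[OF B h] lin_ext_add[OF B h] lin_ext_scale[OF B h] in \<open>auto simp: monoid_algebra_simps\<close>)

section \<open>Quotients by relation ideals and their universal property\<close>

context
  fixes A :: "(complex, 'a) module" and R :: "('a \<times> 'a) set"
  assumes A: "calg A" and R: "R \<subseteq> carrier A \<times> carrier A"
begin

interpretation A: calg A by (rule A)

lemma rel_ideal_ideal: "ideal (rel_ideal A R) A"
  unfolding rel_ideal_def using R by (intro A.genideal_ideal) auto

interpretation I: ideal "rel_ideal A R" A by (rule rel_ideal_ideal)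

lemma quot_class_hom: "quot_class A R \<in> ring_hom A (A Quot rel_ideal A R)"
  using I.rcos_ring_hom by (simp add: quot_class_def[abs_def])

lemma quot_algebra_simps:
  "carrier (quot_algebra A R) = quot_class A R ` carrier A"
  "mult (quot_algebra A R) = rcoset_mult A (rel_ideal A R)"
  "\<one>\<^bsub>quot_algebra A R\<^esub> = quot_class A R \<one>\<^bsub>A\<^esub>"
  "\<zero>\<^bsub>quot_algebra A R\<^esub> = rel_ideal A R"
  "add (quot_algebra A R) = set_add A"
  "module.smult (quot_algebra A R) c X = (\<Union>x\<in>X. quot_class A R (c \<odot>\<^bsub>A\<^esub> x))"
  by (auto simp: quot_algebra_def FactRing_def ring.defs module.defs quot_class_def A_RCOSETS_def' image_def)

lemma quot_class_mem_iff:
  assumes x: "x \<in> carrier A"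
  shows "y \<in> quot_class A R x \<longleftrightarrow> y \<in> carrier A \<and> y \<ominus>\<^bsub>A\<^esub> x \<in> rel_ideal A R"
proof
  assume "y \<in> quot_class A R x"
  then obtain i where i: "i \<in> rel_ideal A R" "y = i \<oplus>\<^bsub>A\<^esub> x" by (auto simp: quot_class_def a_r_coset_def')
  have ic: "i \<in> carrier A" by (rule I.a_Hcarr[OF i(1)])
  then have "y \<ominus>\<^bsub>A\<^esub> x = i" unfolding i(2) using x by (simp add: a_minus_def A.a_assoc A.r_neg)
  then show "y \<in> carrier A \<and> y \<ominus>\<^bsub>A\<^esub> x \<in> rel_ideal A R" using i ic x by simp
next
  assume y: "y \<in> carrier A \<and> y \<ominus>\<^bsub>A\<^esub> x \<in> rel_ideal A R"
  then have "y = (y \<ominus>\<^bsub>A\<^esub> x) \<oplus>\<^bsub>A\<^esub> x" using x by (simp add: a_minus_def A.a_assoc A.l_neg)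
  then show "y \<in> quot_class A R x" using y by (auto simp: quot_class_def a_r_coset_def')
qed

lemma quot_class_self: "x \<in> carrier A \<Longrightarrow> x \<in> quot_class A R x"
  by (simp add: quot_class_mem_iff A.r_neg a_minus_def)

text \<open>The ideal is one of rings only; it absorbs scalars because scaling is multiplication by
  a multiple of the unit.\<close>

lemma rel_ideal_smult: "x \<in> rel_ideal A R \<Longrightarrow> c \<odot>\<^bsub>A\<^esub> x \<in> rel_ideal A R"
proof -
  assume x: "x \<in> rel_ideal A R"
  then have xc: "x \<in> carrier A" by (rule I.a_Hcarr)
  have "(c \<odot>\<^bsub>A\<^esub> \<one>\<^bsub>A\<^esub>) \<otimes>\<^bsub>A\<^esub> x \<in> rel_ideal A R" using x by (intro I.I_l_closed) auto
  then show ?thesis using xc by (simp add: A.smult_mult_left)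
qed

lemma quot_class_eq: "x \<in> carrier A \<Longrightarrow> y \<in> quot_class A R x \<Longrightarrow> quot_class A R y = quot_class A R x"
  using A.a_repr_independence by (metis quot_class_def I.is_additive_subgroup additive_subgroup.a_subgroup)

lemma quot_smult: "x \<in> carrier A \<Longrightarrow> c \<odot>\<^bsub>quot_algebra A R\<^esub> quot_class A R x = quot_class A R (c \<odot>\<^bsub>A\<^esub> x)"
proof -
  assume x: "x \<in> carrier A"
  have "quot_class A R (c \<odot>\<^bsub>A\<^esub> y) = quot_class A R (c \<odot>\<^bsub>A\<^esub> x)" if y: "y \<in> quot_class A R x" for y
  proof (rule quot_class_eq)
    have yc: "y \<in> carrier A" and d: "y \<ominus>\<^bsub>A\<^esub> x \<in> rel_ideal A R" using y quot_class_mem_iff[OF x] by blast+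
    have "c \<odot>\<^bsub>A\<^esub> (y \<ominus>\<^bsub>A\<^esub> x) = c \<odot>\<^bsub>A\<^esub> y \<ominus>\<^bsub>A\<^esub> c \<odot>\<^bsub>A\<^esub> x"
      by (rule smult_a_minus[OF A yc x])
    then show "c \<odot>\<^bsub>A\<^esub> y \<in> quot_class A R (c \<odot>\<^bsub>A\<^esub> x)"
      using rel_ideal_smult[OF d, of c] quot_class_mem_iff[of "c \<odot>\<^bsub>A\<^esub> x"] x yc by simp
  qed (use x in auto)
  then have "(\<Union>y\<in>quot_class A R x. quot_class A R (c \<odot>\<^bsub>A\<^esub> y)) = (\<Union>y\<in>quot_class A R x. quot_class A R (c \<odot>\<^bsub>A\<^esub> x))"
    by (intro SUP_cong refl)
  also have "\<dots> = quot_class A R (c \<odot>\<^bsub>A\<^esub> x)" using quot_class_self[OF x] by (intro UN_constant[THEN trans]) auto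
  finally show ?thesis by (simp only: quot_algebra_simps)
qed

lemma quot_ops:
  "x \<in> carrier A \<Longrightarrow> y \<in> carrier A \<Longrightarrow> quot_class A R x \<otimes>\<^bsub>quot_algebra A R\<^esub> quot_class A R y = quot_class A R (x \<otimes>\<^bsub>A\<^esub> y)"
  "x \<in> carrier A \<Longrightarrow> y \<in> carrier A \<Longrightarrow> quot_class A R x \<oplus>\<^bsub>quot_algebra A R\<^esub> quot_class A R y = quot_class A R (x \<oplus>\<^bsub>A\<^esub> y)"
  using quot_class_hom by (auto simp: quot_algebra_simps ring_hom_def FactRing_def)

lemma calg_quot_algebra: "calg (quot_algebra A R)"
proof -
  have r: "ring (A Quot rel_ideal A R)" by (rule I.quotient_is_ring)
  have "ring (quot_algebra A R)"
  proof -
    have e: "carrier (quot_algebra A R) = carrier (A Quot rel_ideal A R)" "mult (quot_algebra A R) = mult (A Quot rel_ideal A R)"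
      "one (quot_algebra A R) = one (A Quot rel_ideal A R)" "zero (quot_algebra A R) = zero (A Quot rel_ideal A R)"
      "add (quot_algebra A R) = add (A Quot rel_ideal A R)"
      by (simp_all add: quot_algebra_def ring.defs module.defs)
    interpret Q: ring "A Quot rel_ideal A R" by (rule r)
    show ?thesis
      by (rule ringI; (rule abelian_groupI monoidI)?; (unfold e)?)
        (auto simp: Q.a_assoc Q.m_assoc Q.l_distr Q.r_distr Q.a_ac intro: Q.add.l_inv_ex)
  qed
  then show ?thesis
    by (intro calg.intro calg_axioms.intro)
      (auto simp: quot_algebra_simps(1) quot_smult quot_ops A.smult_add_left A.smult_add_right A.smult_smult A.smult_mult_left A.smult_mult_right)
qed

lemma quot_class_alg_hom: "quot_class A R \<in> alg_hom A (quot_algebra A R)"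
  by (rule alg_homI) (simp_all add: quot_algebra_simps(1,3) quot_ops quot_smult)

lemma quot_class_rel:
  assumes "(l, r) \<in> R" shows "quot_class A R l = quot_class A R r"
proof -
  have lr: "l \<in> carrier A" "r \<in> carrier A" using assms R by auto
  have "{l \<ominus>\<^bsub>A\<^esub> r | l r. (l, r) \<in> R} \<subseteq> carrier A" using R by auto
  from A.genideal_self[OF this] have "l \<ominus>\<^bsub>A\<^esub> r \<in> rel_ideal A R"
    using assms unfolding rel_ideal_def by blast
  then show ?thesis using quot_class_eq[of r l] lr by (simp add: quot_class_mem_iff)
qed

text \<open>The kernel of a homomorphism is a two-sided ideal and contains all relators. Constancy
  on classes is what gives the \<open>the_elem\<close> in the definitions of induced maps its
  meaning.\<close>

lemma quot_factor:
  assumes C: "calg C" and \<Phi>: "\<Phi> \<in> alg_hom A C" and rels: "\<And>l r. (l, r) \<in> R \<Longrightarrow> \<Phi> l = \<Phi> r"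
    and x: "x \<in> carrier A" and y: "y \<in> quot_class A R x"
  shows "\<Phi> y = \<Phi> x"
proof -
  interpret C: calg C by fact
  have "\<Phi> \<in> ring_hom A C" using \<Phi> unfolding alg_hom_def by blast
  then interpret h: ring_hom_ring A C \<Phi>
    by (rule ring_hom_ringI2[OF A.ring_axioms C.ring_axioms])
  have k: "l \<ominus>\<^bsub>A\<^esub> r \<in> a_kernel A C \<Phi>" if lr: "(l, r) \<in> R" for l r
  proof -
    have l: "l \<in> carrier A" and r: "r \<in> carrier A" using subsetD[OF R lr] by blast+
    have "\<Phi> (l \<ominus>\<^bsub>A\<^esub> r) = \<Phi> r \<ominus>\<^bsub>C\<^esub> \<Phi> r"
      using alg_hom_minus[OF \<Phi> A C l r] unfolding rels[OF lr] .
    also have "\<dots> = \<zero>\<^bsub>C\<^esub>" unfolding a_minus_def by (rule C.r_neg[OF alg_homD(1)[OF \<Phi> r]])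
    finally show ?thesis unfolding a_kernel_def' using A.minus_closed[OF l r] by blast
  qed
  have "rel_ideal A R \<subseteq> a_kernel A C \<Phi>"
    unfolding rel_ideal_def
  proof (rule A.genideal_minimal[OF h.kernel_is_ideal], rule subsetI)
    fix z assume "z \<in> {l \<ominus>\<^bsub>A\<^esub> r |l r. (l, r) \<in> R}"
    then obtain l r where "z = l \<ominus>\<^bsub>A\<^esub> r" "(l, r) \<in> R" by blast
    then show "z \<in> a_kernel A C \<Phi>" using k[of l r] by (simp only:)
  qed
  moreover have y': "y \<in> carrier A" "y \<ominus>\<^bsub>A\<^esub> x \<in> rel_ideal A R" using y quot_class_mem_iff[OF x] by blast+
  ultimately have "\<Phi> (y \<ominus>\<^bsub>A\<^esub> x) = \<zero>\<^bsub>C\<^esub>" unfolding a_kernel_def' by blast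
  then have "\<Phi> y \<ominus>\<^bsub>C\<^esub> \<Phi> x = \<zero>\<^bsub>C\<^esub>" unfolding alg_hom_minus[OF \<Phi> A C y'(1) x] .
  then have "(\<Phi> y \<ominus>\<^bsub>C\<^esub> \<Phi> x) \<oplus>\<^bsub>C\<^esub> \<Phi> x = \<Phi> x" using alg_homD(1)[OF \<Phi> x] by simp
  then show ?thesis using alg_homD(1)[OF \<Phi> y'(1)] alg_homD(1)[OF \<Phi> x] by (simp add: a_minus_def C.a_assoc C.l_neg)
qed

lemma quot_factor_the_elem:
  assumes "calg C" "\<Phi> \<in> alg_hom A C" "\<And>l r. (l, r) \<in> R \<Longrightarrow> \<Phi> l = \<Phi> r" "x \<in> carrier A"
  shows "the_elem (\<Phi> ` quot_class A R x) = \<Phi> x"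
proof -
  have "\<Phi> ` quot_class A R x = (\<lambda>_. \<Phi> x) ` quot_class A R x"
    by (rule image_cong[OF refl quot_factor[OF assms(1-4)]])
  also have "\<dots> = {\<Phi> x}" by (rule image_constant[OF quot_class_self[OF assms(4)]])
  finally show ?thesis by simp
qed

lemma quot_factor_alg_hom:
  assumes "calg C" "\<Phi> \<in> alg_hom A C" "\<And>l r. (l, r) \<in> R \<Longrightarrow> \<Phi> l = \<Phi> r"
  shows "(\<lambda>X. the_elem (\<Phi> ` X)) \<in> alg_hom (quot_algebra A R) C"
  by (rule alg_homI)
    (auto simp: quot_algebra_simps(1,3) quot_ops quot_smult quot_factor_the_elem[OF assms] alg_homD[OF assms(2)])

end

section \<open>Presentations and tensor products\<close>

lemma monoid_free: "Group.monoid \<lparr>carrier = UNIV, mult = (@), one = []\<rparr>"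
  by (rule monoidI) simp_all

lemma calg_free_algebra: "calg free_algebra"
  unfolding free_algebra_def by (rule calg_monoid_algebra[OF monoid_free])

lemma carrier_free_algebra [simp]: "carrier free_algebra = UNIV"
  by (simp add: free_algebra_def monoid_algebra_simps)

lemma free_algebra_simps:
  "mult free_algebra = mmul (@)" "add free_algebra = (+)" "module.smult free_algebra = (\<lambda>c f. pm_scale c f)"
  "\<one>\<^bsub>free_algebra\<^esub> = pm_single [] 1" "\<zero>\<^bsub>free_algebra\<^esub> = 0"
  by (simp_all add: free_algebra_def monoid_algebra_simps)

definition word_eval :: "(complex, 'b) module \<Rightarrow> ('g \<Rightarrow> 'b) \<Rightarrow> 'g list \<Rightarrow> 'b" where
  "word_eval B \<phi> w = foldr (\<lambda>g y. \<phi> g \<otimes>\<^bsub>B\<^esub> y) w \<one>\<^bsub>B\<^esub>"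

definition free_eval :: "(complex, 'b) module \<Rightarrow> ('g \<Rightarrow> 'b) \<Rightarrow> ('g list \<Rightarrow>\<^sub>0 complex) \<Rightarrow> 'b" where
  "free_eval B \<phi> = lin_ext B (word_eval B \<phi>)"

lemma presented_lift_eq: "presented_lift B \<phi> = (\<lambda>X. the_elem (free_eval B \<phi> ` X))"
  by (simp add: fun_eq_iff presented_lift_def free_eval_def word_eval_def[abs_def])

context
  fixes B :: "(complex, 'b) module" and \<phi> :: "'g \<Rightarrow> 'b"
  assumes B: "calg B" and \<phi>: "\<And>g. \<phi> g \<in> carrier B"
begin

interpretation B: calg B by (rule B)

lemma word_eval_closed: "word_eval B \<phi> w \<in> carrier B"
  by (induction w) (simp_all add: word_eval_def \<phi>)

lemma word_eval_append: "word_eval B \<phi> (u @ v) = word_eval B \<phi> u \<otimes>\<^bsub>B\<^esub> word_eval B \<phi> v"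
  by (induction u) (use word_eval_closed \<phi> in \<open>simp_all add: word_eval_def B.m_assoc\<close>)

lemma free_eval_alg_hom: "free_eval B \<phi> \<in> alg_hom free_algebra B"
  unfolding free_eval_def free_algebra_def
  by (rule lin_ext_alg_hom[OF monoid_free B]) (simp_all add: word_eval_closed word_eval_append, simp add: word_eval_def)

lemma free_eval_gen: "free_eval B \<phi> (gen g) = \<phi> g"
  unfolding free_eval_def gen_def
proof (subst lin_ext_single[where S = UNIV, OF B])
  have "word_eval B \<phi> [g] = \<phi> g" using \<phi> by (simp add: word_eval_def)
  then show "1 \<odot>\<^bsub>B\<^esub> word_eval B \<phi> [g] = \<phi> g" using \<phi> by simp
qed (simp_all add: word_eval_closed)

lemma presented_lift_alg_hom:
  assumes "\<And>l r. (l, r) \<in> R \<Longrightarrow> free_eval B \<phi> l = free_eval B \<phi> r"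
  shows "presented_lift B \<phi> \<in> alg_hom (quot_algebra free_algebra R) B"
    and "presented_lift B \<phi> (quot_class free_algebra R (gen g)) = \<phi> g"
  unfolding presented_lift_eq
  using quot_factor_alg_hom[OF calg_free_algebra _ B free_eval_alg_hom assms]
    quot_factor_the_elem[OF calg_free_algebra _ B free_eval_alg_hom assms, where x = "gen g"]
  by (simp_all add: free_eval_gen)

end

lemma alg_hom_free_unique:
  assumes B: "calg B" and f: "f \<in> alg_hom free_algebra B" and g: "g \<in> alg_hom free_algebra B"
    and eq: "\<And>x. f (gen x) = g (gen x)"
  shows "f w = g w"
proof -
  have "pm_keys w \<subseteq> UNIV" by simp
  then show ?thesis
  proof (induction w rule: pm_induct)
    case zero
    then show ?case using alg_hom_zero[OF f calg_free_algebra B] alg_hom_zero[OF g calg_free_algebra B] by (simp add: free_algebra_simps)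
  next
    case (single u a)
    have "f (pm_single u 1) = g (pm_single u 1)"
    proof (induction u)
      case Nil
      then show ?case using alg_homD(4)[OF f] alg_homD(4)[OF g] by (simp add: free_algebra_simps)
    next
      case (Cons x u)
      have "pm_single (x # u) (1 :: complex) = gen x \<otimes>\<^bsub>free_algebra\<^esub> pm_single u 1"
        by (simp add: free_algebra_simps gen_def mmul_single)
      then show ?case using alg_homD(2)[OF f, of "gen x" "pm_single u 1"] alg_homD(2)[OF g, of "gen x" "pm_single u 1"] Cons eq by simp
    qed
    moreover have "pm_single u a = a \<odot>\<^bsub>free_algebra\<^esub> pm_single u 1" by (simp add: free_algebra_simps pm_scale_single)
    ultimately show ?case using alg_homD(5)[OF f, of "pm_single u 1" a] alg_homD(5)[OF g, of "pm_single u 1" a] by simp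
  next
    case (add v w)
    then show ?case using alg_homD(3)[OF f, of v w] alg_homD(3)[OF g, of v w] by (simp add: free_algebra_simps)
  qed
qed

lemma alg_hom_presented_unique:
  assumes B: "calg B" and f: "f \<in> alg_hom (quot_algebra free_algebra R) B" and g: "g \<in> alg_hom (quot_algebra free_algebra R) B"
    and eq: "\<And>x. f (quot_class free_algebra R (gen x)) = g (quot_class free_algebra R (gen x))"
    and X: "X \<in> carrier (quot_algebra free_algebra R)"
  shows "f X = g X"
proof -
  have R: "R \<subseteq> carrier free_algebra \<times> carrier free_algebra" by simp
  note qc = quot_class_alg_hom[OF calg_free_algebra R]
  obtain x where x: "X = quot_class free_algebra R x"
    using X unfolding quot_algebra_simps(1)[OF calg_free_algebra R] by blast
  have "(f \<circ> quot_class free_algebra R) x = (g \<circ> quot_class free_algebra R) x"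
    by (rule alg_hom_free_unique[OF B alg_hom_comp[OF qc f] alg_hom_comp[OF qc g]]) (simp only: comp_apply eq)
  then show ?thesis by (simp add: x)
qed

text \<open>Bilinear maps that are moreover multiplicative and unital, that is, those whose lift to
  the tensor product is an algebra homomorphism.\<close>

definition bihom :: "(complex, 'a) module \<Rightarrow> (complex, 'b) module \<Rightarrow> (complex, 'c) module \<Rightarrow> ('a \<Rightarrow> 'b \<Rightarrow> 'c) \<Rightarrow> bool" where
  "bihom A B C \<beta> \<longleftrightarrow>
    (\<forall>a\<in>carrier A. \<forall>b\<in>carrier B. \<beta> a b \<in> carrier C) \<and>
    (\<forall>a\<in>carrier A. \<forall>a'\<in>carrier A. \<forall>b\<in>carrier B. \<beta> (a \<oplus>\<^bsub>A\<^esub> a') b = \<beta> a b \<oplus>\<^bsub>C\<^esub> \<beta> a' b) \<and>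
    (\<forall>a\<in>carrier A. \<forall>b\<in>carrier B. \<forall>b'\<in>carrier B. \<beta> a (b \<oplus>\<^bsub>B\<^esub> b') = \<beta> a b \<oplus>\<^bsub>C\<^esub> \<beta> a b') \<and>
    (\<forall>c. \<forall>a\<in>carrier A. \<forall>b\<in>carrier B. \<beta> (c \<odot>\<^bsub>A\<^esub> a) b = c \<odot>\<^bsub>C\<^esub> \<beta> a b \<and> \<beta> a (c \<odot>\<^bsub>B\<^esub> b) = c \<odot>\<^bsub>C\<^esub> \<beta> a b) \<and>
    (\<forall>a\<in>carrier A. \<forall>a'\<in>carrier A. \<forall>b\<in>carrier B. \<forall>b'\<in>carrier B.
      \<beta> (a \<otimes>\<^bsub>A\<^esub> a') (b \<otimes>\<^bsub>B\<^esub> b') = \<beta> a b \<otimes>\<^bsub>C\<^esub> \<beta> a' b') \<and>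
    \<beta> \<one>\<^bsub>A\<^esub> \<one>\<^bsub>B\<^esub> = \<one>\<^bsub>C\<^esub>"

lemma bihom_hom_hom:
  assumes C: "calg C" and f: "f \<in> alg_hom A C" and g: "g \<in> alg_hom B C"
    and comm: "\<And>a b. a \<in> carrier A \<Longrightarrow> b \<in> carrier B \<Longrightarrow> g b \<otimes>\<^bsub>C\<^esub> f a = f a \<otimes>\<^bsub>C\<^esub> g b"
  shows "bihom A B C (\<lambda>a b. f a \<otimes>\<^bsub>C\<^esub> g b)"
proof -
  interpret C: calg C by fact
  note fg = alg_homD(1)[OF f] alg_homD(1)[OF g]
  have "f a \<otimes>\<^bsub>C\<^esub> f a' \<otimes>\<^bsub>C\<^esub> (g b \<otimes>\<^bsub>C\<^esub> g b') = f a \<otimes>\<^bsub>C\<^esub> g b \<otimes>\<^bsub>C\<^esub> (f a' \<otimes>\<^bsub>C\<^esub> g b')"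
    if "a \<in> carrier A" "a' \<in> carrier A" "b \<in> carrier B" "b' \<in> carrier B" for a a' b b'
  proof -
    have "f a' \<otimes>\<^bsub>C\<^esub> (g b \<otimes>\<^bsub>C\<^esub> g b') = g b \<otimes>\<^bsub>C\<^esub> (f a' \<otimes>\<^bsub>C\<^esub> g b')"
      using that fg comm[of a' b] by (simp add: C.m_assoc[symmetric])
    then show ?thesis using that fg by (simp add: C.m_assoc)
  qed
  then show ?thesis
    using fg unfolding bihom_def
    by (auto simp: alg_homD(2-5)[OF f] alg_homD(2-5)[OF g] C.l_distr C.r_distr C.smult_mult_left C.smult_mult_right)
qed

lemma monoid_pairs: "calg A \<Longrightarrow> calg B \<Longrightarrow> Group.monoid (A \<times>\<times> B)"
  by (intro DirProd_monoid) (auto intro: ring.is_monoid calg.axioms(1))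

context
  fixes A :: "(complex, 'a) module" and B :: "(complex, 'b) module"
  assumes A: "calg A" and B: "calg B"
begin

interpretation A: calg A by (rule A)
interpretation B: calg B by (rule B)

abbreviation (input) "AB \<equiv> monoid_algebra (A \<times>\<times> B)"

lemma calg_AB: "calg AB" by (rule calg_monoid_algebra[OF monoid_pairs[OF A B]])

interpretation AB: calg AB by (rule calg_AB)

lemma pair_in: "a \<in> carrier A \<Longrightarrow> b \<in> carrier B \<Longrightarrow> pair a b \<in> carrier AB"
  and single_in: "a \<in> carrier A \<Longrightarrow> b \<in> carrier B \<Longrightarrow> pm_single (a, b) c \<in> carrier AB"
  by (auto simp: pair_def monoid_algebra_simps)

lemma bilinear_rels_carrier: "bilinear_rels A B \<subseteq> carrier AB \<times> carrier AB"
proof -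
  have "x + y \<in> carrier AB" if "x \<in> carrier AB" "y \<in> carrier AB" for x y
    using AB.a_closed[OF that] by (simp add: monoid_algebra_simps)
  then show ?thesis unfolding bilinear_rels_def using pair_in single_in by auto
qed

lemma calg_tensor: "calg (tensor_algebra A B)"
  unfolding tensor_algebra_def by (rule calg_quot_algebra[OF calg_AB bilinear_rels_carrier])

lemmas tens_hom = quot_class_alg_hom[OF calg_AB bilinear_rels_carrier, folded tensor_algebra_def]

lemma tens_closed: "a \<in> carrier A \<Longrightarrow> b \<in> carrier B \<Longrightarrow> tens A B a b \<in> carrier (tensor_algebra A B)"
  unfolding tens_def by (rule alg_homD(1)[OF tens_hom pair_in])

lemma tens_single:
  assumes "a \<in> carrier A" "b \<in> carrier B"
  shows "quot_class AB (bilinear_rels A B) (pm_single (a, b) c) = c \<odot>\<^bsub>tensor_algebra A B\<^esub> tens A B a b"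
proof -
  have "pm_single (a, b) c = c \<odot>\<^bsub>AB\<^esub> pair a b" by (simp add: monoid_algebra_simps pair_def pm_scale_single)
  then show ?thesis using alg_homD(5)[OF tens_hom pair_in[OF assms], of c] by (simp add: tens_def)
qed

lemma bihom_tens: "bihom A B (tensor_algebra A B) (tens A B)"
proof -
  note rel = quot_class_rel[OF calg_AB bilinear_rels_carrier]
  note h = alg_homD[OF tens_hom]
  have plus: "quot_class AB (bilinear_rels A B) (x + y) = quot_class AB (bilinear_rels A B) x \<oplus>\<^bsub>tensor_algebra A B\<^esub> quot_class AB (bilinear_rels A B) y"
    if "x \<in> carrier AB" "y \<in> carrier AB" for x y
    using h(3)[OF that] by (simp add: monoid_algebra_simps)
  have p1: "tens A B (a \<oplus>\<^bsub>A\<^esub> a') b = tens A B a b \<oplus>\<^bsub>tensor_algebra A B\<^esub> tens A B a' b"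
    if "a \<in> carrier A" "a' \<in> carrier A" "b \<in> carrier B" for a a' b
  proof -
    have "(pair (a \<oplus>\<^bsub>A\<^esub> a') b, pair a b + pair a' b) \<in> bilinear_rels A B" using that unfolding bilinear_rels_def by blast
    from rel[OF this] plus[OF pair_in[OF that(1,3)] pair_in[OF that(2,3)]] show ?thesis unfolding tens_def by (rule trans)
  qed
  have p2: "tens A B a (b \<oplus>\<^bsub>B\<^esub> b') = tens A B a b \<oplus>\<^bsub>tensor_algebra A B\<^esub> tens A B a b'"
    if "a \<in> carrier A" "b \<in> carrier B" "b' \<in> carrier B" for a b b'
  proof -
    have "(pair a (b \<oplus>\<^bsub>B\<^esub> b'), pair a b + pair a b') \<in> bilinear_rels A B" using that unfolding bilinear_rels_def by blast
    from rel[OF this] plus[OF pair_in[OF that(1,2)] pair_in[OF that(1,3)]] show ?thesis unfolding tens_def by (rule trans)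
  qed
  have p3: "tens A B (c \<odot>\<^bsub>A\<^esub> a) b = c \<odot>\<^bsub>tensor_algebra A B\<^esub> tens A B a b"
    if "a \<in> carrier A" "b \<in> carrier B" for a b c
  proof -
    have "(pair (c \<odot>\<^bsub>A\<^esub> a) b, pm_single (a, b) c) \<in> bilinear_rels A B" using that unfolding bilinear_rels_def by blast
    from rel[OF this] tens_single[OF that] show ?thesis unfolding tens_def by (rule trans)
  qed
  have p4: "tens A B a (c \<odot>\<^bsub>B\<^esub> b) = c \<odot>\<^bsub>tensor_algebra A B\<^esub> tens A B a b"
    if "a \<in> carrier A" "b \<in> carrier B" for a b c
  proof -
    have "(pair a (c \<odot>\<^bsub>B\<^esub> b), pm_single (a, b) c) \<in> bilinear_rels A B" using that unfolding bilinear_rels_def by blast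
    from rel[OF this] tens_single[OF that] show ?thesis unfolding tens_def by (rule trans)
  qed
  have p5: "tens A B (a \<otimes>\<^bsub>A\<^esub> a') (b \<otimes>\<^bsub>B\<^esub> b') = tens A B a b \<otimes>\<^bsub>tensor_algebra A B\<^esub> tens A B a' b'"
    if "a \<in> carrier A" "a' \<in> carrier A" "b \<in> carrier B" "b' \<in> carrier B" for a a' b b'
  proof -
    have "pair (a \<otimes>\<^bsub>A\<^esub> a') (b \<otimes>\<^bsub>B\<^esub> b') = pair a b \<otimes>\<^bsub>AB\<^esub> pair a' b'"
      by (simp add: monoid_algebra_simps pair_def mmul_single)
    then show ?thesis unfolding tens_def using h(2)[OF pair_in[OF that(1,3)] pair_in[OF that(2,4)]] by (simp only:)
  qed
  have p6: "tens A B \<one>\<^bsub>A\<^esub> \<one>\<^bsub>B\<^esub> = \<one>\<^bsub>tensor_algebra A B\<^esub>"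
    using h(4) by (simp add: tens_def pair_def monoid_algebra_simps)
  show ?thesis unfolding bihom_def by (intro conjI ballI allI) (simp_all only: p1 p2 p3 p4 p5 p6 tens_closed)
qed

context
  fixes C :: "(complex, 'c) module" and \<beta> :: "'a \<Rightarrow> 'b \<Rightarrow> 'c"
  assumes C: "calg C" and \<beta>: "bihom A B C \<beta>"
begin

interpretation C: calg C by (rule C)

lemma bihom_closed: "a \<in> carrier A \<Longrightarrow> b \<in> carrier B \<Longrightarrow> \<beta> a b \<in> carrier C"
  using \<beta> unfolding bihom_def by blast

lemma lin_ext_bihom: "lin_ext C (\<lambda>(a, b). \<beta> a b) \<in> alg_hom AB C"
  using \<beta> by (intro lin_ext_alg_hom[OF monoid_pairs[OF A B] C]) (auto simp: bihom_def)

lemma lin_ext_bihom_single: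
  "a \<in> carrier A \<Longrightarrow> b \<in> carrier B \<Longrightarrow> lin_ext C (\<lambda>(a, b). \<beta> a b) (pm_single (a, b) c) = c \<odot>\<^bsub>C\<^esub> \<beta> a b"
  using lin_ext_single[OF C, where S = "carrier A \<times> carrier B" and x = "(a, b)" and a = c and h = "\<lambda>(a, b). \<beta> a b"] bihom_closed by auto

lemma lin_ext_bihom_rel:
  assumes "(l, r) \<in> bilinear_rels A B"
  shows "lin_ext C (\<lambda>(a, b). \<beta> a b) l = lin_ext C (\<lambda>(a, b). \<beta> a b) r"
proof -
  let ?L = "lin_ext C (\<lambda>(a, b). \<beta> a b)"
  have add: "?L (x + y) = ?L x \<oplus>\<^bsub>C\<^esub> ?L y" if "x \<in> carrier AB" "y \<in> carrier AB" for x y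
    using alg_homD(3)[OF lin_ext_bihom that] by (simp add: monoid_algebra_simps)
  have pair: "?L (pair a b) = \<beta> a b" if "a \<in> carrier A" "b \<in> carrier B" for a b
    using lin_ext_bihom_single[OF that] bihom_closed[OF that] by (simp add: pair_def)
  show ?thesis
    using assms \<beta> unfolding bilinear_rels_def bihom_def
    by (auto simp: add pair pair_in lin_ext_bihom_single)
qed

lemma tensor_lift_hom: "tensor_lift C \<beta> \<in> alg_hom (tensor_algebra A B) C"
  using quot_factor_alg_hom[OF calg_AB bilinear_rels_carrier C lin_ext_bihom lin_ext_bihom_rel]
  unfolding tensor_algebra_def tensor_lift_def[abs_def] .

lemma tensor_lift_class:
  "x \<in> carrier AB \<Longrightarrow> tensor_lift C \<beta> (quot_class AB (bilinear_rels A B) x) = lin_ext C (\<lambda>(a, b). \<beta> a b) x"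
  unfolding tensor_lift_def
  by (rule quot_factor_the_elem[OF calg_AB bilinear_rels_carrier C lin_ext_bihom lin_ext_bihom_rel])

lemma tensor_lift_tens: "a \<in> carrier A \<Longrightarrow> b \<in> carrier B \<Longrightarrow> tensor_lift C \<beta> (tens A B a b) = \<beta> a b"
  unfolding tens_def using tensor_lift_class[OF pair_in] lin_ext_bihom_single[of a b 1] bihom_closed by (simp add: pair_def)

text \<open>The map \<gamma> is in general not multiplicative, so the universal property for
  homomorphisms does not cover it. Its lift is computed on each representative as the lift of
  \<beta> times \<open>u\<close>. Reassociation of tensors requires this.\<close>

lemma tensor_lift_mult_right:
  assumes u: "u \<in> carrier C" and \<gamma>: "\<And>a b. a \<in> carrier A \<Longrightarrow> b \<in> carrier B \<Longrightarrow> \<gamma> a b = \<beta> a b \<otimes>\<^bsub>C\<^esub> u"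
    and t: "t \<in> carrier (tensor_algebra A B)"
  shows "tensor_lift C \<gamma> t = tensor_lift C \<beta> t \<otimes>\<^bsub>C\<^esub> u"
proof -
  let ?L = "lin_ext C (\<lambda>(a, b). \<beta> a b)" and ?G = "lin_ext C (\<lambda>(a, b). \<gamma> a b)"
  obtain x where x: "x \<in> carrier AB" "t = quot_class AB (bilinear_rels A B) x"
    using t unfolding tensor_algebra_def quot_algebra_simps(1)[OF calg_AB bilinear_rels_carrier] by blast
  have "?G y = ?L x \<otimes>\<^bsub>C\<^esub> u" if y: "y \<in> t" for y
  proof -
    have y': "y \<in> carrier AB" using y quot_class_mem_iff[OF calg_AB bilinear_rels_carrier x(1)] x(2) by blast
    then have k: "pm_keys y \<subseteq> carrier A \<times> carrier B" by (simp add: monoid_algebra_simps)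
    have "?G y = lin_ext C (\<lambda>p. (\<lambda>(a, b). \<beta> a b) p \<otimes>\<^bsub>C\<^esub> u) y"
      using k \<gamma> bihom_closed u by (intro lin_ext_cong[OF C]) auto
    also have "\<dots> = ?L y \<otimes>\<^bsub>C\<^esub> u"
      using bihom_closed by (intro lin_ext_mult_right[OF C _ k u]) auto
    also have "?L y = ?L x"
      using quot_factor[OF calg_AB bilinear_rels_carrier C lin_ext_bihom lin_ext_bihom_rel x(1), of y] y x(2) by blast
    finally show ?thesis .
  qed
  then have "?G ` t = (\<lambda>_. ?L x \<otimes>\<^bsub>C\<^esub> u) ` t" by (intro image_cong refl)
  also have "\<dots> = {?L x \<otimes>\<^bsub>C\<^esub> u}"
    by (rule image_constant) (use quot_class_self[OF calg_AB bilinear_rels_carrier x(1)] x(2) in blast)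
  finally have "tensor_lift C \<gamma> t = ?L x \<otimes>\<^bsub>C\<^esub> u" by (simp add: tensor_lift_def)
  then show ?thesis using tensor_lift_class[OF x(1)] x(2) by simp
qed

end

text \<open>Scalar multiples call for no case of their own, since a scalar can be absorbed into the
  left factor.\<close>

lemma tensor_induct [consumes 1, case_names tens add]:
  assumes t: "t \<in> carrier (tensor_algebra A B)"
    and P: "\<And>a b. a \<in> carrier A \<Longrightarrow> b \<in> carrier B \<Longrightarrow> P (tens A B a b)"
    and add: "\<And>t u. t \<in> carrier (tensor_algebra A B) \<Longrightarrow> u \<in> carrier (tensor_algebra A B) \<Longrightarrow> P t \<Longrightarrow> P u \<Longrightarrow>
      P (t \<oplus>\<^bsub>tensor_algebra A B\<^esub> u)"
  shows "P t"
proof -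
  let ?Q = "quot_class AB (bilinear_rels A B)"
  have scale: "c \<odot>\<^bsub>tensor_algebra A B\<^esub> tens A B a b = tens A B (c \<odot>\<^bsub>A\<^esub> a) b" if "a \<in> carrier A" "b \<in> carrier B" for a b c
    using bihom_tens that by (simp add: bihom_def)
  interpret T: calg "tensor_algebra A B" by (rule calg_tensor)
  obtain x where x: "x \<in> carrier AB" "t = ?Q x"
    using t unfolding tensor_algebra_def quot_algebra_simps(1)[OF calg_AB bilinear_rels_carrier] by blast
  from x(1) have "pm_keys x \<subseteq> carrier A \<times> carrier B" by (simp add: monoid_algebra_simps)
  then have "P (?Q x)"
  proof (induction x rule: pm_induct)
    case zero
    have "?Q 0 = \<zero>\<^bsub>tensor_algebra A B\<^esub>"
      using alg_hom_zero[OF tens_hom calg_AB calg_tensor] by (simp add: monoid_algebra_simps)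
    also have "\<dots> = tens A B (0 \<odot>\<^bsub>A\<^esub> \<one>\<^bsub>A\<^esub>) \<one>\<^bsub>B\<^esub>"
      using scale[of "\<one>\<^bsub>A\<^esub>" "\<one>\<^bsub>B\<^esub>" 0, symmetric] tens_closed[of "\<one>\<^bsub>A\<^esub>" "\<one>\<^bsub>B\<^esub>"] by simp
    also have "P \<dots>" by (rule P) simp_all
    finally show ?case .
  next
    case (single p a)
    then obtain u v where p: "p = (u, v)" "u \<in> carrier A" "v \<in> carrier B" by auto
    then show ?case using tens_single[of u v a] scale[of u v a] P[of "a \<odot>\<^bsub>A\<^esub> u" v] by simp
  next
    case (add f g)
    then have fg: "f \<in> carrier AB" "g \<in> carrier AB" by (simp_all add: monoid_algebra_simps)
    have "?Q (f + g) = ?Q f \<oplus>\<^bsub>tensor_algebra A B\<^esub> ?Q g"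
      using alg_homD(3)[OF tens_hom fg] by (simp add: monoid_algebra_simps)
    then show ?case using assms(3)[OF alg_homD(1)[OF tens_hom fg(1)] alg_homD(1)[OF tens_hom fg(2)]] add by simp
  qed
  then show ?thesis by (simp add: x(2))
qed

end

section \<open>The coproduct\<close>

lemma (in calg) minus_smult: "u \<in> carrier A \<Longrightarrow> \<ominus> (c \<odot> u) = (- c) \<odot> u"
  using smult_minus_one[of "c \<odot> u"] smult_smult[of u "- 1" c] by simp

text \<open>Turns the commutator relation into one between sums, which can be rearranged by
  associativity and commutativity.\<close>

lemma (in calg) minus_eq_smult_iff:
  assumes "x \<in> carrier A" "y \<in> carrier A" "u \<in> carrier A" "v \<in> carrier A"
  shows "x \<ominus> y = c \<odot> (u \<ominus> v) \<longleftrightarrow> x = y \<oplus> (c \<odot> u \<oplus> (- c) \<odot> v)"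
proof -
  have e: "c \<odot> (u \<ominus> v) = c \<odot> u \<oplus> (- c) \<odot> v"
    using smult_a_minus[OF calg_axioms assms(3,4), of c] minus_smult[OF assms(4), of c] by (simp add: a_minus_def)
  have cl: "c \<odot> u \<oplus> (- c) \<odot> v \<in> carrier A" using assms by simp
  show ?thesis unfolding e
  proof
    assume *: "x \<ominus> y = c \<odot> u \<oplus> (- c) \<odot> v"
    have "x = y \<oplus> (x \<ominus> y)" using assms(1,2) a_lcomm[of y x "\<ominus> y"] by (simp add: a_minus_def r_neg)
    then show "x = y \<oplus> (c \<odot> u \<oplus> (- c) \<odot> v)" unfolding * .
  next
    assume *: "x = y \<oplus> (c \<odot> u \<oplus> (- c) \<odot> v)"
    have "y \<oplus> z \<ominus> y = z" if z: "z \<in> carrier A" for z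
      unfolding a_minus_def a_comm[OF assms(2) z] a_assoc[OF z assms(2) a_inv_closed[OF assms(2)]] r_neg[OF assms(2)] r_zero[OF z] ..
    then show "x \<ominus> y = c \<odot> u \<oplus> (- c) \<odot> v" unfolding * using cl by blast
  qed
qed

definition uq_rels_hold :: "complex \<Rightarrow> (complex, 'b) module \<Rightarrow> (uq_gen \<Rightarrow> 'b) \<Rightarrow> bool" where
  "uq_rels_hold q B \<phi> \<longleftrightarrow>
    \<phi> GenQH \<otimes>\<^bsub>B\<^esub> \<phi> GenQHinv = \<one>\<^bsub>B\<^esub> \<and> \<phi> GenQHinv \<otimes>\<^bsub>B\<^esub> \<phi> GenQH = \<one>\<^bsub>B\<^esub> \<and>
    \<phi> GenQH \<otimes>\<^bsub>B\<^esub> \<phi> GenE = q \<odot>\<^bsub>B\<^esub> (\<phi> GenE \<otimes>\<^bsub>B\<^esub> \<phi> GenQH) \<and>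
    \<phi> GenQH \<otimes>\<^bsub>B\<^esub> \<phi> GenF = inverse q \<odot>\<^bsub>B\<^esub> (\<phi> GenF \<otimes>\<^bsub>B\<^esub> \<phi> GenQH) \<and>
    \<phi> GenE \<otimes>\<^bsub>B\<^esub> \<phi> GenF \<ominus>\<^bsub>B\<^esub> \<phi> GenF \<otimes>\<^bsub>B\<^esub> \<phi> GenE =
      inverse (q - inverse q) \<odot>\<^bsub>B\<^esub> (\<phi> GenQH \<otimes>\<^bsub>B\<^esub> \<phi> GenQH \<ominus>\<^bsub>B\<^esub> \<phi> GenQHinv \<otimes>\<^bsub>B\<^esub> \<phi> GenQHinv)"

lemma uq_rels_hom:
  assumes h: "h \<in> alg_hom free_algebra B" and B: "calg B"
  shows "(\<forall>l r. (l, r) \<in> uq_rels q \<longrightarrow> h l = h r) \<longleftrightarrow> uq_rels_hold q B (\<lambda>g. h (gen g))"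
proof -
  have m: "h (x \<otimes>\<^bsub>free_algebra\<^esub> y) = h x \<otimes>\<^bsub>B\<^esub> h y" for x y by (rule alg_homD(2)[OF h]) simp_all
  have s: "h (c \<odot>\<^bsub>free_algebra\<^esub> x) = c \<odot>\<^bsub>B\<^esub> h x" for c x by (rule alg_homD(5)[OF h]) simp
  have d: "h (x \<ominus>\<^bsub>free_algebra\<^esub> y) = h x \<ominus>\<^bsub>B\<^esub> h y" for x y by (rule alg_hom_minus[OF h calg_free_algebra B]) simp_all
  have all: "(\<forall>l r. (l, r) \<in> {(a, a'), (b, b'), (c, c'), (d, d'), (e, e')} \<longrightarrow> h l = h r) \<longleftrightarrow>
     h a = h a' \<and> h b = h b' \<and> h c = h c' \<and> h d = h d' \<and> h e = h e'" for a a' b b' c c' d d' e e'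
    by blast
  show ?thesis unfolding uq_rels_def Let_def all uq_rels_hold_def m s d alg_homD(4)[OF h] ..
qed

lemma uq_rels_carrier: "uq_rels q \<subseteq> carrier free_algebra \<times> carrier free_algebra" by simp

lemma calg_Uq: "calg (Uq q)"
  unfolding Uq_def by (rule calg_quot_algebra[OF calg_free_algebra uq_rels_carrier])

lemma uq_class_hom: "quot_class free_algebra (uq_rels q) \<in> alg_hom free_algebra (Uq q)"
  unfolding Uq_def by (rule quot_class_alg_hom[OF calg_free_algebra uq_rels_carrier])

lemma uq_elt_closed: "uq_elt q g \<in> carrier (Uq q)"
  unfolding uq_elt_def by (rule alg_homD(1)[OF uq_class_hom]) simp

lemma uq_elt_rels: "uq_rels_hold q (Uq q) (uq_elt q)"
proof -
  have "\<forall>l r. (l, r) \<in> uq_rels q \<longrightarrow> quot_class free_algebra (uq_rels q) l = quot_class free_algebra (uq_rels q) r"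
    using quot_class_rel[OF calg_free_algebra uq_rels_carrier] by blast
  then show ?thesis unfolding uq_rels_hom[OF uq_class_hom calg_Uq] uq_elt_def .
qed

lemma uq_hom_rels:
  assumes h: "h \<in> alg_hom (Uq q) B" and B: "calg B"
  shows "uq_rels_hold q B (\<lambda>g. h (uq_elt q g))"
proof -
  have "\<forall>l r. (l, r) \<in> uq_rels q \<longrightarrow> (h \<circ> quot_class free_algebra (uq_rels q)) l = (h \<circ> quot_class free_algebra (uq_rels q)) r"
    unfolding comp_def using quot_class_rel[OF calg_free_algebra uq_rels_carrier] by metis
  then have "uq_rels_hold q B (\<lambda>g. (h \<circ> quot_class free_algebra (uq_rels q)) (gen g))"
    using uq_rels_hom[OF alg_hom_comp[OF uq_class_hom h] B, of q] by blast
  then show ?thesis by (simp only: uq_elt_def comp_apply)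
qed

lemma uq_presented:
  assumes B: "calg B" and \<phi>: "\<And>g. \<phi> g \<in> carrier B" and "uq_rels_hold q B \<phi>"
  shows "presented_lift B \<phi> \<in> alg_hom (Uq q) B" "presented_lift B \<phi> (uq_elt q g) = \<phi> g"
proof -
  have fh: "free_eval B \<phi> \<in> alg_hom free_algebra B" by (rule free_eval_alg_hom[OF B \<phi>])
  have "uq_rels_hold q B (\<lambda>g. free_eval B \<phi> (gen g))" using assms(3) by (simp only: free_eval_gen[OF B \<phi>])
  then have *: "free_eval B \<phi> l = free_eval B \<phi> r" if "(l, r) \<in> uq_rels q" for l r
    using that uq_rels_hom[OF fh B, of q] by blast
  show "presented_lift B \<phi> \<in> alg_hom (Uq q) B" "presented_lift B \<phi> (uq_elt q g) = \<phi> g"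
    using presented_lift_alg_hom[OF B \<phi> *] by (simp_all only: Uq_def uq_elt_def)
qed

lemma calg_Uq2: "calg (Uq2 q)" unfolding Uq2_def by (rule calg_tensor[OF calg_Uq calg_Uq])
lemma calg_Uq3: "calg (Uq3 q)" unfolding Uq3_def by (rule calg_tensor[OF calg_Uq calg_Uq2])

lemma bihom_tens2: "bihom (Uq q) (Uq q) (Uq2 q) (tens2 q)"
  unfolding Uq2_def tens2_def by (rule bihom_tens[OF calg_Uq calg_Uq])

lemma bihom_tens3: "bihom (Uq q) (Uq2 q) (Uq3 q) (tens (Uq q) (Uq2 q))"
  unfolding Uq3_def by (rule bihom_tens[OF calg_Uq calg_Uq2])

lemma bihomD:
  assumes "bihom A B C \<beta>"
  shows "a \<in> carrier A \<Longrightarrow> b \<in> carrier B \<Longrightarrow> \<beta> a b \<in> carrier C"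
    "a \<in> carrier A \<Longrightarrow> a' \<in> carrier A \<Longrightarrow> b \<in> carrier B \<Longrightarrow> \<beta> (a \<oplus>\<^bsub>A\<^esub> a') b = \<beta> a b \<oplus>\<^bsub>C\<^esub> \<beta> a' b"
    "a \<in> carrier A \<Longrightarrow> b \<in> carrier B \<Longrightarrow> b' \<in> carrier B \<Longrightarrow> \<beta> a (b \<oplus>\<^bsub>B\<^esub> b') = \<beta> a b \<oplus>\<^bsub>C\<^esub> \<beta> a b'"
    "a \<in> carrier A \<Longrightarrow> b \<in> carrier B \<Longrightarrow> \<beta> (c \<odot>\<^bsub>A\<^esub> a) b = c \<odot>\<^bsub>C\<^esub> \<beta> a b"
    "a \<in> carrier A \<Longrightarrow> b \<in> carrier B \<Longrightarrow> \<beta> a (c \<odot>\<^bsub>B\<^esub> b) = c \<odot>\<^bsub>C\<^esub> \<beta> a b"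
    "a \<in> carrier A \<Longrightarrow> a' \<in> carrier A \<Longrightarrow> b \<in> carrier B \<Longrightarrow> b' \<in> carrier B \<Longrightarrow>
      \<beta> (a \<otimes>\<^bsub>A\<^esub> a') (b \<otimes>\<^bsub>B\<^esub> b') = \<beta> a b \<otimes>\<^bsub>C\<^esub> \<beta> a' b'"
    "\<beta> \<one>\<^bsub>A\<^esub> \<one>\<^bsub>B\<^esub> = \<one>\<^bsub>C\<^esub>"
  using assms unfolding bihom_def by blast+

lemma bihom_comp_homs:
  assumes "bihom A' B' C \<beta>" "f \<in> alg_hom A A'" "g \<in> alg_hom B B'"
  shows "bihom A B C (\<lambda>a b. \<beta> (f a) (g b))"
  unfolding bihom_def
  by (intro conjI ballI allI) (simp_all only: alg_homD[OF assms(2)] alg_homD[OF assms(3)] bihomD[OF assms(1)])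

lemma alg_hom_id: "(\<lambda>x. x) \<in> alg_hom A A"
  by (rule alg_homI) simp_all

lemma bihom_left_unit_hom:
  assumes "bihom A B C \<beta>" "calg A" shows "\<beta> \<one>\<^bsub>A\<^esub> \<in> alg_hom B C"
proof -
  interpret A: calg A by fact
  show ?thesis
  proof (rule alg_homI)
    fix x y assume "x \<in> carrier B" "y \<in> carrier B"
    then show "\<beta> \<one>\<^bsub>A\<^esub> (x \<otimes>\<^bsub>B\<^esub> y) = \<beta> \<one>\<^bsub>A\<^esub> x \<otimes>\<^bsub>C\<^esub> \<beta> \<one>\<^bsub>A\<^esub> y"
      using bihomD(6)[OF assms(1), of "\<one>\<^bsub>A\<^esub>" "\<one>\<^bsub>A\<^esub>" x y] by simp
  qed (simp_all add: bihomD[OF assms(1)])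
qed

lemma bihom_right_unit_hom:
  assumes "bihom A B C \<beta>" "calg B" shows "(\<lambda>a. \<beta> a \<one>\<^bsub>B\<^esub>) \<in> alg_hom A C"
proof -
  interpret B: calg B by fact
  show ?thesis
  proof (rule alg_homI)
    fix x y assume "x \<in> carrier A" "y \<in> carrier A"
    then show "\<beta> (x \<otimes>\<^bsub>A\<^esub> y) \<one>\<^bsub>B\<^esub> = \<beta> x \<one>\<^bsub>B\<^esub> \<otimes>\<^bsub>C\<^esub> \<beta> y \<one>\<^bsub>B\<^esub>"
      using bihomD(6)[OF assms(1), of x y "\<one>\<^bsub>B\<^esub>" "\<one>\<^bsub>B\<^esub>"] by simp
  qed (simp_all add: bihomD[OF assms(1)])
qed

lemma uq_rels_inverse:
  assumes B: "calg B" and \<phi>: "\<And>g. \<phi> g \<in> carrier B" and r: "uq_rels_hold q B \<phi>" and q: "q \<noteq> 0"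
  shows "\<phi> GenE \<otimes>\<^bsub>B\<^esub> \<phi> GenQH = inverse q \<odot>\<^bsub>B\<^esub> (\<phi> GenQH \<otimes>\<^bsub>B\<^esub> \<phi> GenE)"
    "\<phi> GenF \<otimes>\<^bsub>B\<^esub> \<phi> GenQH = q \<odot>\<^bsub>B\<^esub> (\<phi> GenQH \<otimes>\<^bsub>B\<^esub> \<phi> GenF)"
    "\<phi> GenQHinv \<otimes>\<^bsub>B\<^esub> \<phi> GenE = inverse q \<odot>\<^bsub>B\<^esub> (\<phi> GenE \<otimes>\<^bsub>B\<^esub> \<phi> GenQHinv)"
    "\<phi> GenQHinv \<otimes>\<^bsub>B\<^esub> \<phi> GenF = q \<odot>\<^bsub>B\<^esub> (\<phi> GenF \<otimes>\<^bsub>B\<^esub> \<phi> GenQHinv)"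
proof -
  interpret B: calg B by fact
  let ?e = "\<phi> GenE" and ?f = "\<phi> GenF" and ?k = "\<phi> GenQH" and ?l = "\<phi> GenQHinv"
  have r': "?k \<otimes>\<^bsub>B\<^esub> ?l = \<one>\<^bsub>B\<^esub>" "?l \<otimes>\<^bsub>B\<^esub> ?k = \<one>\<^bsub>B\<^esub>" "?k \<otimes>\<^bsub>B\<^esub> ?e = q \<odot>\<^bsub>B\<^esub> (?e \<otimes>\<^bsub>B\<^esub> ?k)"
    "?k \<otimes>\<^bsub>B\<^esub> ?f = inverse q \<odot>\<^bsub>B\<^esub> (?f \<otimes>\<^bsub>B\<^esub> ?k)" using r unfolding uq_rels_hold_def by blast+
  show ek: "?e \<otimes>\<^bsub>B\<^esub> ?k = inverse q \<odot>\<^bsub>B\<^esub> (?k \<otimes>\<^bsub>B\<^esub> ?e)" and fk: "?f \<otimes>\<^bsub>B\<^esub> ?k = q \<odot>\<^bsub>B\<^esub> (?k \<otimes>\<^bsub>B\<^esub> ?f)"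
    unfolding r' using q \<phi> by (simp_all add: B.smult_smult)
  have inv: "?l \<otimes>\<^bsub>B\<^esub> x = c \<odot>\<^bsub>B\<^esub> (x \<otimes>\<^bsub>B\<^esub> ?l)" if x: "x \<in> carrier B" and xk: "x \<otimes>\<^bsub>B\<^esub> ?k = c \<odot>\<^bsub>B\<^esub> (?k \<otimes>\<^bsub>B\<^esub> x)" for x c
  proof -
    have "?l \<otimes>\<^bsub>B\<^esub> x = ?l \<otimes>\<^bsub>B\<^esub> (x \<otimes>\<^bsub>B\<^esub> (?k \<otimes>\<^bsub>B\<^esub> ?l))" using x \<phi> by (simp add: r'(1))
    also have "\<dots> = ?l \<otimes>\<^bsub>B\<^esub> ((x \<otimes>\<^bsub>B\<^esub> ?k) \<otimes>\<^bsub>B\<^esub> ?l)" using x \<phi> by (simp add: B.m_assoc)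
    also have "\<dots> = c \<odot>\<^bsub>B\<^esub> ((?l \<otimes>\<^bsub>B\<^esub> ?k) \<otimes>\<^bsub>B\<^esub> (x \<otimes>\<^bsub>B\<^esub> ?l))"
      unfolding xk using x \<phi> by (simp add: B.m_assoc B.smult_mult_left B.smult_mult_right)
    also have "\<dots> = c \<odot>\<^bsub>B\<^esub> (x \<otimes>\<^bsub>B\<^esub> ?l)" using x \<phi> by (simp add: r'(2))
    finally show ?thesis .
  qed
  show "?l \<otimes>\<^bsub>B\<^esub> ?e = inverse q \<odot>\<^bsub>B\<^esub> (?e \<otimes>\<^bsub>B\<^esub> ?l)" by (rule inv[OF \<phi> ek])
  show "?l \<otimes>\<^bsub>B\<^esub> ?f = q \<odot>\<^bsub>B\<^esub> (?f \<otimes>\<^bsub>B\<^esub> ?l)" by (rule inv[OF \<phi> fk])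
qed

definition comult_gen :: "complex \<Rightarrow> uq_gen \<Rightarrow> (uq, uq) tensor" where
  "comult_gen q = (\<lambda>g. let T = Uq2 q; e = uq_elt q GenE; f = uq_elt q GenF;
             k = uq_elt q GenQH; k' = uq_elt q GenQHinv in
      case g of
        GenE \<Rightarrow> tens2 q e k' \<oplus>\<^bsub>T\<^esub> tens2 q k e
      | GenF \<Rightarrow> tens2 q f k' \<oplus>\<^bsub>T\<^esub> tens2 q k f
      | GenQH \<Rightarrow> tens2 q k k
      | GenQHinv \<Rightarrow> tens2 q k' k')"

lemma comult_gen_simps:
  "comult_gen q GenE = tens2 q (uq_elt q GenE) (uq_elt q GenQHinv) \<oplus>\<^bsub>Uq2 q\<^esub> tens2 q (uq_elt q GenQH) (uq_elt q GenE)"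
  "comult_gen q GenF = tens2 q (uq_elt q GenF) (uq_elt q GenQHinv) \<oplus>\<^bsub>Uq2 q\<^esub> tens2 q (uq_elt q GenQH) (uq_elt q GenF)"
  "comult_gen q GenQH = tens2 q (uq_elt q GenQH) (uq_elt q GenQH)"
  "comult_gen q GenQHinv = tens2 q (uq_elt q GenQHinv) (uq_elt q GenQHinv)"
  by (simp_all add: comult_gen_def Let_def)

lemma comult_gen_closed: "comult_gen q g \<in> carrier (Uq2 q)"
proof -
  interpret T: calg "Uq2 q" by (rule calg_Uq2)
  show ?thesis
    by (cases g) (simp_all add: comult_gen_simps uq_elt_closed bihomD(1)[OF bihom_tens2])
qed

text \<open>Only the commutator of E and F is substantial. Its mixed terms agree in both orders, and
  the contributions of q^(2H) tensor q^(-2H) from the two slots cancel, which leaves the difference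
  of the two diagonal terms.\<close>

lemma comult_gen_rels:
  assumes q: "q \<noteq> 0"
  shows "uq_rels_hold q (Uq2 q) (comult_gen q)"
proof -
  interpret T: calg "Uq2 q" by (rule calg_Uq2)
  interpret U: calg "Uq q" by (rule calg_Uq)
  define t where "t = tens2 q"
  define e f k l where "e = uq_elt q GenE" "f = uq_elt q GenF" "k = uq_elt q GenQH" "l = uq_elt q GenQHinv"
  have c [simp]: "e \<in> carrier (Uq q)" "f \<in> carrier (Uq q)" "k \<in> carrier (Uq q)" "l \<in> carrier (Uq q)"
    by (simp_all add: e_f_k_l_def uq_elt_closed)
  note b = bihomD[OF bihom_tens2[of q], folded t_def]
  have [simp]: "x \<in> carrier (Uq q) \<Longrightarrow> y \<in> carrier (Uq q) \<Longrightarrow> t x y \<in> carrier (Uq2 q)" for x y by (rule b(1))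
  have mult: "t x y \<otimes>\<^bsub>Uq2 q\<^esub> t x' y' = t (x \<otimes>\<^bsub>Uq q\<^esub> x') (y \<otimes>\<^bsub>Uq q\<^esub> y')"
    if "x \<in> carrier (Uq q)" "x' \<in> carrier (Uq q)" "y \<in> carrier (Uq q)" "y' \<in> carrier (Uq q)" for x x' y y'
    by (rule b(6)[OF that, symmetric])
  let ?\<gamma> = "inverse (q - inverse q)"
  have r: "k \<otimes>\<^bsub>Uq q\<^esub> l = \<one>\<^bsub>Uq q\<^esub>" "l \<otimes>\<^bsub>Uq q\<^esub> k = \<one>\<^bsub>Uq q\<^esub>" "k \<otimes>\<^bsub>Uq q\<^esub> e = q \<odot>\<^bsub>Uq q\<^esub> (e \<otimes>\<^bsub>Uq q\<^esub> k)"
    "k \<otimes>\<^bsub>Uq q\<^esub> f = inverse q \<odot>\<^bsub>Uq q\<^esub> (f \<otimes>\<^bsub>Uq q\<^esub> k)"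
    "e \<otimes>\<^bsub>Uq q\<^esub> f \<ominus>\<^bsub>Uq q\<^esub> f \<otimes>\<^bsub>Uq q\<^esub> e = ?\<gamma> \<odot>\<^bsub>Uq q\<^esub> (k \<otimes>\<^bsub>Uq q\<^esub> k \<ominus>\<^bsub>Uq q\<^esub> l \<otimes>\<^bsub>Uq q\<^esub> l)"
    using uq_elt_rels[of q] unfolding uq_rels_hold_def e_f_k_l_def by blast+
  note inv = uq_rels_inverse[OF calg_Uq uq_elt_closed uq_elt_rels q, folded e_f_k_l_def]
  have ef: "e \<otimes>\<^bsub>Uq q\<^esub> f = f \<otimes>\<^bsub>Uq q\<^esub> e \<oplus>\<^bsub>Uq q\<^esub> (?\<gamma> \<odot>\<^bsub>Uq q\<^esub> (k \<otimes>\<^bsub>Uq q\<^esub> k) \<oplus>\<^bsub>Uq q\<^esub> (- ?\<gamma>) \<odot>\<^bsub>Uq q\<^esub> (l \<otimes>\<^bsub>Uq q\<^esub> l))"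
    using r(5) by (subst (asm) U.minus_eq_smult_iff) simp_all
  have 1: "t k k \<otimes>\<^bsub>Uq2 q\<^esub> t l l = \<one>\<^bsub>Uq2 q\<^esub>" "t l l \<otimes>\<^bsub>Uq2 q\<^esub> t k k = \<one>\<^bsub>Uq2 q\<^esub>"
    by (simp_all only: mult c r b(7))
  have kl: "k \<otimes>\<^bsub>Uq q\<^esub> l = l \<otimes>\<^bsub>Uq q\<^esub> k" by (simp only: r)
  have 2: "t k k \<otimes>\<^bsub>Uq2 q\<^esub> (t x l \<oplus>\<^bsub>Uq2 q\<^esub> t k x) = \<mu> \<odot>\<^bsub>Uq2 q\<^esub> ((t x l \<oplus>\<^bsub>Uq2 q\<^esub> t k x) \<otimes>\<^bsub>Uq2 q\<^esub> t k k)"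
    if x: "x \<in> carrier (Uq q)" and kx: "k \<otimes>\<^bsub>Uq q\<^esub> x = \<mu> \<odot>\<^bsub>Uq q\<^esub> (x \<otimes>\<^bsub>Uq q\<^esub> k)" for x \<mu>
  proof -
    have "t k k \<otimes>\<^bsub>Uq2 q\<^esub> (t x l \<oplus>\<^bsub>Uq2 q\<^esub> t k x) = t (k \<otimes>\<^bsub>Uq q\<^esub> x) (k \<otimes>\<^bsub>Uq q\<^esub> l) \<oplus>\<^bsub>Uq2 q\<^esub> t (k \<otimes>\<^bsub>Uq q\<^esub> k) (k \<otimes>\<^bsub>Uq q\<^esub> x)"
      using x by (simp add: T.r_distr mult)
    also have "\<dots> = \<mu> \<odot>\<^bsub>Uq2 q\<^esub> t (x \<otimes>\<^bsub>Uq q\<^esub> k) (l \<otimes>\<^bsub>Uq q\<^esub> k) \<oplus>\<^bsub>Uq2 q\<^esub> \<mu> \<odot>\<^bsub>Uq2 q\<^esub> t (k \<otimes>\<^bsub>Uq q\<^esub> k) (x \<otimes>\<^bsub>Uq q\<^esub> k)"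
      unfolding kx kl using x by (simp add: b(4,5))
    also have "\<dots> = \<mu> \<odot>\<^bsub>Uq2 q\<^esub> ((t x l \<oplus>\<^bsub>Uq2 q\<^esub> t k x) \<otimes>\<^bsub>Uq2 q\<^esub> t k k)"
      using x by (simp add: T.l_distr mult T.smult_add_right)
    finally show ?thesis .
  qed
  let ?X = "t (f \<otimes>\<^bsub>Uq q\<^esub> e) (l \<otimes>\<^bsub>Uq q\<^esub> l)" and ?Y = "t (k \<otimes>\<^bsub>Uq q\<^esub> k) (f \<otimes>\<^bsub>Uq q\<^esub> e)"
  let ?P = "t (k \<otimes>\<^bsub>Uq q\<^esub> e) (f \<otimes>\<^bsub>Uq q\<^esub> l)" and ?Q = "t (k \<otimes>\<^bsub>Uq q\<^esub> f) (e \<otimes>\<^bsub>Uq q\<^esub> l)"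
  let ?KL = "t (k \<otimes>\<^bsub>Uq q\<^esub> k) (l \<otimes>\<^bsub>Uq q\<^esub> l)" and ?KK = "t (k \<otimes>\<^bsub>Uq q\<^esub> k) (k \<otimes>\<^bsub>Uq q\<^esub> k)" and ?LL = "t (l \<otimes>\<^bsub>Uq q\<^esub> l) (l \<otimes>\<^bsub>Uq q\<^esub> l)"
  \<comment> \<open>Reordering costs \<open>inverse q\<close> in the left slot and \<open>q\<close>
    in the right slot, so nothing in total.\<close>
  have P: "t (e \<otimes>\<^bsub>Uq q\<^esub> k) (l \<otimes>\<^bsub>Uq q\<^esub> f) = ?P"
    unfolding inv(1,4) using q by (simp add: b(4,5) T.smult_smult)
  have Q: "t (f \<otimes>\<^bsub>Uq q\<^esub> k) (l \<otimes>\<^bsub>Uq q\<^esub> e) = ?Q"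
    unfolding inv(2,3) using q by (simp add: b(4,5) T.smult_smult)
  have FE: "(t f l \<oplus>\<^bsub>Uq2 q\<^esub> t k f) \<otimes>\<^bsub>Uq2 q\<^esub> (t e l \<oplus>\<^bsub>Uq2 q\<^esub> t k e) = (?X \<oplus>\<^bsub>Uq2 q\<^esub> ?Q) \<oplus>\<^bsub>Uq2 q\<^esub> (?P \<oplus>\<^bsub>Uq2 q\<^esub> ?Y)"
    by (simp add: T.l_distr T.r_distr mult Q) (simp add: T.a_ac)
  have "(t e l \<oplus>\<^bsub>Uq2 q\<^esub> t k e) \<otimes>\<^bsub>Uq2 q\<^esub> (t f l \<oplus>\<^bsub>Uq2 q\<^esub> t k f)
    = (t (e \<otimes>\<^bsub>Uq q\<^esub> f) (l \<otimes>\<^bsub>Uq q\<^esub> l) \<oplus>\<^bsub>Uq2 q\<^esub> ?Q) \<oplus>\<^bsub>Uq2 q\<^esub> (?P \<oplus>\<^bsub>Uq2 q\<^esub> t (k \<otimes>\<^bsub>Uq q\<^esub> k) (e \<otimes>\<^bsub>Uq q\<^esub> f))"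
    by (simp add: T.l_distr T.r_distr mult P)
  also have "t (e \<otimes>\<^bsub>Uq q\<^esub> f) (l \<otimes>\<^bsub>Uq q\<^esub> l) = ?X \<oplus>\<^bsub>Uq2 q\<^esub> (?\<gamma> \<odot>\<^bsub>Uq2 q\<^esub> ?KL \<oplus>\<^bsub>Uq2 q\<^esub> (- ?\<gamma>) \<odot>\<^bsub>Uq2 q\<^esub> ?LL)"
    unfolding ef by (simp add: b(2,4))
  also have "t (k \<otimes>\<^bsub>Uq q\<^esub> k) (e \<otimes>\<^bsub>Uq q\<^esub> f) = ?Y \<oplus>\<^bsub>Uq2 q\<^esub> (?\<gamma> \<odot>\<^bsub>Uq2 q\<^esub> ?KK \<oplus>\<^bsub>Uq2 q\<^esub> (- ?\<gamma>) \<odot>\<^bsub>Uq2 q\<^esub> ?KL)"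
    unfolding ef by (simp add: b(3,5))
  finally have "(t e l \<oplus>\<^bsub>Uq2 q\<^esub> t k e) \<otimes>\<^bsub>Uq2 q\<^esub> (t f l \<oplus>\<^bsub>Uq2 q\<^esub> t k f)
    = (?X \<oplus>\<^bsub>Uq2 q\<^esub> (?\<gamma> \<odot>\<^bsub>Uq2 q\<^esub> ?KL \<oplus>\<^bsub>Uq2 q\<^esub> (- ?\<gamma>) \<odot>\<^bsub>Uq2 q\<^esub> ?LL) \<oplus>\<^bsub>Uq2 q\<^esub> ?Q) \<oplus>\<^bsub>Uq2 q\<^esub> (?P \<oplus>\<^bsub>Uq2 q\<^esub> (?Y \<oplus>\<^bsub>Uq2 q\<^esub> (?\<gamma> \<odot>\<^bsub>Uq2 q\<^esub> ?KK \<oplus>\<^bsub>Uq2 q\<^esub> (- ?\<gamma>) \<odot>\<^bsub>Uq2 q\<^esub> ?KL)))" .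
  also have "\<dots> = ((?X \<oplus>\<^bsub>Uq2 q\<^esub> ?Q) \<oplus>\<^bsub>Uq2 q\<^esub> (?P \<oplus>\<^bsub>Uq2 q\<^esub> ?Y)) \<oplus>\<^bsub>Uq2 q\<^esub>
      ((?\<gamma> \<odot>\<^bsub>Uq2 q\<^esub> ?KK \<oplus>\<^bsub>Uq2 q\<^esub> (- ?\<gamma>) \<odot>\<^bsub>Uq2 q\<^esub> ?LL) \<oplus>\<^bsub>Uq2 q\<^esub> (?\<gamma> \<odot>\<^bsub>Uq2 q\<^esub> ?KL \<oplus>\<^bsub>Uq2 q\<^esub> (- ?\<gamma>) \<odot>\<^bsub>Uq2 q\<^esub> ?KL))"
    by (simp add: T.a_ac)
  also have "?\<gamma> \<odot>\<^bsub>Uq2 q\<^esub> ?KL \<oplus>\<^bsub>Uq2 q\<^esub> (- ?\<gamma>) \<odot>\<^bsub>Uq2 q\<^esub> ?KL = \<zero>\<^bsub>Uq2 q\<^esub>"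
    using T.smult_add_left[of ?KL ?\<gamma> "- ?\<gamma>"] by simp
  finally have "(t e l \<oplus>\<^bsub>Uq2 q\<^esub> t k e) \<otimes>\<^bsub>Uq2 q\<^esub> (t f l \<oplus>\<^bsub>Uq2 q\<^esub> t k f) =
     (t f l \<oplus>\<^bsub>Uq2 q\<^esub> t k f) \<otimes>\<^bsub>Uq2 q\<^esub> (t e l \<oplus>\<^bsub>Uq2 q\<^esub> t k e) \<oplus>\<^bsub>Uq2 q\<^esub>
      (?\<gamma> \<odot>\<^bsub>Uq2 q\<^esub> (t k k \<otimes>\<^bsub>Uq2 q\<^esub> t k k) \<oplus>\<^bsub>Uq2 q\<^esub> (- ?\<gamma>) \<odot>\<^bsub>Uq2 q\<^esub> (t l l \<otimes>\<^bsub>Uq2 q\<^esub> t l l))"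
    unfolding FE by (simp add: mult)
  then have 3: "(t e l \<oplus>\<^bsub>Uq2 q\<^esub> t k e) \<otimes>\<^bsub>Uq2 q\<^esub> (t f l \<oplus>\<^bsub>Uq2 q\<^esub> t k f) \<ominus>\<^bsub>Uq2 q\<^esub>
     (t f l \<oplus>\<^bsub>Uq2 q\<^esub> t k f) \<otimes>\<^bsub>Uq2 q\<^esub> (t e l \<oplus>\<^bsub>Uq2 q\<^esub> t k e) =
      ?\<gamma> \<odot>\<^bsub>Uq2 q\<^esub> (t k k \<otimes>\<^bsub>Uq2 q\<^esub> t k k \<ominus>\<^bsub>Uq2 q\<^esub> t l l \<otimes>\<^bsub>Uq2 q\<^esub> t l l)"
    by (subst T.minus_eq_smult_iff) simp_all
  show ?thesis
    unfolding uq_rels_hold_def comult_gen_simps t_def[symmetric] e_f_k_l_def[symmetric]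
    using 1 2[OF c(1) r(3)] 2[OF c(2) r(4)] 3 by blast
qed

lemma comult_hom: "q \<noteq> 0 \<Longrightarrow> comult q \<in> alg_hom (Uq q) (Uq2 q)"
  and comult_elt: "q \<noteq> 0 \<Longrightarrow> comult q (uq_elt q g) = comult_gen q g"
proof -
  have e: "comult q = presented_lift (Uq2 q) (comult_gen q)" unfolding comult_def comult_gen_def ..
  show "q \<noteq> 0 \<Longrightarrow> comult q \<in> alg_hom (Uq q) (Uq2 q)" "q \<noteq> 0 \<Longrightarrow> comult q (uq_elt q g) = comult_gen q g"
    unfolding e using uq_presented[OF calg_Uq2 comult_gen_closed comult_gen_rels] by blast+
qed

section \<open>Matrix algebras and representations of tensor products\<close>

lemma End_alg_simps:
  "carrier End_alg = UNIV" "mult End_alg = (**)" "\<one>\<^bsub>End_alg\<^esub> = mat 1" "\<zero>\<^bsub>End_alg\<^esub> = 0" "add End_alg = (+)"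
  "module.smult End_alg = mat_smult"
  by (simp_all add: End_alg_def mat_smult_def fun_eq_iff)

lemma calg_subalgebra_End:
  fixes S :: "(complex^'n^'n) set"
  assumes "mat 1 \<in> S" "\<And>x y. x \<in> S \<Longrightarrow> y \<in> S \<Longrightarrow> x + y \<in> S" "\<And>x y. x \<in> S \<Longrightarrow> y \<in> S \<Longrightarrow> x ** y \<in> S"
    "\<And>c x. x \<in> S \<Longrightarrow> mat_smult c x \<in> S"
  shows "calg (End_alg\<lparr>carrier := S\<rparr>)"
proof -
  let ?E = "End_alg\<lparr>carrier := S\<rparr>"
  have simps: "carrier ?E = S" "mult ?E = (**)" "\<one>\<^bsub>?E\<^esub> = mat 1" "\<zero>\<^bsub>?E\<^esub> = 0" "add ?E = (+)" "module.smult ?E = mat_smult"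
    by (simp_all add: End_alg_simps)
  have neg: "- x \<in> S" if "x \<in> S" for x
  proof -
    have "mat_smult (- 1) x = - x" by (simp add: mat_smult_def vec_eq_iff)
    then show ?thesis using assms(4)[OF that, of "- 1"] by simp
  qed
  have zero: "0 \<in> S"
  proof -
    have "mat_smult 0 (mat 1) = (0 :: complex^'n^'n)" by (simp add: mat_smult_def vec_eq_iff)
    then show ?thesis using assms(4)[OF assms(1), of 0] by simp
  qed
  have "ring ?E"
  proof (rule ringI)
    show "abelian_group ?E"
    proof (rule abelian_groupI)
      fix x assume "x \<in> carrier ?E"
      then show "\<exists>y\<in>carrier ?E. y \<oplus>\<^bsub>?E\<^esub> x = \<zero>\<^bsub>?E\<^esub>"
        unfolding simps using neg by (intro bexI[of _ "- x"]) simp_all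
    qed (use assms zero in \<open>simp_all add: simps add_ac\<close>)
    show "Group.monoid ?E"
      by (rule monoidI) (use assms in \<open>simp_all add: simps matrix_mul_assoc\<close>)
  qed (auto simp: simps matrix_eq mv_simps)
  then show ?thesis
    by (intro calg.intro calg_axioms.intro)
      (use assms in \<open>auto simp: simps matrix_eq mv_simps vector_smult_assoc vector_sadd_rdistrib vector_add_ldistrib\<close>)
qed

lemma calg_End: "calg End_alg"
  using calg_subalgebra_End[of UNIV] by (simp add: End_alg_def)

lemma End_minus:
  assumes "calg (End_alg\<lparr>carrier := S\<rparr>)" "x \<in> S" "y \<in> S"
  shows "x \<ominus>\<^bsub>End_alg\<lparr>carrier := S\<rparr>\<^esub> y = x - y"
proof -
  interpret S: calg "End_alg\<lparr>carrier := S\<rparr>" by fact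
  have "\<ominus>\<^bsub>End_alg\<lparr>carrier := S\<rparr>\<^esub> y = mat_smult (- 1) y"
    using S.smult_minus_one[of y] assms(3) by (simp add: End_alg_simps)
  then show ?thesis using assms by (simp add: a_minus_def End_alg_simps matrix_eq mv_simps)
qed

lemma uq_triple_hom:
  assumes "h \<in> alg_hom (Uq q) End_alg"
  shows "uq_triple q (h (uq_elt q GenE)) (h (uq_elt q GenF)) (h (uq_elt q GenQH)) (h (uq_elt q GenQHinv))"
proof -
  have "x \<ominus>\<^bsub>End_alg\<^esub> y = x - y" for x y :: "complex^'a^'a"
    using End_minus[of UNIV x y] calg_End by (simp add: End_alg_def)
  then show ?thesis
    using uq_hom_rels[OF assms calg_End] unfolding uq_rels_hold_def uq_triple_def End_alg_simps by simp
qed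

lemma casimir_hom:
  assumes h: "h \<in> alg_hom (Uq q) End_alg"
  shows "h (casimir q) = cas q (h (uq_elt q GenE)) (h (uq_elt q GenF)) (h (uq_elt q GenQH)) (h (uq_elt q GenQHinv))"
proof -
  interpret U: calg "Uq q" by (rule calg_Uq)
  show ?thesis
    unfolding casimir_def Let_def cas_def
    by (simp add: alg_homD(2,3,5)[OF h] uq_elt_closed End_alg_simps)
qed

lemma casimir_closed: "casimir q \<in> carrier (Uq q)"
proof -
  interpret U: calg "Uq q" by (rule calg_Uq)
  show ?thesis unfolding casimir_def Let_def by (simp add: uq_elt_closed)
qed

lemma kronecker_mult: "kronecker M N ** kronecker M' N' = kronecker (M ** M') (N ** N')"
proof -
  have "(\<Sum>k\<in>UNIV. M $ fst i $ fst k * N $ snd i $ snd k * (M' $ fst k $ fst j * N' $ snd k $ snd j))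
     = (\<Sum>k\<in>UNIV. M $ fst i $ k * M' $ k $ fst j) * (\<Sum>k\<in>UNIV. N $ snd i $ k * N' $ k $ snd j)" for i j
    unfolding sum_product sum.cartesian_product UNIV_Times_UNIV
    by (intro sum.cong refl) (simp add: case_prod_unfold mult_ac)
  then show ?thesis by (simp add: kronecker_def matrix_matrix_mult_def vec_eq_iff)
qed

lemma kronecker_one: "kronecker (mat 1) (mat 1) = mat 1"
  by (auto simp: kronecker_def mat_def vec_eq_iff prod_eq_iff)

lemma bihom_kronecker: "bihom End_alg End_alg End_alg kronecker"
  unfolding bihom_def End_alg_simps
  by (auto simp: kronecker_mult kronecker_one) (auto simp: kronecker_def mat_smult_def vec_eq_iff algebra_simps)

lemma tensor_rep_hom:
  assumes "calg A" "calg B" "\<pi> \<in> alg_hom A End_alg" "\<rho> \<in> alg_hom B End_alg"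
  shows "tensor_rep \<pi> \<rho> \<in> alg_hom (tensor_algebra A B) End_alg"
    and "a \<in> carrier A \<Longrightarrow> b \<in> carrier B \<Longrightarrow> tensor_rep \<pi> \<rho> (tens A B a b) = kronecker (\<pi> a) (\<rho> b)"
  unfolding tensor_rep_def
  using tensor_lift_hom[OF assms(1,2) calg_End bihom_comp_homs[OF bihom_kronecker assms(3,4)]]
    tensor_lift_tens[OF assms(1,2) calg_End bihom_comp_homs[OF bihom_kronecker assms(3,4)]] by blast+

lemma bihom_comult2:
  assumes "q \<noteq> 0" shows "bihom (Uq q) (Uq q) (Uq3 q) (\<lambda>a b. tens (Uq q) (Uq2 q) a (comult q b))"
  by (rule bihom_comp_homs[OF bihom_tens3 alg_hom_id comult_hom[OF assms]])

lemma comult2_hom: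
  assumes "q \<noteq> 0" shows "comult2 q \<in> alg_hom (Uq q) (Uq3 q)"
proof -
  note l = tensor_lift_hom[OF calg_Uq calg_Uq calg_Uq3 bihom_comult2[OF assms], folded Uq2_def]
  have "comult2 q = tensor_lift (Uq3 q) (\<lambda>a b. tens (Uq q) (Uq2 q) a (comult q b)) \<circ> comult q"
    by (simp add: comult2_def fun_eq_iff)
  then show ?thesis using alg_hom_comp[OF comult_hom[OF assms] l] by simp
qed

lemma comult2_tens:
  assumes "q \<noteq> 0" "a \<in> carrier (Uq q)" "b \<in> carrier (Uq q)"
  shows "tensor_lift (Uq3 q) (\<lambda>a b. tens (Uq q) (Uq2 q) a (comult q b)) (tens2 q a b) = tens (Uq q) (Uq2 q) a (comult q b)"
  unfolding tens2_def by (rule tensor_lift_tens[OF calg_Uq calg_Uq calg_Uq3 bihom_comult2[OF assms(1)] assms(2,3)])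

text \<open>The embedding of t as t tensor 1, written directly in the right-nested
  bracketing.\<close>

definition first_two :: "complex \<Rightarrow> (uq, uq) tensor \<Rightarrow> (uq, (uq, uq) tensor) tensor" where
  "first_two q = tensor_lift (Uq3 q) (\<lambda>a b. tens (Uq q) (Uq2 q) a (tens2 q b \<one>\<^bsub>Uq q\<^esub>))"

lemma bihom_first_two: "bihom (Uq q) (Uq q) (Uq3 q) (\<lambda>a b. tens (Uq q) (Uq2 q) a (tens2 q b \<one>\<^bsub>Uq q\<^esub>))"
  by (rule bihom_comp_homs[OF bihom_tens3 alg_hom_id bihom_right_unit_hom[OF bihom_tens2 calg_Uq]])

lemma first_two_hom: "first_two q \<in> alg_hom (Uq2 q) (Uq3 q)"
  unfolding first_two_def
  by (rule tensor_lift_hom[OF calg_Uq calg_Uq calg_Uq3 bihom_first_two, folded Uq2_def])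

lemma first_two_tens:
  assumes "a \<in> carrier (Uq q)" "b \<in> carrier (Uq q)"
  shows "first_two q (tens2 q a b) = tens (Uq q) (Uq2 q) a (tens2 q b \<one>\<^bsub>Uq q\<^esub>)"
proof -
  have "tens2 q a b = tens (Uq q) (Uq q) a b" by (simp only: tens2_def)
  then show ?thesis
    using tensor_lift_tens[OF calg_Uq calg_Uq calg_Uq3 bihom_first_two assms] by (simp only: first_two_def)
qed

text \<open>For a fixed third factor c the inner lift in \<open>tensor_assoc\<close> is no
  homomorphism. It equals \<open>first_two q u\<close> times the image \<open>G c\<close> of c in
  the third slot; the two images commute, so the product is multiplicative in the pair and the outer
  lift can be evaluated.\<close>

lemma tensor_assoc_unit:
  assumes t: "t \<in> carrier (Uq2 q)"
  shows "tensor_assoc (Uq q) (Uq q) (Uq q) (tens (Uq2 q) (Uq q) t \<one>\<^bsub>Uq q\<^esub>) = first_two q t"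
proof -
  interpret U: calg "Uq q" by (rule calg_Uq)
  interpret U2: calg "Uq2 q" by (rule calg_Uq2)
  interpret U3: calg "Uq3 q" by (rule calg_Uq3)
  let ?A = "Uq q" and ?T = "tens (Uq q) (Uq2 q)"
  define G where "G = (\<lambda>c. ?T \<one>\<^bsub>?A\<^esub> (tens2 q \<one>\<^bsub>?A\<^esub> c))"
  have G: "G \<in> alg_hom ?A (Uq3 q)"
    using alg_hom_comp[OF bihom_left_unit_hom[OF bihom_tens2[of q] calg_Uq] bihom_left_unit_hom[OF bihom_tens3[of q] calg_Uq]]
    by (simp add: G_def comp_def)
  note b2 = bihomD[OF bihom_tens2[of q]] and b3 = bihomD[OF bihom_tens3[of q]] and F = alg_homD[OF first_two_hom[of q]]
  have split: "?T a (tens2 q b c) = ?T a (tens2 q b \<one>\<^bsub>?A\<^esub>) \<otimes>\<^bsub>Uq3 q\<^esub> G c" "?T a (tens2 q b c) = G c \<otimes>\<^bsub>Uq3 q\<^esub> ?T a (tens2 q b \<one>\<^bsub>?A\<^esub>)"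
    if "a \<in> carrier ?A" "b \<in> carrier ?A" "c \<in> carrier ?A" for a b c
    using that unfolding G_def by (simp_all add: b3(6)[symmetric] b2(6)[symmetric] b2(1))
  have comm: "G c \<otimes>\<^bsub>Uq3 q\<^esub> first_two q u = first_two q u \<otimes>\<^bsub>Uq3 q\<^esub> G c" if u: "u \<in> carrier (Uq2 q)" and c: "c \<in> carrier ?A" for u c
    using u unfolding Uq2_def
  proof (induction u rule: tensor_induct[OF calg_Uq calg_Uq, consumes 1])
    case (1 a b)
    have "first_two q (tens ?A ?A a b) = ?T a (tens2 q b \<one>\<^bsub>?A\<^esub>)"
      using first_two_tens[OF 1] by (simp only: tens2_def)
    then show ?case using split[OF 1 c] by simp
  next
    case (2 v w)
    then have vw: "v \<in> carrier (Uq2 q)" "w \<in> carrier (Uq2 q)" by (simp_all only: Uq2_def)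
    have "first_two q (v \<oplus>\<^bsub>Uq2 q\<^esub> w) = first_two q v \<oplus>\<^bsub>Uq3 q\<^esub> first_two q w" by (rule F(3)[OF vw])
    then show ?case using 2(3,4) F(1)[OF vw(1)] F(1)[OF vw(2)] alg_homD(1)[OF G c]
      by (simp add: Uq2_def[symmetric] U3.l_distr U3.r_distr)
  qed
  let ?\<beta> = "\<lambda>t c. tensor_lift (Uq3 q) (\<lambda>a b. ?T a (tens2 q b c)) t"
  have \<beta>: "?\<beta> u c = first_two q u \<otimes>\<^bsub>Uq3 q\<^esub> G c" if "u \<in> carrier (Uq2 q)" "c \<in> carrier ?A" for u c
    unfolding first_two_def
    by (rule tensor_lift_mult_right[OF calg_Uq calg_Uq calg_Uq3 bihom_first_two alg_homD(1)[OF G that(2)] split(1)[OF _ _ that(2)] that(1)[unfolded Uq2_def]])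
  have "bihom (Uq2 q) ?A (Uq3 q) (\<lambda>u c. first_two q u \<otimes>\<^bsub>Uq3 q\<^esub> G c)"
    by (rule bihom_hom_hom[OF calg_Uq3 first_two_hom G comm])
  note bb = bihomD[OF this]
  have "bihom (Uq2 q) ?A (Uq3 q) ?\<beta>"
    unfolding bihom_def
    by (intro conjI ballI allI)
      (simp_all only: \<beta> bb U.a_closed U.m_closed U.one_closed U.smult_closed U2.a_closed U2.m_closed U2.one_closed U2.smult_closed)
  then have "tensor_lift (Uq3 q) ?\<beta> (tens (Uq2 q) ?A t \<one>\<^bsub>?A\<^esub>) = ?\<beta> t \<one>\<^bsub>?A\<^esub>"
    by (rule tensor_lift_tens[OF calg_Uq2 calg_Uq calg_Uq3 _ t U.one_closed])
  also have "\<dots> = first_two q t \<otimes>\<^bsub>Uq3 q\<^esub> \<one>\<^bsub>Uq3 q\<^esub>" using \<beta>[OF t U.one_closed] alg_homD(4)[OF G] by simp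
  also have "\<dots> = first_two q t" using F(1)[OF t] by simp
  finally show ?thesis
    unfolding tensor_assoc_def Let_def Uq2_def[symmetric] Uq3_def[symmetric] tens2_def[symmetric] .
qed

section \<open>Spin representations in coordinates\<close>

lemma alg_hom_free_range:
  assumes h: "h \<in> alg_hom free_algebra B" and B: "calg B"
    and gen: "\<And>x. h (gen x) \<in> P" and one: "\<one>\<^bsub>B\<^esub> \<in> P"
    and mult: "\<And>x y. x \<in> P \<Longrightarrow> y \<in> P \<Longrightarrow> x \<otimes>\<^bsub>B\<^esub> y \<in> P"
    and add: "\<And>x y. x \<in> P \<Longrightarrow> y \<in> P \<Longrightarrow> x \<oplus>\<^bsub>B\<^esub> y \<in> P"
    and smult: "\<And>c x. x \<in> P \<Longrightarrow> c \<odot>\<^bsub>B\<^esub> x \<in> P"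
  shows "h w \<in> P"
proof -
  have word: "h (pm_single u 1) \<in> P" for u
  proof (induction u)
    case Nil
    then show ?case using one alg_homD(4)[OF h] by (simp add: free_algebra_simps)
  next
    case (Cons x u)
    have "pm_single (x # u) (1 :: complex) = gen x \<otimes>\<^bsub>free_algebra\<^esub> pm_single u 1"
      by (simp add: free_algebra_simps gen_def mmul_single)
    then show ?case using alg_homD(2)[OF h, of "gen x" "pm_single u 1"] mult[OF gen Cons] by simp
  qed
  have sgl: "h (pm_single u a) \<in> P" for u a
  proof -
    have "pm_single u a = a \<odot>\<^bsub>free_algebra\<^esub> pm_single u 1" by (simp add: free_algebra_simps pm_scale_single)
    then show ?thesis using alg_homD(5)[OF h, of "pm_single u 1" a] smult[OF word] by simp
  qed
  have "pm_keys w \<subseteq> UNIV" by simp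
  then show ?thesis
  proof (induction w rule: pm_induct)
    case zero
    then show ?case using sgl[of _ 0] by simp
  next
    case (single u a) then show ?case by (intro sgl)
  next
    case (add v w)
    then show ?case using alg_homD(3)[OF h, of v w] assms(6) by (simp add: free_algebra_simps)
  qed
qed

lemma uq_hom_range:
  assumes h: "h \<in> alg_hom (Uq q) End_alg" and x: "x \<in> carrier (Uq q)"
    and gen: "\<And>g. h (uq_elt q g) \<in> P" and one: "mat 1 \<in> P"
    and mult: "\<And>x y. x \<in> P \<Longrightarrow> y \<in> P \<Longrightarrow> x ** y \<in> P"
    and add: "\<And>x y. x \<in> P \<Longrightarrow> y \<in> P \<Longrightarrow> x + y \<in> P"
    and smult: "\<And>c x. x \<in> P \<Longrightarrow> mat_smult c x \<in> P"
  shows "h x \<in> P"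
proof -
  obtain w where w: "x = quot_class free_algebra (uq_rels q) w"
    using x unfolding Uq_def quot_algebra_simps(1)[OF calg_free_algebra uq_rels_carrier] by blast
  have "(h \<circ> quot_class free_algebra (uq_rels q)) w \<in> P"
    by (rule alg_hom_free_range[OF alg_hom_comp[OF uq_class_hom h] calg_End])
      (use assms(3-) in \<open>simp_all add: End_alg_simps uq_elt_def\<close>)
  then show ?thesis by (simp add: w)
qed

text \<open>The polynomial in \<open>K\<close> with the other eigenvalues as roots kills the span of
  the other vectors but not the new one.\<close>

lemma eigenvectors_independent:
  fixes f :: "nat \<Rightarrow> complex^'n"
  assumes "finite T" "\<And>k. k \<in> T \<Longrightarrow> f k \<noteq> 0" "\<And>k. k \<in> T \<Longrightarrow> K *v f k = \<kappa> k *s f k" "inj \<kappa>"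
  shows "vec.independent (f ` T) \<and> inj_on f T"
  using assms(1-3)
proof (induction T rule: finite_induct)
  case empty
  then show ?case by (simp add: vec.independent_empty)
next
  case (insert x T)
  have "f x \<notin> vec.span (f ` T)"
  proof
    assume x: "f x \<in> vec.span (f ` T)"
    let ?P = "root_poly K (map \<kappa> (sorted_list_of_set T))"
    have "?P *v f t = 0" if "t \<in> T" for t
    proof -
      have "(\<Prod>b\<leftarrow>map \<kappa> (sorted_list_of_set T). \<kappa> t - b) = 0"
        using that insert.hyps(1) by (auto simp: prod_list_zero_iff)
      then show ?thesis using root_poly_eigen[OF insert.prems(2)[of t]] that by simp
    qed
    then have "f ` T \<subseteq> {w. ?P *v w = 0}" by blast
    moreover have "vec.subspace {w. ?P *v w = 0}" by (auto simp: vec.subspace_def mv_simps)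
    ultimately have "vec.span (f ` T) \<subseteq> {w. ?P *v w = 0}" by (rule vec.span_minimal)
    with x have "?P *v f x = 0" by blast
    moreover have "(\<Prod>b\<leftarrow>map \<kappa> (sorted_list_of_set T). \<kappa> x - b) \<noteq> 0"
      using insert.hyps assms(4) by (auto simp: prod_list_zero_iff inj_eq)
    ultimately show False using root_poly_eigen[OF insert.prems(2)[of x], of "map \<kappa> (sorted_list_of_set T)"] insert.prems(1)[of x]
      by (simp add: vec.scale_eq_0_iff)
  qed
  moreover from this have "f x \<notin> f ` T" using vec.span_base by blast
  ultimately show ?case using insert by (auto simp: vec.independent_insert)
qed

context generic_q
begin

context
  fixes d :: nat and \<pi> :: "uq \<Rightarrow> complex^'n^'n"
  assumes spin: "spin_rep q s d \<pi>"
begin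

text \<open>The vectors are the images of the given highest weight vector under powers of F. The
  nonzero ones are independent as eigenvectors for distinct eigenvalues, so there are at most d + 1;
  their span is invariant and contains a generating vector, so there are at least d + 1.\<close>

lemma spin_string:
  obtains f :: "nat \<Rightarrow> complex^'n" where
    "\<And>k. \<pi> (uq_elt q GenF) *v f k = f (Suc k)"
    "\<And>k. \<pi> (uq_elt q GenQH) *v f k = s powi (int d - 2 * int k) *s f k"
    "\<And>k. \<pi> (uq_elt q GenQHinv) *v f k = s powi (2 * int k - int d) *s f k"
    "\<pi> (uq_elt q GenE) *v f 0 = 0"
    "\<And>k. \<pi> (uq_elt q GenE) *v f (Suc k) = (q_int q (int k + 1) * q_int q (int d - int k)) *s f k"
    "vec.independent (f ` {..d})" "inj_on f {..d}" "vec.span (f ` {..d}) = UNIV" "f (Suc d) = 0"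
proof -
  let ?E = "\<pi> (uq_elt q GenE)" and ?F = "\<pi> (uq_elt q GenF)" and ?K = "\<pi> (uq_elt q GenQH)" and ?L = "\<pi> (uq_elt q GenQHinv)"
  have hom: "\<pi> \<in> alg_hom (Uq q) End_alg" and card: "CARD('n) = d + 1" using spin by (auto simp: spin_rep_def)
  obtain v where v: "v \<noteq> 0" "?E *v v = 0" "?K *v v = s ^ d *s v" "{\<pi> x *v v | x. x \<in> carrier (Uq q)} = UNIV"
    using spin unfolding spin_rep_def by blast
  note U = uq_triple_hom[OF hom]
  have spow: "s powi x * s powi y = s powi (x + y)" for x y using s_nz by (simp add: power_int_add)
  have sq: "s powi m * s powi m = q powi m" for m unfolding spow using s_powi_double[of m] by simp
  define f where "f = (\<lambda>k. ((*v) ?F ^^ k) v)"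
  have F: "?F *v f k = f (Suc k)" for k by (simp add: f_def)
  have K: "?K *v f k = s powi (int d - 2 * int k) *s f k" for k
  proof (induction k)
    case 0 then show ?case using v(3) by (simp add: f_def)
  next
    case (Suc k)
    have "s powi (int d - 2 * int (Suc k)) = inverse q * s powi (int d - 2 * int k)"
    proof -
      have "int d - 2 * int (Suc k) = (int d - 2 * int k) + - 2" by simp
      then have "s powi (int d - 2 * int (Suc k)) = s powi (int d - 2 * int k) * s powi (- 2)" by (simp only: spow)
      also have "s powi (- 2) = inverse q" using s_sq by (simp add: power_int_def power_inverse)
      finally show ?thesis by simp
    qed
    then show ?case unfolding F[symmetric] using uq_triple_hom[OF hom] Suc KF[OF q_nz q2_ne_1 U] by (simp add: vec.scale vector_smult_assoc)
  qed
  have L: "?L *v f k = s powi (2 * int k - int d) *s f k" for k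
  proof -
    have "f k = s powi (int d - 2 * int k) *s (?L *v f k)"
      using LK[OF q_nz q2_ne_1 U, of "f k"] K[of k] by (simp add: vec.scale)
    then have "s powi (2 * int k - int d) *s f k = (s powi (2 * int k - int d) * s powi (int d - 2 * int k)) *s (?L *v f k)"
      by (metis vector_smult_assoc)
    then show ?thesis unfolding spow by simp
  qed
  have step: "?E *v (?F *v f k) = ?F *v (?E *v f k) + q_int q (int d - 2 * int k) *s f k" for k
  proof -
    have "s powi (2 * int k - int d) * s powi (2 * int k - int d) = q powi (- (int d - 2 * int k))" unfolding sq by simp
    then show ?thesis
      unfolding EF[OF q_nz q2_ne_1 U] K L vec.scale vector_smult_assoc sq
      by (simp add: vector_smult_assoc vector_ssub_ldistrib q_int_def) (simp add: vec_eq_iff divide_inverse algebra_simps)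
  qed
  have E: "?E *v f (Suc k) = (q_int q (int k + 1) * q_int q (int d - int k)) *s f k" for k
  proof (induction k)
    case 0
    then show ?case using step[of 0] v(2) F[of 0] q_diff_nz by (simp add: f_def q_int_def)
  next
    case (Suc k)
    \<comment> \<open>Writing a single q-integer as its product with the q-integer of 1 gives all
      terms the same denominator, after which four powers on each side are compared.\<close>
    have qid: "q_int q (int k + 1) * q_int q (int d - int k) + q_int q (int d - 2 * int (Suc k)) = q_int q (int (Suc k) + 1) * q_int q (int d - int (Suc k))"
    proof -
      have m: "q_int q a * q_int q b = (q powi (a + b) + q powi (- a - b) - q powi (a - b) - q powi (b - a)) / (q - inverse q)^2" for a b
      proof -
        have "(q powi a - q powi - a) * (q powi b - q powi - b) = q powi (a + b) + q powi (- a + - b) - q powi (a + - b) - q powi (- a + b)"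
          using q_nz by (simp only: power_int_add simp_thms) (simp add: algebra_simps)
        then show ?thesis by (simp add: q_int_def power2_eq_square)
      qed
      have "q_int q x = q_int q 1 * q_int q x" for x using q_diff_nz by (simp add: q_int_def)
      then have "q_int q x = (q powi (1 + x) + q powi (- 1 - x) - q powi (1 - x) - q powi (x - 1)) / (q - inverse q)^2" for x
        using m[of 1 x] by metis
      from this[of "int d - 2 * int (Suc k)"] show ?thesis unfolding m
        by (simp add: add_divide_distrib[symmetric] algebra_simps)
    qed
    have "?E *v f (Suc (Suc k)) = ?F *v (?E *v f (Suc k)) + q_int q (int d - 2 * int (Suc k)) *s f (Suc k)"
      using step[of "Suc k"] F by simp
    also have "\<dots> = (q_int q (int k + 1) * q_int q (int d - int k) + q_int q (int d - 2 * int (Suc k))) *s f (Suc k)"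
      unfolding Suc vec.scale F vector_sadd_rdistrib ..
    finally show ?case unfolding qid .
  qed
  have E0: "?E *v f 0 = 0" using v(2) by (simp add: f_def)
  define T where "T = {k. f k \<noteq> 0}"
  have inj: "inj (\<lambda>k. s powi (int d - 2 * int k))"
  proof (rule injI)
    fix x y :: nat assume "s powi (int d - 2 * int x) = s powi (int d - 2 * int y)"
    then have "q powi (int d - 2 * int x) = q powi (int d - 2 * int y)" unfolding sq[symmetric] by simp
    then show "x = y" by (simp add: q_powi_inject)
  qed
  have ind: "vec.independent (f ` S) \<and> inj_on f S" if "finite S" "S \<subseteq> T" for S
    by (rule eigenvectors_independent[OF that(1) _ K inj]) (use that(2) in \<open>auto simp: T_def\<close>)
  have dim: "vec.dim (UNIV :: (complex^'n) set) = d + 1" using card by (simp add: vec.dim_UNIV card_cart_basis)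
  have bound: "card S \<le> d + 1" if "finite S" "S \<subseteq> T" for S
  proof -
    have "card S = card (f ` S)" using ind[OF that] by (simp add: card_image)
    also have "\<dots> \<le> vec.dim (UNIV :: (complex^'n) set)" using ind[OF that] by (intro vec.independent_card_le_dim) auto
    finally show ?thesis using dim by simp
  qed
  have down: "j \<in> T" if "k \<in> T" "j \<le> k" for j k
  proof (rule ccontr)
    assume "j \<notin> T"
    then have "f j = 0" by (simp add: T_def)
    moreover have "f (j + m) = 0" if "f j = 0" for m using that by (induction m) (simp_all add: F[symmetric])
    ultimately have "f (j + (k - j)) = 0" by blast
    then show False using that by (simp add: T_def)
  qed
  have out: "k \<notin> T" if "k > d" for k
  proof
    assume "k \<in> T"
    then have "{..Suc d} \<subseteq> T" using down that by (auto intro: down[of k])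
    then show False using bound[of "{..Suc d}"] by simp
  qed
  then have TD: "T \<subseteq> {..d}" by (meson atMost_iff not_le subsetI)
  then have fT: "finite T" using finite_subset by blast
  \<comment> \<open>Invariance under the generators gives invariance under the whole image, and the
    orbit of \<open>v\<close> is everything.\<close>
  let ?W = "vec.span (f ` T)"
  have fW: "f k \<in> ?W" for k by (cases "k \<in> T") (auto intro: vec.span_base simp: T_def vec.span_zero)
  have inv: "\<pi> (uq_elt q g) *v w \<in> ?W" if "w \<in> ?W" for g w
  proof -
    have "\<pi> (uq_elt q g) *v f k \<in> ?W" for k
    proof (cases g)
      case GenE then show ?thesis using E0 E fW by (cases k) (auto intro: vec.span_scale vec.span_zero)
    qed (use F K L fW in \<open>auto intro: vec.span_scale\<close>)
    then have "f ` T \<subseteq> {w. \<pi> (uq_elt q g) *v w \<in> ?W}" by blast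
    moreover have "vec.subspace {w. \<pi> (uq_elt q g) *v w \<in> ?W}"
      by (auto simp: vec.subspace_def mv_simps intro: vec.span_add vec.span_scale vec.span_zero)
    ultimately show ?thesis using vec.span_minimal that by blast
  qed
  have "\<pi> x \<in> {M. \<forall>w\<in>?W. M *v w \<in> ?W}" if "x \<in> carrier (Uq q)" for x
    by (rule uq_hom_range[OF hom that]) (auto simp: inv mv_simps intro: vec.span_add vec.span_scale)
  moreover have "v \<in> ?W" using fW[of 0] by (simp add: f_def)
  ultimately have "\<pi> x *v v \<in> ?W" if "x \<in> carrier (Uq q)" for x using that by blast
  then have "{\<pi> x *v v | x. x \<in> carrier (Uq q)} \<subseteq> ?W" by blast
  then have W: "?W = UNIV" unfolding v(4) by blast
  have "d + 1 \<le> card (f ` T)"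
    using vec.dim_le_card[of UNIV "f ` T"] W fT dim by simp
  also have "\<dots> \<le> card T" by (rule card_image_le[OF fT])
  finally have Td: "T = {..d}" using TD card_subset_eq[of "{..d}" T] card_mono[OF _ TD] by simp
  have "f (Suc d) = 0" using out[of "Suc d"] by (simp add: T_def)
  then show ?thesis
    using that[of f, OF F K L E0 E] ind[OF fT order_refl, unfolded Td] W[unfolded Td] by blast
qed

end
end

section \<open>Coordinate functionals on spin representations and their tensor product\<close>

definition lfun :: "complex^'n \<Rightarrow> complex^'n \<Rightarrow> complex" where
  "lfun l x = (\<Sum>a\<in>UNIV. l $ a * x $ a)"

lemma lfun_add: "lfun l (x + y) = lfun l x + lfun l y"
  and lfun_add_left: "lfun (l + l') x = lfun l x + lfun l' x"
  and lfun_scale: "lfun l (a *s x) = a * lfun l x"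
  and lfun_scale_left: "lfun (a *s l) x = a * lfun l x"
  by (simp_all add: lfun_def ring_distribs sum.distrib sum_distrib_left mult_ac)

lemma lfun_zero [simp]: "lfun l 0 = 0" "lfun 0 x = 0"
  by (simp_all add: lfun_def)

lemma lfun_axis: "lfun (axis a 1) x = x $ a"
proof -
  have "lfun (axis a 1) x = (\<Sum>b\<in>UNIV. if b = a then x $ b else 0)"
    unfolding lfun_def by (intro sum.cong) (auto simp: axis_def)
  then show ?thesis by simp
qed

text \<open>Square roots of the eigenvalues of \<open>F E\<close> along the string, shifted so that
  \<open>g k\<close> links positions k - 1 and k; the zero end values close the string.\<close>

definition good_g :: "complex \<Rightarrow> nat \<Rightarrow> (nat \<Rightarrow> complex) \<Rightarrow> bool" where
  "good_g q d g \<longleftrightarrow> g 0 = 0 \<and> g (Suc d) = 0 \<and> (\<forall>k\<le>Suc d. g k ^ 2 = q_int q (int k) * q_int q (int d + 1 - int k))"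

definition spin_coords :: "complex \<Rightarrow> complex \<Rightarrow> nat \<Rightarrow> (uq \<Rightarrow> complex^'n^'n) \<Rightarrow> (nat \<Rightarrow> complex) \<Rightarrow> (nat \<Rightarrow> complex^'n) \<Rightarrow> (nat \<Rightarrow> complex^'n) \<Rightarrow> bool" where
  "spin_coords q s d \<pi> g L R \<longleftrightarrow> good_g q d g \<and>
    (\<forall>k>d. L k = 0) \<and> (\<forall>x. (\<forall>k. lfun (L k) x = 0) \<longrightarrow> x = 0) \<and>
    (\<forall>k j. j \<le> d \<longrightarrow> lfun (L k) (R j) = (if k = j then 1 else 0)) \<and>
    (\<forall>k x. lfun (L k) (\<pi> (uq_elt q GenE) *v x) = g (Suc k) * lfun (L (Suc k)) x \<and>
      lfun (L k) (\<pi> (uq_elt q GenF) *v x) = g k * lfun (L (k - 1)) x \<and>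
      lfun (L k) (\<pi> (uq_elt q GenQH) *v x) = s powi (int d - 2 * int k) * lfun (L k) x \<and>
      lfun (L k) (\<pi> (uq_elt q GenQHinv) *v x) = s powi (2 * int k - int d) * lfun (L k) x)"

text \<open>The string is rescaled by partial products of \<open>g\<close>. Then F has coefficient
  \<open>g\<close> by construction, and E has it as well because the coefficients of E along the
  unscaled string are the squares of \<open>g\<close>. The functionals are the dual basis.\<close>

lemma (in generic_q) spin_coords_exist:
  fixes \<pi> :: "uq \<Rightarrow> complex^'n^'n"
  assumes "spin_rep q s d \<pi>"
  shows "\<exists>g L R. spin_coords q s d \<pi> g L R"
proof -
  let ?E = "\<pi> (uq_elt q GenE)" and ?F = "\<pi> (uq_elt q GenF)" and ?K = "\<pi> (uq_elt q GenQH)" and ?L = "\<pi> (uq_elt q GenQHinv)"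
  obtain f where f: "\<And>k. ?F *v f k = f (Suc k)" "\<And>k. ?K *v f k = s powi (int d - 2 * int k) *s f k"
    "\<And>k. ?L *v f k = s powi (2 * int k - int d) *s f k" "?E *v f 0 = 0"
    "\<And>k. ?E *v f (Suc k) = (q_int q (int k + 1) * q_int q (int d - int k)) *s f k"
    "vec.independent (f ` {..d})" "inj_on f {..d}" "vec.span (f ` {..d}) = UNIV" "f (Suc d) = 0"
    using spin_string[OF assms] by metis
  define g where "g = (\<lambda>k. csqrt (q_int q (int k) * q_int q (int d + 1 - int k)))"
  have g2: "g k * g k = q_int q (int k) * q_int q (int d + 1 - int k)" for k
    by (simp add: g_def flip: power2_eq_square)
  have g: "good_g q d g" by (auto simp: good_g_def g_def q_int_def)
  have gnz: "g (Suc k) \<noteq> 0" if "k < d" for k using that by (simp add: g_def q_int_eq_0_iff)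
  define G where "G = (\<lambda>k. \<Prod>i<k. g (Suc i))"
  have GS: "G (Suc k) = G k * g (Suc k)" for k by (simp add: G_def)
  have Gnz: "G k \<noteq> 0" if "k \<le> d" for k using that gnz by (auto simp: G_def)
  define R where "R = (\<lambda>k. if k \<le> d then (1 / G k) *s f k else 0)"
  have RF: "?F *v R k = g (Suc k) *s R (Suc k)" if "k \<le> d" for k
  proof (cases "k = d")
    case True
    then show ?thesis using f(1)[of d] f(9) by (simp add: R_def vec.scale)
  next
    case False
    then have k: "k < d" using that by simp
    then show ?thesis using gnz[OF k] that by (simp add: R_def vec.scale f(1) GS vector_smult_assoc)
  qed
  have RE: "?E *v R (Suc k) = g (Suc k) *s R k" if "Suc k \<le> d" for k
  proof -
    have nz: "g (Suc k) \<noteq> 0" "G k \<noteq> 0" using gnz[of k] Gnz[of k] that by auto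
    have "q_int q (int k + 1) * q_int q (int d - int k) = g (Suc k) * g (Suc k)" unfolding g2 by (simp add: algebra_simps)
    then show ?thesis using that nz by (simp add: R_def vec.scale f(5) GS vector_smult_assoc)
  qed
  have RE0: "?E *v R 0 = 0" by (simp add: R_def vec.scale f(4))
  have RK: "?K *v R k = s powi (int d - 2 * int k) *s R k" "?L *v R k = s powi (2 * int k - int d) *s R k" for k
    by (simp_all add: R_def vec.scale f(2,3) vector_smult_assoc mult.commute)
  have "\<exists>F. \<forall>h\<in>f ` {..d}. F h \<in> range lfun \<and> (\<forall>h'\<in>f ` {..d}. F h h' = (if h' = h then 1 else 0))"
  proof (rule dual_family[OF _ f(6)])
    show "(\<lambda>v. h v + k v) \<in> range lfun" if "h \<in> range lfun" "k \<in> range lfun" for h k :: "complex^'n \<Rightarrow> complex"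
      using that by (auto intro!: image_eqI[of _ _ "_ + _"] simp: lfun_add_left fun_eq_iff)
    show "(\<lambda>v. a * h v) \<in> range lfun" if "h \<in> range lfun" for h :: "complex^'n \<Rightarrow> complex" and a
      using that by (auto intro!: image_eqI[of _ _ "_ *s _"] simp: lfun_scale_left fun_eq_iff)
    show "v = 0" if "\<And>h. h \<in> range lfun \<Longrightarrow> h v = 0" for v :: "complex^'n"
      using that[of "lfun (axis a 1)" for a] by (simp add: lfun_axis vec_eq_iff)
  qed (auto simp: lfun_add lfun_scale)
  then obtain F where F: "\<And>h. h \<in> f ` {..d} \<Longrightarrow> F h \<in> range lfun" "\<And>h h'. h \<in> f ` {..d} \<Longrightarrow> h' \<in> f ` {..d} \<Longrightarrow> F h h' = (if h' = h then 1 else 0)"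
    by blast
  have "\<exists>l. \<forall>j\<le>d. lfun l (f j) = (if k = j then 1 else 0)" if "k \<le> d" for k
  proof -
    obtain l where "F (f k) = lfun l" using F(1)[of "f k"] \<open>k \<le> d\<close> by auto
    then have "\<forall>j\<le>d. lfun l (f j) = (if k = j then 1 else 0)"
      using F(2)[of "f k" "f j" for j] that f(7) by (auto simp: inj_on_eq_iff)
    then show ?thesis by blast
  qed
  then obtain l where l: "\<And>k j. k \<le> d \<Longrightarrow> j \<le> d \<Longrightarrow> lfun (l k) (f j) = (if k = j then 1 else 0)" by metis
  define L where "L = (\<lambda>k. if k \<le> d then G k *s l k else 0)"
  have LR: "lfun (L k) (R j) = (if k = j then 1 else 0)" if "j \<le> d" for k j
    using that Gnz l by (auto simp: L_def R_def lfun_scale lfun_scale_left)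
  \<comment> \<open>Every identity below is linear in \<open>x\<close>, so checking it on the
    rescaled string suffices.\<close>
  have spanR: "P x" if sub: "vec.subspace {x. P x}" and "\<And>j. j \<le> d \<Longrightarrow> P (R j)" for P x
  proof -
    have "P (f j)" if "j \<le> d" for j
    proof -
      have "G j *s R j \<in> {x. P x}" using \<open>\<And>j. j \<le> d \<Longrightarrow> P (R j)\<close>[OF that] by (intro vec.subspace_scale[OF sub]) simp
      then show ?thesis using Gnz[OF that] that by (simp add: R_def vector_smult_assoc)
    qed
    then have "vec.span (f ` {..d}) \<subseteq> {x. P x}" by (intro vec.span_minimal[OF _ sub]) auto
    then show ?thesis using f(8) by blast
  qed
  have lin: "vec.subspace {x. lfun a (M *v x) = b * lfun a' x}" for M a a' b
    by (auto simp: vec.subspace_def mv_simps lfun_add lfun_scale algebra_simps)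
  have LE: "lfun (L k) (?E *v x) = g (Suc k) * lfun (L (Suc k)) x" for k x
  proof (rule spanR[OF lin])
    fix j assume j: "j \<le> d"
    show "lfun (L k) (?E *v R j) = g (Suc k) * lfun (L (Suc k)) (R j)"
      by (cases j) (use j RE0 RE LR in \<open>auto simp: lfun_scale\<close>)
  qed
  have LF: "lfun (L k) (?F *v x) = g k * lfun (L (k - 1)) x" for k x
  proof (rule spanR[OF lin])
    fix j assume j: "j \<le> d"
    have e: "lfun (L k) (?F *v R j) = g (Suc j) * lfun (L k) (R (Suc j))" using RF[OF j] by (simp add: lfun_scale)
    show "lfun (L k) (?F *v R j) = g k * lfun (L (k - 1)) (R j)"
    proof (cases "j = d")
      case True
      then show ?thesis unfolding e using g LR[OF j, of "k - 1"] by (auto simp: good_g_def) (cases k; simp)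
    next
      case False
      then show ?thesis unfolding e using g j LR[of "Suc j" k] LR[OF j, of "k - 1"] by (cases k) (auto simp: good_g_def)
    qed
  qed
  have LK: "lfun (L k) (?K *v x) = s powi (int d - 2 * int k) * lfun (L k) x" for k x
    by (rule spanR[OF lin]) (auto simp: RK lfun_scale LR)
  have LL: "lfun (L k) (?L *v x) = s powi (2 * int k - int d) * lfun (L k) x" for k x
    by (rule spanR[OF lin]) (auto simp: RK lfun_scale LR)
  have sep: "x = 0" if "\<And>k. lfun (L k) x = 0" for x
  proof -
    have "x = (\<Sum>k\<le>d. lfun (L k) x *s R k)" 
    proof (rule spanR[where P = "\<lambda>x. x = (\<Sum>k\<le>d. lfun (L k) x *s R k)"])
      show "vec.subspace {x. x = (\<Sum>k\<le>d. lfun (L k) x *s R k)}"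
        unfolding vec.subspace_def
      proof (intro conjI ballI allI)
        fix x c assume "x \<in> {x. x = (\<Sum>k\<le>d. lfun (L k) x *s R k)}"
        then have x: "(\<Sum>k\<le>d. lfun (L k) x *s R k) = x" by (simp only: mem_Collect_eq)
        have "(\<Sum>k\<le>d. lfun (L k) (c *s x) *s R k) = c *s (\<Sum>k\<le>d. lfun (L k) x *s R k)"
          by (simp add: lfun_scale vec.scale_sum_right vector_smult_assoc)
        then show "c *s x \<in> {x. x = (\<Sum>k\<le>d. lfun (L k) x *s R k)}" unfolding x by simp
      qed (auto simp: lfun_add vector_sadd_rdistrib sum.distrib)
      fix j assume j: "j \<le> d"
      have "(\<Sum>k\<le>d. lfun (L k) (R j) *s R k) = (\<Sum>k\<le>d. if k = j then R j else 0)"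
        by (intro sum.cong refl) (simp add: LR[OF j])
      then show "R j = (\<Sum>k\<le>d. lfun (L k) (R j) *s R k)" using j by simp
    qed
    then show ?thesis using that by simp
  qed
  have "spin_coords q s d \<pi> g L R"
    unfolding spin_coords_def using g LE LF LK LL sep LR by (auto simp: L_def)
  then show ?thesis by blast
qed

text \<open>The tensor product of three functionals, evaluated slot by slot, so that an operator in
  one slot meets only the functional of that slot.\<close>

definition triple_coord :: "(nat \<Rightarrow> complex^'n1) \<Rightarrow> (nat \<Rightarrow> complex^'n2) \<Rightarrow> (nat \<Rightarrow> complex^'n3) \<Rightarrow> complex^('n1 \<times> 'n2 \<times> 'n3) \<Rightarrow> nat \<Rightarrow> nat \<Rightarrow> nat \<Rightarrow> complex" where
  "triple_coord L1 L2 L3 v i j k = lfun (L1 i) (\<chi> a. lfun (L2 j) (\<chi> b. lfun (L3 k) (\<chi> c. v $ (a, b, c))))"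

abbreviation "slot1 M \<equiv> kronecker M (kronecker (mat 1) (mat 1))"
abbreviation "slot2 M \<equiv> kronecker (mat 1) (kronecker M (mat 1))"
abbreviation "slot3 M \<equiv> kronecker (mat 1) (kronecker (mat 1) M)"

lemma sum_triple: "(\<Sum>p\<in>UNIV. f p) = (\<Sum>a\<in>UNIV. \<Sum>b\<in>UNIV. \<Sum>c\<in>UNIV. (f :: 'a::finite \<times> 'b::finite \<times> 'c::finite \<Rightarrow> complex) (a, b, c))"
  by (simp add: sum.cartesian_product case_prod_unfold)

lemma slot_component:
  "(slot1 M *v v) $ (a, b, c) = (\<Sum>a'\<in>UNIV. M $ a $ a' * v $ (a', b, c))"
  "(slot2 N *v v) $ (a, b, c) = (\<Sum>b'\<in>UNIV. N $ b $ b' * v $ (a, b', c))"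
  "(slot3 P *v v) $ (a, b, c) = (\<Sum>c'\<in>UNIV. P $ c $ c' * v $ (a, b, c'))"
proof -
  have d': "(\<Sum>x\<in>UNIV. if z = x then f x else 0) = f z" for f :: "'z::finite \<Rightarrow> complex" and z by simp
  have i: "(if P then y else 0) * x = (if P then y * x else (0 :: complex))" for P x y by simp
  have z: "(\<Sum>x\<in>S. if P then f x else 0) = (if P then \<Sum>x\<in>S. f x else (0 :: complex))" for P S and f :: "'z \<Rightarrow> complex" by simp
  have m: "x * (if P then y else 0) = (if P then x * y else (0 :: complex))" for P x y by simp
  show "(slot1 M *v v) $ (a, b, c) = (\<Sum>a'\<in>UNIV. M $ a $ a' * v $ (a', b, c))"
    "(slot2 N *v v) $ (a, b, c) = (\<Sum>b'\<in>UNIV. N $ b $ b' * v $ (a, b', c))"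
    "(slot3 P *v v) $ (a, b, c) = (\<Sum>c'\<in>UNIV. P $ c $ c' * v $ (a, b, c'))"
    unfolding matrix_vector_mult_def sum_triple kronecker_def mat_def
    by (simp_all only: vec_lambda_beta fst_conv snd_conv i m mult_1 mult_1_right) (simp_all add: z)
qed

lemma triple_coord_slots:
  "triple_coord L1 L2 L3 (slot1 M *v v) i j k = lfun (L1 i) (M *v (\<chi> a. lfun (L2 j) (\<chi> b. lfun (L3 k) (\<chi> c. v $ (a, b, c)))))"
  "triple_coord L1 L2 L3 (slot2 N *v v) i j k = lfun (L1 i) (\<chi> a. lfun (L2 j) (N *v (\<chi> b. lfun (L3 k) (\<chi> c. v $ (a, b, c)))))"
  "triple_coord L1 L2 L3 (slot3 P *v v) i j k = lfun (L1 i) (\<chi> a. lfun (L2 j) (\<chi> b. lfun (L3 k) (P *v (\<chi> c. v $ (a, b, c)))))"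
proof -
  have s: "lfun m (\<chi> c. (\<Sum>a\<in>UNIV. M a * w a c)) = (\<Sum>a\<in>UNIV. M a * lfun m (\<chi> c. w a c))"
    for m and M :: "'z::finite \<Rightarrow> complex" and w
    unfolding lfun_def by (simp add: sum_distrib_left mult_ac) (rule sum.swap)
  show "triple_coord L1 L2 L3 (slot1 M *v v) i j k = lfun (L1 i) (M *v (\<chi> a. lfun (L2 j) (\<chi> b. lfun (L3 k) (\<chi> c. v $ (a, b, c)))))"
    "triple_coord L1 L2 L3 (slot2 N *v v) i j k = lfun (L1 i) (\<chi> a. lfun (L2 j) (N *v (\<chi> b. lfun (L3 k) (\<chi> c. v $ (a, b, c)))))"
    "triple_coord L1 L2 L3 (slot3 P *v v) i j k = lfun (L1 i) (\<chi> a. lfun (L2 j) (\<chi> b. lfun (L3 k) (P *v (\<chi> c. v $ (a, b, c)))))"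
    unfolding triple_coord_def slot_component s by (simp_all add: matrix_vector_mult_def)
qed

lemma (in generic_q) three_strings_exist:
  fixes \<pi>1 :: "uq \<Rightarrow> complex^'n1^'n1" and \<pi>2 :: "uq \<Rightarrow> complex^'n2^'n2" and \<pi>3 :: "uq \<Rightarrow> complex^'n3^'n3"
  assumes sp: "spin_rep q s d1 \<pi>1" "spin_rep q s d2 \<pi>2" "spin_rep q s d3 \<pi>3"
  defines "X1 \<equiv> \<lambda>g. slot1 (\<pi>1 (uq_elt q g)) :: complex^('n1 \<times> 'n2 \<times> 'n3)^('n1 \<times> 'n2 \<times> 'n3)"
    and "X2 \<equiv> \<lambda>g. slot2 (\<pi>2 (uq_elt q g)) :: complex^('n1 \<times> 'n2 \<times> 'n3)^('n1 \<times> 'n2 \<times> 'n3)"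
    and "X3 \<equiv> \<lambda>g. slot3 (\<pi>3 (uq_elt q g)) :: complex^('n1 \<times> 'n2 \<times> 'n3)^('n1 \<times> 'n2 \<times> 'n3)"
  assumes uq: "uq_triple q (X1 GenE ** X2 GenQHinv + X1 GenQH ** X2 GenE) (X1 GenF ** X2 GenQHinv + X1 GenQH ** X2 GenF) (X1 GenQH ** X2 GenQH) (X1 GenQHinv ** X2 GenQHinv)"
    "uq_triple q (X2 GenE ** X3 GenQHinv + X2 GenQH ** X3 GenE) (X2 GenF ** X3 GenQHinv + X2 GenQH ** X3 GenF) (X2 GenQH ** X3 GenQH) (X2 GenQHinv ** X3 GenQHinv)"
    "uq_triple q (X1 GenE ** X2 GenQHinv ** X3 GenQHinv + X1 GenQH ** X2 GenE ** X3 GenQHinv + X1 GenQH ** X2 GenQH ** X3 GenE)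
      (X1 GenF ** X2 GenQHinv ** X3 GenQHinv + X1 GenQH ** X2 GenF ** X3 GenQHinv + X1 GenQH ** X2 GenQH ** X3 GenF)
      (X1 GenQH ** X2 GenQH ** X3 GenQH) (X1 GenQHinv ** X2 GenQHinv ** X3 GenQHinv)"
  shows "\<exists>c g1 g2 g3. three_strings q s d1 d2 d3 c g1 g2 g3
    (X1 GenE) (X1 GenF) (X1 GenQH) (X1 GenQHinv) (X2 GenE) (X2 GenF) (X2 GenQH) (X2 GenQHinv) (X3 GenE) (X3 GenF) (X3 GenQH) (X3 GenQHinv)"
proof -
  obtain g1 L1 R1 where c1: "spin_coords q s d1 \<pi>1 g1 L1 R1" using spin_coords_exist[OF sp(1)] by blast
  obtain g2 L2 R2 where c2: "spin_coords q s d2 \<pi>2 g2 L2 R2" using spin_coords_exist[OF sp(2)] by blast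
  obtain g3 L3 R3 where c3: "spin_coords q s d3 \<pi>3 g3 L3 R3" using spin_coords_exist[OF sp(3)] by blast
  note c1 = c1[unfolded spin_coords_def good_g_def] and c2 = c2[unfolded spin_coords_def good_g_def] and c3 = c3[unfolded spin_coords_def good_g_def]
  let ?c = "triple_coord L1 L2 L3"
  have outer: "lfun l (\<chi> a. r * w a) = r * lfun l (\<chi> a. w a)" for l r w
    unfolding lfun_def sum_distrib_left by (intro sum.cong) (simp_all add: mult_ac)
  have plus: "lfun l (\<chi> a. u a + w a) = lfun l (\<chi> a. u a) + lfun l (\<chi> a. w a)" for l u w by (simp add: lfun_def ring_distribs sum.distrib)
  have zero: "lfun l (\<chi> a. 0) = 0" for l by (simp add: lfun_def)
  have "three_strings q s d1 d2 d3 ?c g1 g2 g3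
    (X1 GenE) (X1 GenF) (X1 GenQH) (X1 GenQHinv) (X2 GenE) (X2 GenF) (X2 GenQH) (X2 GenQHinv) (X3 GenE) (X3 GenF) (X3 GenQH) (X3 GenQHinv)"
  proof (unfold_locales)
    fix v :: "complex^('n1 \<times> 'n2 \<times> 'n3)"
    assume z: "\<And>i j k. ?c v i j k = 0"
    have "(\<chi> a. lfun (L2 j) (\<chi> b. lfun (L3 k) (\<chi> c. v $ (a, b, c)))) = 0" for j k
      using z c1 unfolding triple_coord_def by blast
    then have "lfun (L2 j) (\<chi> b. lfun (L3 k) (\<chi> c. v $ (a, b, c))) = 0" for j k a by (simp add: vec_eq_iff)
    then have "(\<chi> b. lfun (L3 k) (\<chi> c. v $ (a, b, c))) = 0" for k a using c2 by blast
    then have "lfun (L3 k) (\<chi> c. v $ (a, b, c)) = 0" for k a b by (simp add: vec_eq_iff)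
    then have "(\<chi> c. v $ (a, b, c)) = 0" for a b using c3 by blast
    then show "v = 0" by (auto simp: vec_eq_iff)
  next
    fix i j k assume ijk: "i \<le> d1" "j \<le> d2" "k \<le> d3"
    let ?v = "\<chi> p. R1 i $ fst p * (R2 j $ fst (snd p) * R3 k $ snd (snd p))"
    have "?c ?v i' j' k' = lfun (L1 i') (R1 i) * (lfun (L2 j') (R2 j) * lfun (L3 k') (R3 k))" for i' j' k'
    proof -
      have e: "(\<chi> c. w $ c) = w" for w :: "complex^'z" by (simp add: vec_eq_iff)
      have o: "lfun l (\<chi> a. w a * r) = lfun l (\<chi> a. w a) * r" for l w r
        unfolding lfun_def sum_distrib_right by (intro sum.cong) (simp_all add: mult_ac)
      show ?thesis unfolding triple_coord_def by (simp add: outer o e)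
    qed
    then have "\<forall>i' j' k'. ?c ?v i' j' k' = (if i' = i \<and> j' = j \<and> k' = k then 1 else 0)"
      using ijk c1 c2 c3 by auto
    then show "\<exists>v. \<forall>i' j' k'. ?c v i' j' k' = (if i' = i \<and> j' = j \<and> k' = k then 1 else 0)" by blast
  next
    fix v i j k
    assume "\<not> (i \<le> d1 \<and> j \<le> d2 \<and> k \<le> d3)"
    then show "?c v i j k = 0" using c1 c2 c3 by (auto simp: triple_coord_def zero not_le)
  qed (use c1 c2 c3 uq in \<open>simp_all add: X1_def X2_def X3_def triple_coord_slots\<close>, simp_all add: triple_coord_def outer plus)
  then show ?thesis by blast
qed

section \<open>Scalar Casimirs of the slots, and the Askey--Wilson relations\<close>

context three_strings
begin

text \<open>On coordinate i the term \<open>F E\<close> contributes \<open>lam^2\<close> times the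
  square of \<open>g1 i\<close>; by \<open>q_int_mult\<close> its dependence on i is exactly
  cancelled by the two diagonal terms.\<close>

lemma cas_slot1: "cas q E1 F1 K1 L1 = mat_smult (chi q d1) (mat 1)"
  and cas_slot2: "cas q E2 F2 K2 L2 = mat_smult (chi q d2) (mat 1)"
  and cas_slot3: "cas q E3 F3 K3 L3 = mat_smult (chi q d3) (mat 1)"
proof -
  have id: "lam^2 * g^2 + q * (s powi (int d - 2 * int k) * s powi (int d - 2 * int k))
      + inverse q * (s powi (2 * int k - int d) * s powi (2 * int k - int d)) = chi q (int d)"
    if "g^2 = q_int q (int k) * q_int q (int d + 1 - int k)" for g d k
  proof -
    have "q * q powi (int d - 2 * int k) = q powi (int d + 1 - 2 * int k)"
    proof -
      have "q powi (1 + (int d - 2 * int k)) = q powi 1 * q powi (int d - 2 * int k)"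
        by (rule power_int_add) (simp add: q_nz)
      moreover have "1 + (int d - 2 * int k) = int d + 1 - 2 * int k" by simp
      ultimately show ?thesis by (simp only: power_int_1_right)
    qed
    moreover have "inverse q * q powi (2 * int k - int d) = q powi (2 * int k - int d - 1)"
    proof -
      have "q powi (- 1 + (2 * int k - int d)) = q powi (- 1) * q powi (2 * int k - int d)"
        by (rule power_int_add) (simp add: q_nz)
      moreover have "- 1 + (2 * int k - int d) = 2 * int k - int d - 1" by simp
      ultimately show ?thesis by (simp only: power_int_minus power_int_1_right)
    qed
    moreover have "s powi (2 * int k - int d) * s powi (2 * int k - int d) = q powi (2 * int k - int d)" by (rule s_powi_square)
    ultimately show ?thesis unfolding that q_int_mult s_powi_square by simp
  qed
  \<comment> \<open>The squares of the \<open>g\<close> are known only within range; outside it the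
    coordinates themselves vanish.\<close>
  have out: "(i \<le> d1 \<and> j \<le> d2 \<and> k \<le> d3 \<Longrightarrow> a = b) \<Longrightarrow> a * c v i j k = b * c v i j k" for a b v i j k
    using c_out[of i j k v] by (cases "i \<le> d1 \<and> j \<le> d2 \<and> k \<le> d3") auto
  have cc: "x * c v i j k + y * c v i j k + z * c v i j k = (x + y + z) * c v i j k" for x y z v i j k
    by (simp add: ring_distribs)
  have e: "g1 i * (g1 (Suc (i - 1)) * c v (Suc (i - 1)) j k) = g1 i ^ 2 * c v i j k"
    "g2 j * (g2 (Suc (j - 1)) * c v i (Suc (j - 1)) k) = g2 j ^ 2 * c v i j k"
    "g3 k * (g3 (Suc (k - 1)) * c v i j (Suc (k - 1))) = g3 k ^ 2 * c v i j k" for v i j k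
    using g1(1) g2(1) g3(1) by (cases i; cases j; cases k; simp add: power2_eq_square)+
  show "cas q E1 F1 K1 L1 = mat_smult (chi q d1) (mat 1)"
    by (intro matrix_eqI c_eqI, unfold cas_def mv_simps matrix_vector_mul_lid c_lin cF1 cE1 cK1 cL1 e(1), unfold mult.assoc[symmetric] cc, rule out)
      (unfold mult.assoc, rule id, simp add: g1)
  show "cas q E2 F2 K2 L2 = mat_smult (chi q d2) (mat 1)"
    by (intro matrix_eqI c_eqI, unfold cas_def mv_simps matrix_vector_mul_lid c_lin cF2 cE2 cK2 cL2 e(2), unfold mult.assoc[symmetric] cc, rule out)
      (unfold mult.assoc, rule id, simp add: g2)
  show "cas q E3 F3 K3 L3 = mat_smult (chi q d3) (mat 1)"
    by (intro matrix_eqI c_eqI, unfold cas_def mv_simps matrix_vector_mul_lid c_lin cF3 cE3 cK3 cL3 e(3), unfold mult.assoc[symmetric] cc, rule out)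
      (unfold mult.assoc, rule id, simp add: g3)
qed

text \<open>The only possible image of the generator D, solved from the third defining
  relation.\<close>

definition "Dmat = mat_smult (inverse (q + inverse q)) (mat_smult (chi q d1 * chi q d3) (mat 1) + mat_smult (chi q d2) C)
  - mat_smult (inverse (q^2 - inverse (q^2))) (mat_smult q (A ** B) - mat_smult (inverse q) (B ** A))"

lemma Dmat_relations:
  "A + mat_smult (inverse (q^2 - inverse (q^2))) (mat_smult q (B ** Dmat) - mat_smult (inverse q) (Dmat ** B))
    = mat_smult (inverse (q + inverse q)) (mat_smult (chi q d1 * chi q d2) (mat 1) + mat_smult (chi q d3) C)" (is ?A)
  "B + mat_smult (inverse (q^2 - inverse (q^2))) (mat_smult q (Dmat ** A) - mat_smult (inverse q) (A ** Dmat))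
    = mat_smult (inverse (q + inverse q)) (mat_smult (chi q d2 * chi q d3) (mat 1) + mat_smult (chi q d1) C)" (is ?B)
proof -
  define p where "p = inverse q"
  define u w where "u = inverse (q^2 - p^2)" and "w = inverse (q + p)"
  have qp: "q * p = 1" "q powi (- 1) = p" using q_nz by (simp_all add: p_def)
  have inv: "inverse q = p" "inverse (q^2) = p^2" by (simp_all add: p_def power_inverse)
  have nz: "q - p \<noteq> 0" "q + p \<noteq> 0"
  proof -
    show "q - p \<noteq> 0" using q_diff_nz by (simp add: p_def)
    show "q + p \<noteq> 0"
    proof
      assume "q + p = 0"
      then have "q * q = - 1" using q_nz by (simp add: p_def field_simps eq_neg_iff_add_eq_0)
      then have "q ^ 4 = 1" by (simp add: power4_eq_xxxx mult.assoc[symmetric]) 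
      then show False using q4_ne_1 by simp
    qed
  qed
  have fac: "q^2 - p^2 = (q - p) * (q + p)" by (simp add: power2_eq_square algebra_simps)
  have u: "u = 1 / ((q - p) * (q + p))" and w: "w = 1 / (q + p)" by (simp_all add: u_def w_def fac inverse_eq_divide)
  have BC: "B *v (C *v v) = C *v (B *v v)" and AC: "A *v (C *v v) = C *v (A *v v)" for v
    using C_commute[OF B_commutant] C_commute[OF A_commutant] by simp_all
  have e: "u * (q - p) * (q + p) = 1" and wu: "w = u * (q - p)"
    unfolding u w using nz by simp_all
  \<comment> \<open>The elimination of D undone for scalars and then used componentwise: for the
    first relation \<open>x\<close>, \<open>y\<close>, \<open>z\<close> stand for the words BAB, BBA
    and ABB applied to a vector, for the second \<open>A\<close> and \<open>B\<close> trade places,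
    with AAB as \<open>z\<close>.\<close>
  have scalar: "a + u * (q * (w * m - u * (q * x - p * y)) - p * (w * m - u * (q * z - p * x))) = w * t"
    if R: "(q^2 - p^2)^2 * a + (q - p)^2 * m - ((q^2 + p^2) * x - y - z) - (q - p)^2 * (q + p) * t = 0" for a m x y z t
  proof -
    have "u^2 * ((q^2 - p^2)^2 * a + (q - p)^2 * m - ((q^2 + p^2) * x - y - z) - (q - p)^2 * (q + p) * t)
      = (u * (q - p) * (q + p))^2 * a + w^2 * m - u^2 * ((q^2 + p^2) * x - y - z) - w * (u * (q - p) * (q + p)) * t"
      unfolding wu fac by (simp add: power2_eq_square algebra_simps)
    also have "\<dots> = a + w^2 * m - u^2 * ((q^2 + p^2) * x - y - z) - w * t" unfolding e by simp
    finally have 1: "a + w^2 * m - u^2 * ((q^2 + p^2) * x - y - z) - w * t = 0" unfolding R by simp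
    have "a + u * (q * (w * m - u * (q * x - p * y)) - p * (w * m - u * (q * z - p * x)))
      = a + w * (u * (q - p)) * m - u^2 * ((q^2 + p^2) * x - (q * p) * y - (q * p) * z)"
      by (simp add: power2_eq_square algebra_simps)
    also have "\<dots> = a + w^2 * m - u^2 * ((q^2 + p^2) * x - y - z)"
      unfolding wu[symmetric] qp(1) by (simp add: power2_eq_square)
    finally show ?thesis using 1 by (simp add: add_diff_eq)
  qed
  have vector: "a + u *s (q *s (w *s m - u *s (q *s x - p *s y)) - p *s (w *s m - u *s (q *s z - p *s x))) = w *s t"
    if R: "(q^2 - p^2)^2 *s a + (q - p)^2 *s m - ((q^2 + p^2) *s x - y - z) - ((q - p)^2 * (q + p)) *s t = 0" for a m x y z t :: "complex^'N"
  proof -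
    have "(q^2 - p^2)^2 * a $ i + (q - p)^2 * m $ i - ((q^2 + p^2) * x $ i - y $ i - z $ i) - (q - p)^2 * (q + p) * t $ i = 0" for i
      using arg_cong[OF R, of "\<lambda>r. r $ i"] by simp
    from scalar[OF this] show ?thesis by (simp add: vec_eq_iff)
  qed
  have rA: "relA *v v = 0" and rB: "relB *v v = 0" for v by (simp_all add: relA_zero relB_zero)
  show ?A
  proof (rule matrix_eqI)
    fix v
    let ?m = "(chi q d1 * chi q d3) *s (B *v v) + chi q d2 *s (C *v (B *v v))"
    have "A *v v + u *s (q *s (w *s ?m - u *s (q *s (B *v (A *v (B *v v))) - p *s (B *v (B *v (A *v v)))))
        - p *s (w *s ?m - u *s (q *s (A *v (B *v (B *v v))) - p *s (B *v (A *v (B *v v))))))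
      = w *s ((chi q d1 * chi q d2) *s v + chi q d3 *s (C *v v))"
      using rA[of v] unfolding relA_def qp(2)
      by (intro vector) (simp add: mv_simps vector_smult_assoc vector_add_ldistrib)
    then show "(A + mat_smult (inverse (q^2 - inverse (q^2))) (mat_smult q (B ** Dmat) - mat_smult (inverse q) (Dmat ** B))) *v v
      = mat_smult (inverse (q + inverse q)) (mat_smult (chi q d1 * chi q d2) (mat 1) + mat_smult (chi q d3) C) *v v"
      unfolding Dmat_def inv u_def[symmetric] w_def[symmetric] by (simp add: mv_simps BC)
  qed
  show ?B
  proof (rule matrix_eqI)
    fix v
    let ?m = "(chi q d1 * chi q d3) *s (A *v v) + chi q d2 *s (C *v (A *v v))"
    have "B *v v + u *s (q *s (w *s ?m - u *s (q *s (A *v (B *v (A *v v))) - p *s (B *v (A *v (A *v v)))))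
        - p *s (w *s ?m - u *s (q *s (A *v (A *v (B *v v))) - p *s (A *v (B *v (A *v v))))))
      = w *s ((chi q d2 * chi q d3) *s v + chi q d1 *s (C *v v))"
      using rB[of v] unfolding relB_def qp(2)
      by (intro vector) (simp add: mv_simps vector_smult_assoc vector_add_ldistrib algebra_simps)
    then show "(B + mat_smult (inverse (q^2 - inverse (q^2))) (mat_smult q (Dmat ** A) - mat_smult (inverse q) (A ** Dmat))) *v v
      = mat_smult (inverse (q + inverse q)) (mat_smult (chi q d2 * chi q d3) (mat 1) + mat_smult (chi q d1) C) *v v"
      unfolding Dmat_def inv u_def[symmetric] w_def[symmetric] by (simp add: mv_simps AC)
  qed
qed

end

section \<open>The centralizer and the Askey--Wilson algebra\<close>

lemma uq_triple_comult_values: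
  assumes q: "q \<noteq> 0" and h: "h \<in> alg_hom (Uq2 q) End_alg"
  shows "uq_triple q (h (comult_gen q GenE)) (h (comult_gen q GenF)) (h (comult_gen q GenQH)) (h (comult_gen q GenQHinv))"
    and "h (comult q (casimir q)) = cas q (h (comult_gen q GenE)) (h (comult_gen q GenF)) (h (comult_gen q GenQH)) (h (comult_gen q GenQHinv))"
  using uq_triple_hom[OF alg_hom_comp[OF comult_hom[OF q] h]] casimir_hom[OF alg_hom_comp[OF comult_hom[OF q] h]]
  by (simp_all add: comult_elt[OF q])

locale three_spin_reps = generic_q q s + three_spins q \<pi>1 \<pi>2 \<pi>3
  for q s :: complex and \<pi>1 :: "uq \<Rightarrow> complex^'n1^'n1" and \<pi>2 :: "uq \<Rightarrow> complex^'n2^'n2" and \<pi>3 :: "uq \<Rightarrow> complex^'n3^'n3" +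
  fixes d1 d2 d3 :: nat
  assumes spin1: "spin_rep q s d1 \<pi>1" and spin2: "spin_rep q s d2 \<pi>2" and spin3: "spin_rep q s d3 \<pi>3"
begin

lemma hom1: "\<pi>1 \<in> alg_hom (Uq q) End_alg" and hom2: "\<pi>2 \<in> alg_hom (Uq q) End_alg" and hom3: "\<pi>3 \<in> alg_hom (Uq q) End_alg"
  using spin1 spin2 spin3 by (simp_all add: spin_rep_def)

lemmas hom23 = tensor_rep_hom(1)[OF calg_Uq calg_Uq hom2 hom3, folded Uq2_def]

lemma val23: "b \<in> carrier (Uq q) \<Longrightarrow> c \<in> carrier (Uq q) \<Longrightarrow> tensor_rep \<pi>2 \<pi>3 (tens2 q b c) = kronecker (\<pi>2 b) (\<pi>3 c)"
  unfolding tens2_def by (rule tensor_rep_hom(2)[OF calg_Uq calg_Uq hom2 hom3])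

lemma hom123: "\<pi>123 \<in> alg_hom (Uq3 q) End_alg"
  unfolding \<pi>123_def Uq3_def by (rule tensor_rep_hom(1)[OF calg_Uq calg_Uq2 hom1 hom23])

lemma val123: "a \<in> carrier (Uq q) \<Longrightarrow> t \<in> carrier (Uq2 q) \<Longrightarrow> \<pi>123 (tens (Uq q) (Uq2 q) a t) = kronecker (\<pi>1 a) (tensor_rep \<pi>2 \<pi>3 t)"
  unfolding \<pi>123_def by (rule tensor_rep_hom(2)[OF calg_Uq calg_Uq2 hom1 hom23])

lemma uq_one: "\<one>\<^bsub>Uq q\<^esub> \<in> carrier (Uq q)"
proof -
  interpret U: calg "Uq q" by (rule calg_Uq)
  show ?thesis by simp
qed

lemma one_vals: "\<pi>1 \<one>\<^bsub>Uq q\<^esub> = mat 1" "\<pi>2 \<one>\<^bsub>Uq q\<^esub> = mat 1" "\<pi>3 \<one>\<^bsub>Uq q\<^esub> = mat 1"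
  using alg_homD(4)[OF hom1] alg_homD(4)[OF hom2] alg_homD(4)[OF hom3] by (simp_all add: End_alg_simps)

lemma val_tens3:
  "a \<in> carrier (Uq q) \<Longrightarrow> b \<in> carrier (Uq q) \<Longrightarrow> c \<in> carrier (Uq q) \<Longrightarrow>
    \<pi>123 (tens (Uq q) (Uq2 q) a (tens2 q b c)) = kronecker (\<pi>1 a) (kronecker (\<pi>2 b) (\<pi>3 c))"
  using val123[OF _ bihomD(1)[OF bihom_tens2]] val23 by simp

definition "X1 g = (slot1 (\<pi>1 (uq_elt q g)) :: complex^('n1 \<times> 'n2 \<times> 'n3)^('n1 \<times> 'n2 \<times> 'n3))"
definition "X2 g = (slot2 (\<pi>2 (uq_elt q g)) :: complex^('n1 \<times> 'n2 \<times> 'n3)^('n1 \<times> 'n2 \<times> 'n3))"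
definition "X3 g = (slot3 (\<pi>3 (uq_elt q g)) :: complex^('n1 \<times> 'n2 \<times> 'n3)^('n1 \<times> 'n2 \<times> 'n3))"

lemma X_mult:
  "X1 g ** X2 h = kronecker (\<pi>1 (uq_elt q g)) (kronecker (\<pi>2 (uq_elt q h)) (mat 1))"
  "X2 g ** X3 h = kronecker (mat 1) (kronecker (\<pi>2 (uq_elt q g)) (\<pi>3 (uq_elt q h)))"
  "X1 g ** X2 h ** X3 k = kronecker (\<pi>1 (uq_elt q g)) (kronecker (\<pi>2 (uq_elt q h)) (\<pi>3 (uq_elt q k)))"
  by (simp_all add: X1_def X2_def X3_def kronecker_mult)

definition "h12 t = \<pi>123 (first_two q t)"
definition "h23 t = \<pi>123 (tens (Uq q) (Uq2 q) \<one>\<^bsub>Uq q\<^esub> t)"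

lemma h12_hom: "h12 \<in> alg_hom (Uq2 q) End_alg"
  using alg_hom_comp[OF first_two_hom hom123] by (simp add: h12_def[abs_def] comp_def)

lemma h23_hom: "h23 \<in> alg_hom (Uq2 q) End_alg"
  using alg_hom_comp[OF bihom_left_unit_hom[OF bihom_tens3 calg_Uq] hom123] by (simp add: h23_def[abs_def] comp_def)

lemma h12_tens: "a \<in> carrier (Uq q) \<Longrightarrow> b \<in> carrier (Uq q) \<Longrightarrow> h12 (tens2 q a b) = kronecker (\<pi>1 a) (kronecker (\<pi>2 b) (mat 1))"
  by (simp add: h12_def first_two_tens val_tens3 uq_one one_vals)

lemma h23_tens: "a \<in> carrier (Uq q) \<Longrightarrow> b \<in> carrier (Uq q) \<Longrightarrow> h23 (tens2 q a b) = kronecker (mat 1) (kronecker (\<pi>2 a) (\<pi>3 b))"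
  by (simp add: h23_def val_tens3 uq_one one_vals)

lemma h_comult:
  assumes "h \<in> alg_hom (Uq2 q) End_alg"
  shows "h (comult_gen q GenE) = h (tens2 q (uq_elt q GenE) (uq_elt q GenQHinv)) + h (tens2 q (uq_elt q GenQH) (uq_elt q GenE))"
    "h (comult_gen q GenF) = h (tens2 q (uq_elt q GenF) (uq_elt q GenQHinv)) + h (tens2 q (uq_elt q GenQH) (uq_elt q GenF))"
    "h (comult_gen q GenQH) = h (tens2 q (uq_elt q GenQH) (uq_elt q GenQH))"
    "h (comult_gen q GenQHinv) = h (tens2 q (uq_elt q GenQHinv) (uq_elt q GenQHinv))"
  unfolding comult_gen_simps
  by (simp_all add: alg_homD(3)[OF assms] bihomD(1)[OF bihom_tens2] uq_elt_closed End_alg_simps)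

lemma h12_comult: "h12 (comult_gen q GenE) = X1 GenE ** X2 GenQHinv + X1 GenQH ** X2 GenE"
    "h12 (comult_gen q GenF) = X1 GenF ** X2 GenQHinv + X1 GenQH ** X2 GenF"
    "h12 (comult_gen q GenQH) = X1 GenQH ** X2 GenQH"
    "h12 (comult_gen q GenQHinv) = X1 GenQHinv ** X2 GenQHinv"
  by (simp_all add: h_comult[OF h12_hom] h12_tens uq_elt_closed X_mult)

lemma h23_comult: "h23 (comult_gen q GenE) = X2 GenE ** X3 GenQHinv + X2 GenQH ** X3 GenE"
    "h23 (comult_gen q GenF) = X2 GenF ** X3 GenQHinv + X2 GenQH ** X3 GenF"
    "h23 (comult_gen q GenQH) = X2 GenQH ** X3 GenQH"
    "h23 (comult_gen q GenQHinv) = X2 GenQHinv ** X3 GenQHinv"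
  by (simp_all add: h_comult[OF h23_hom] h23_tens uq_elt_closed X_mult)

definition "h123 x = \<pi>123 (comult2 q x)"

lemma h123_hom: "h123 \<in> alg_hom (Uq q) End_alg"
  using alg_hom_comp[OF comult2_hom[OF q_nz] hom123] by (simp add: h123_def[abs_def] comp_def)

lemma h123_vals:
  "h123 (uq_elt q GenE) = X1 GenE ** X2 GenQHinv ** X3 GenQHinv + X1 GenQH ** X2 GenE ** X3 GenQHinv + X1 GenQH ** X2 GenQH ** X3 GenE"
  "h123 (uq_elt q GenF) = X1 GenF ** X2 GenQHinv ** X3 GenQHinv + X1 GenQH ** X2 GenF ** X3 GenQHinv + X1 GenQH ** X2 GenQH ** X3 GenF"
  "h123 (uq_elt q GenQH) = X1 GenQH ** X2 GenQH ** X3 GenQH"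
  "h123 (uq_elt q GenQHinv) = X1 GenQHinv ** X2 GenQHinv ** X3 GenQHinv"
proof -
  define J where "J = (\<lambda>t. \<pi>123 (tensor_lift (Uq3 q) (\<lambda>a b. tens (Uq q) (Uq2 q) a (comult q b)) t))"
  have J: "J \<in> alg_hom (Uq2 q) End_alg"
    using alg_hom_comp[OF tensor_lift_hom[OF calg_Uq calg_Uq calg_Uq3 bihom_comult2[OF q_nz], folded Uq2_def] hom123]
    by (simp add: J_def comp_def)
  have h: "h123 (uq_elt q g) = J (comult_gen q g)" for g
    by (simp add: h123_def J_def comult2_def comult_elt[OF q_nz])
  have Jt: "J (tens2 q (uq_elt q a) (uq_elt q b)) = kronecker (\<pi>1 (uq_elt q a)) (tensor_rep \<pi>2 \<pi>3 (comult_gen q b))" for a b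
    unfolding J_def comult2_tens[OF q_nz uq_elt_closed uq_elt_closed] comult_elt[OF q_nz]
    by (rule val123[OF uq_elt_closed comult_gen_closed])
  have kadd: "kronecker M (N + P) = kronecker M N + kronecker M P" for M :: "complex^'n1^'n1" and N P :: "complex^('n2 \<times> 'n3)^('n2 \<times> 'n3)"
    by (simp add: kronecker_def vec_eq_iff algebra_simps)
  show "h123 (uq_elt q GenE) = X1 GenE ** X2 GenQHinv ** X3 GenQHinv + X1 GenQH ** X2 GenE ** X3 GenQHinv + X1 GenQH ** X2 GenQH ** X3 GenE"
    "h123 (uq_elt q GenF) = X1 GenF ** X2 GenQHinv ** X3 GenQHinv + X1 GenQH ** X2 GenF ** X3 GenQHinv + X1 GenQH ** X2 GenQH ** X3 GenF"
    "h123 (uq_elt q GenQH) = X1 GenQH ** X2 GenQH ** X3 GenQH"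
    "h123 (uq_elt q GenQHinv) = X1 GenQHinv ** X2 GenQHinv ** X3 GenQHinv"
    unfolding h h_comult[OF J] Jt h_comult[OF hom23] by (simp_all add: val23 uq_elt_closed X1_def X2_def X3_def kronecker_mult kadd add.assoc)
qed

lemma C12_eq: "C12 = cas q (X1 GenE ** X2 GenQHinv + X1 GenQH ** X2 GenE) (X1 GenF ** X2 GenQHinv + X1 GenQH ** X2 GenF) (X1 GenQH ** X2 GenQH) (X1 GenQHinv ** X2 GenQHinv)"
  unfolding C12_def tensor_assoc_unit[OF alg_homD(1)[OF comult_hom[OF q_nz] casimir_closed]]
  using uq_triple_comult_values(2)[OF q_nz h12_hom] by (simp only: h12_def[symmetric] h12_comult)

lemma C23_eq: "C23 = cas q (X2 GenE ** X3 GenQHinv + X2 GenQH ** X3 GenE) (X2 GenF ** X3 GenQHinv + X2 GenQH ** X3 GenF) (X2 GenQH ** X3 GenQH) (X2 GenQHinv ** X3 GenQHinv)"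
  unfolding C23_def using uq_triple_comult_values(2)[OF q_nz h23_hom] by (simp only: h23_def[symmetric] h23_comult)

lemma C123_eq: "C123 = cas q (h123 (uq_elt q GenE)) (h123 (uq_elt q GenF)) (h123 (uq_elt q GenQH)) (h123 (uq_elt q GenQHinv))"
  unfolding C123_def using casimir_hom[OF h123_hom] by (simp only: h123_def)

lemma slot_homs: "(\<lambda>x. slot1 (\<pi>1 x)) \<in> alg_hom (Uq q) End_alg" "(\<lambda>x. slot2 (\<pi>2 x)) \<in> alg_hom (Uq q) End_alg" "(\<lambda>x. slot3 (\<pi>3 x)) \<in> alg_hom (Uq q) End_alg"
proof -
  note k = bihom_right_unit_hom[OF bihom_kronecker calg_End] and k' = bihom_left_unit_hom[OF bihom_kronecker calg_End]
  have 1: "(\<lambda>M. kronecker M (mat 1)) \<in> alg_hom End_alg End_alg" "kronecker (mat 1) \<in> alg_hom End_alg End_alg"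
    using k k' by (simp_all add: End_alg_simps)
  show "(\<lambda>x. slot1 (\<pi>1 x)) \<in> alg_hom (Uq q) End_alg"
    using alg_hom_comp[OF hom1 1(1)] by (simp add: comp_def kronecker_one)
  show "(\<lambda>x. slot2 (\<pi>2 x)) \<in> alg_hom (Uq q) End_alg"
    using alg_hom_comp[OF alg_hom_comp[OF hom2 k] k'] by (simp add: comp_def End_alg_simps)
  show "(\<lambda>x. slot3 (\<pi>3 x)) \<in> alg_hom (Uq q) End_alg"
    using alg_hom_comp[OF alg_hom_comp[OF hom3 k'] k'] by (simp add: comp_def End_alg_simps)
qed

lemma C1_eq: "C1 = cas q (X1 GenE) (X1 GenF) (X1 GenQH) (X1 GenQHinv)"
  and C2_eq: "C2 = cas q (X2 GenE) (X2 GenF) (X2 GenQH) (X2 GenQHinv)"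
  and C3_eq: "C3 = cas q (X3 GenE) (X3 GenF) (X3 GenQH) (X3 GenQHinv)"
  unfolding C1_def C2_def C3_def
  using casimir_hom[OF slot_homs(1)] casimir_hom[OF slot_homs(2)] casimir_hom[OF slot_homs(3)]
  by (simp_all add: val_tens3 uq_one casimir_closed one_vals X1_def X2_def X3_def)

lemma three_strings_X: "\<exists>c g1 g2 g3. three_strings q s d1 d2 d3 c g1 g2 g3
    (X1 GenE) (X1 GenF) (X1 GenQH) (X1 GenQHinv) (X2 GenE) (X2 GenF) (X2 GenQH) (X2 GenQHinv) (X3 GenE) (X3 GenF) (X3 GenQH) (X3 GenQHinv)"
  using three_strings_exist[OF spin1 spin2 spin3, folded X1_def X2_def X3_def]
    uq_triple_comult_values(1)[OF q_nz h12_hom, unfolded h12_comult] uq_triple_comult_values(1)[OF q_nz h23_hom, unfolded h23_comult]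
    uq_triple_hom[OF h123_hom, unfolded h123_vals] by blast

text \<open>The matrices that commute with a given \<open>m\<close> form an algebra, so it is enough
  that they include the images of the generators.\<close>

lemma centralizer_carrier:
  "carrier centralizer = {m. commute m (h123 (uq_elt q GenE)) \<and> commute m (h123 (uq_elt q GenF)) \<and> commute m (h123 (uq_elt q GenQH)) \<and> commute m (h123 (uq_elt q GenQHinv))}"
proof -
  have "carrier centralizer = {m. \<forall>x\<in>carrier (Uq q). commute m (h123 x)}"
    by (auto simp: centralizer_def commute_def h123_def)
  also have "\<dots> = {m. \<forall>g. commute m (h123 (uq_elt q g))}"
  proof (intro equalityI subsetI CollectI ballI)
    fix m x assume m: "m \<in> {m. \<forall>g. commute m (h123 (uq_elt q g))}" and x: "x \<in> carrier (Uq q)"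
    have "h123 x \<in> {M. commute m M}"
      by (rule uq_hom_range[OF h123_hom x]) (use m in \<open>auto intro: commute_intros\<close>)
    then show "commute m (h123 x)" by simp
  qed (use uq_elt_closed in blast)
  also have "\<dots> = {m. commute m (h123 (uq_elt q GenE)) \<and> commute m (h123 (uq_elt q GenF)) \<and> commute m (h123 (uq_elt q GenQH)) \<and> commute m (h123 (uq_elt q GenQHinv))}"
    by (auto elim!: uq_gen.exhaust) (metis uq_gen.exhaust)
  finally show ?thesis .
qed

end

lemma aw_rels_carrier: "aw_rels q \<subseteq> carrier free_algebra \<times> carrier free_algebra" by simp

lemma calg_AW3: "calg (AW3 q)"
  unfolding AW3_def by (rule calg_quot_algebra[OF calg_free_algebra aw_rels_carrier])

lemma aw_class_hom: "quot_class free_algebra (aw_rels q) \<in> alg_hom free_algebra (AW3 q)"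
  unfolding AW3_def by (rule quot_class_alg_hom[OF calg_free_algebra aw_rels_carrier])

lemma aw_elt_closed: "aw_elt q g \<in> carrier (AW3 q)"
  unfolding aw_elt_def by (rule alg_homD(1)[OF aw_class_hom]) simp

context three_spin_reps
begin

text \<open>The commutant relations give the homomorphism, the third relation pins down its value on
  D and hence uniqueness, and \<open>commutant_subset_gen_alg\<close> gives surjectivity.\<close>

theorem aw_hom_unique_surjective:
  "\<exists>\<phi>. is_aw_hom \<phi> \<and> (\<forall>\<psi>. is_aw_hom \<psi> \<longrightarrow> (\<forall>x\<in>carrier (AW3 q). \<psi> x = \<phi> x)) \<and>
    \<phi> ` carrier (AW3 q) = carrier centralizer"
proof -
  obtain c g1 g2 g3 where T: "three_strings q s d1 d2 d3 c g1 g2 g3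
    (X1 GenE) (X1 GenF) (X1 GenQH) (X1 GenQHinv) (X2 GenE) (X2 GenF) (X2 GenQH) (X2 GenQHinv) (X3 GenE) (X3 GenF) (X3 GenQH) (X3 GenQHinv)"
    using three_strings_X by blast
  interpret T: three_strings q s d1 d2 d3 c g1 g2 g3
    "X1 GenE" "X1 GenF" "X1 GenQH" "X1 GenQHinv" "X2 GenE" "X2 GenF" "X2 GenQH" "X2 GenQHinv" "X3 GenE" "X3 GenF" "X3 GenQH" "X3 GenQHinv"
    by (rule T)
  have A: "C12 = T.A" unfolding C12_eq T.A_def T.E12_def T.F12_def T.K12_def T.L12_def ..
  have B: "C23 = T.B" unfolding C23_eq T.B_def T.E23_def T.F23_def T.K23_def T.L23_def ..
  have C: "C123 = T.C" unfolding C123_eq h123_vals T.C_def T.E_def T.F_def T.K_def T.L_def ..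
  have C1: "C1 = mat_smult (chi q d1) (mat 1)" "C2 = mat_smult (chi q d2) (mat 1)" "C3 = mat_smult (chi q d3) (mat 1)"
    unfolding C1_eq C2_eq C3_eq by (rule T.cas_slot1 T.cas_slot2 T.cas_slot3)+
  have cc: "carrier centralizer = T.commutant"
    unfolding centralizer_carrier h123_vals T.commutant_def T.E_def T.F_def T.K_def T.L_def ..
  then have ce: "centralizer = End_alg\<lparr>carrier := T.commutant\<rparr>" unfolding centralizer_def by simp
  have Z: "calg centralizer"
    unfolding ce by (rule calg_subalgebra_End) (auto intro: T.commutant_1 T.commutant_add T.commutant_mult T.commutant_smc)
  have simps: "mult centralizer = (**)" "\<one>\<^bsub>centralizer\<^esub> = mat 1" "add centralizer = (+)" "module.smult centralizer = mat_smult"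
    by (simp_all add: ce End_alg_simps)
  have minus: "x \<ominus>\<^bsub>centralizer\<^esub> y = x - y" if "x \<in> T.commutant" "y \<in> T.commutant" for x y
    using End_minus[OF Z[unfolded ce] that] by (simp only: ce)
  let ?u = "inverse (q^2 - inverse (q^2))" and ?v = "inverse (q + inverse q)"
  have push: "H (x \<otimes>\<^bsub>free_algebra\<^esub> y) = H x ** H y" "H (x \<oplus>\<^bsub>free_algebra\<^esub> y) = H x + H y"
      "H (a \<odot>\<^bsub>free_algebra\<^esub> x) = mat_smult a (H x)" "H (q_comm q free_algebra x y) = mat_smult q (H x ** H y) - mat_smult (inverse q) (H y ** H x)"
    if H: "H \<in> alg_hom free_algebra centralizer" for H :: "(aw_gen list \<Rightarrow>\<^sub>0 complex) \<Rightarrow> _" and x y a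
  proof -
    show m: "H (x \<otimes>\<^bsub>free_algebra\<^esub> y) = H x ** H y" for x y using alg_homD(2)[OF H, of x y] by (simp add: simps)
    show "H (x \<oplus>\<^bsub>free_algebra\<^esub> y) = H x + H y" using alg_homD(3)[OF H, of x y] by (simp add: simps)
    show s: "H (a \<odot>\<^bsub>free_algebra\<^esub> x) = mat_smult a (H x)" for a x using alg_homD(5)[OF H, of x a] by (simp add: simps)
    have cl: "H z \<in> T.commutant" for z using alg_homD(1)[OF H, of z] by (simp add: cc)
    have "H (z \<ominus>\<^bsub>free_algebra\<^esub> w) = H z - H w" for z w
      using alg_hom_minus[OF H calg_free_algebra Z, of z w] minus[OF cl cl] by simp
    then show "H (q_comm q free_algebra x y) = mat_smult q (H x ** H y) - mat_smult (inverse q) (H y ** H x)"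
      by (simp add: q_comm_def m s)
  qed
  define \<phi>0 where "\<phi>0 g = (case g of GenA \<Rightarrow> T.A | GenB \<Rightarrow> T.B | GenD \<Rightarrow> T.Dmat
      | Alpha1 \<Rightarrow> mat_smult (chi q d1) (mat 1) | Alpha2 \<Rightarrow> mat_smult (chi q d2) (mat 1) | Alpha3 \<Rightarrow> mat_smult (chi q d3) (mat 1) | GenK \<Rightarrow> T.C)" for g
  have D_commutant: "T.Dmat \<in> T.commutant" unfolding T.Dmat_def by (intro T.commutant_intros)
  have \<phi>0: "\<phi>0 g \<in> carrier centralizer" for g
    unfolding cc by (cases g) (simp_all add: \<phi>0_def T.A_commutant T.B_commutant T.C_commutant T.commutant_smc T.commutant_1 D_commutant)
  have \<phi>0s: "\<phi>0 GenA = T.A" "\<phi>0 GenB = T.B" "\<phi>0 GenD = T.Dmat" "\<phi>0 Alpha1 = mat_smult (chi q d1) (mat 1)"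
    "\<phi>0 Alpha2 = mat_smult (chi q d2) (mat 1)" "\<phi>0 Alpha3 = mat_smult (chi q d3) (mat 1)" "\<phi>0 GenK = T.C"
    by (simp_all add: \<phi>0_def)
  let ?h = "free_eval centralizer \<phi>0"
  have h: "?h \<in> alg_hom free_algebra centralizer" by (rule free_eval_alg_hom[OF Z \<phi>0])
  have hg: "?h (gen g) = \<phi>0 g" for g by (rule free_eval_gen[OF Z \<phi>0])
  have smul: "mat_smult a (mat 1) ** M = mat_smult a M" "M ** mat_smult a (mat 1) = mat_smult a M" "mat_smult a (mat_smult b M) = mat_smult (a * b) M"
    for a b and M :: "complex^('n1 \<times> 'n2 \<times> 'n3)^('n1 \<times> 'n2 \<times> 'n3)"
    by (auto intro!: matrix_eqI simp: mv_simps vector_smult_assoc)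
  have D_rel: "T.Dmat + mat_smult ?u (mat_smult q (T.A ** T.B) - mat_smult (inverse q) (T.B ** T.A))
      = mat_smult ?v (mat_smult (chi q d1 * chi q d3) (mat 1) + mat_smult (chi q d2) T.C)"
    by (simp add: T.Dmat_def)
  have rels: "?h l = ?h r" if lr: "(l, r) \<in> aw_rels q" for l r
  proof -
    consider (central) z g where "z \<in> {gen Alpha1, gen Alpha2, gen Alpha3, gen GenK}" "l = z \<otimes>\<^bsub>free_algebra\<^esub> gen g" "r = gen g \<otimes>\<^bsub>free_algebra\<^esub> z"
      | (A) "l = gen GenA \<oplus>\<^bsub>free_algebra\<^esub> ?u \<odot>\<^bsub>free_algebra\<^esub> q_comm q free_algebra (gen GenB) (gen GenD)"
          "r = ?v \<odot>\<^bsub>free_algebra\<^esub> (gen Alpha1 \<otimes>\<^bsub>free_algebra\<^esub> gen Alpha2 \<oplus>\<^bsub>free_algebra\<^esub> gen Alpha3 \<otimes>\<^bsub>free_algebra\<^esub> gen GenK)"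
      | (B) "l = gen GenB \<oplus>\<^bsub>free_algebra\<^esub> ?u \<odot>\<^bsub>free_algebra\<^esub> q_comm q free_algebra (gen GenD) (gen GenA)"
          "r = ?v \<odot>\<^bsub>free_algebra\<^esub> (gen Alpha2 \<otimes>\<^bsub>free_algebra\<^esub> gen Alpha3 \<oplus>\<^bsub>free_algebra\<^esub> gen Alpha1 \<otimes>\<^bsub>free_algebra\<^esub> gen GenK)"
      | (D) "l = gen GenD \<oplus>\<^bsub>free_algebra\<^esub> ?u \<odot>\<^bsub>free_algebra\<^esub> q_comm q free_algebra (gen GenA) (gen GenB)"
          "r = ?v \<odot>\<^bsub>free_algebra\<^esub> (gen Alpha1 \<otimes>\<^bsub>free_algebra\<^esub> gen Alpha3 \<oplus>\<^bsub>free_algebra\<^esub> gen Alpha2 \<otimes>\<^bsub>free_algebra\<^esub> gen GenK)"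
      using lr unfolding aw_rels_def Let_def by blast
    then show ?thesis
    proof cases
      case central
      \<comment> \<open>Three of the central generators go to scalars; the fourth goes to
        \<open>T.C\<close>, which commutes with the commutant as a polynomial in the coproduct
        images.\<close>
      have "\<phi>0 g \<in> T.commutant" using \<phi>0[of g] by (simp add: cc)
      then have "T.C ** \<phi>0 g = \<phi>0 g ** T.C" using T.C_commute by (intro matrix_eqI) (simp add: mv_simps)
      then show ?thesis using central(1) unfolding central(2,3) push[OF h] by (auto simp: hg \<phi>0s smul)
    next
      case A
      then show ?thesis unfolding A push[OF h] hg \<phi>0s smul using T.Dmat_relations(1)
        by (simp only: mult.commute[of "chi q (int d2)" "chi q (int d1)"])
    next
      case B
      then show ?thesis unfolding B push[OF h] hg \<phi>0s smul using T.Dmat_relations(2)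
        by (simp only: mult.commute[of "chi q (int d3)" "chi q (int d2)"])
    next
      case D
      then show ?thesis unfolding D push[OF h] hg \<phi>0s smul using D_rel
        by (simp only: mult.commute[of "chi q (int d3)" "chi q (int d1)"])
    qed
  qed
  define \<phi> where "\<phi> = presented_lift centralizer \<phi>0"
  have \<phi>: "\<phi> \<in> alg_hom (AW3 q) centralizer" and \<phi>g: "\<phi> (aw_elt q g) = \<phi>0 g" for g
    unfolding \<phi>_def AW3_def aw_elt_def by (rule presented_lift_alg_hom[OF Z \<phi>0 rels], assumption)+
  have "is_aw_hom \<phi>"
    unfolding is_aw_hom_def \<phi>g \<phi>0s A B C C1 using \<phi> by blast
  moreover have "\<psi> x = \<phi> x" if \<psi>: "is_aw_hom \<psi>" and x: "x \<in> carrier (AW3 q)" for \<psi> x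
  proof -
    have \<psi>h: "\<psi> \<in> alg_hom (AW3 q) centralizer" using \<psi> unfolding is_aw_hom_def by blast
    have v: "\<psi> (aw_elt q Alpha1) = \<phi>0 Alpha1" "\<psi> (aw_elt q Alpha2) = \<phi>0 Alpha2" "\<psi> (aw_elt q Alpha3) = \<phi>0 Alpha3"
      "\<psi> (aw_elt q GenA) = \<phi>0 GenA" "\<psi> (aw_elt q GenB) = \<phi>0 GenB" "\<psi> (aw_elt q GenK) = \<phi>0 GenK"
      using \<psi> unfolding is_aw_hom_def \<phi>0s A B C C1 by blast+
    let ?Q = "quot_class free_algebra (aw_rels q)"
    let ?H = "\<psi> \<circ> ?Q"
    have H: "?H \<in> alg_hom free_algebra centralizer" by (rule alg_hom_comp[OF aw_class_hom \<psi>h])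
    have Hg: "?H (gen g) = \<psi> (aw_elt q g)" for g by (simp add: aw_elt_def)
    have "(gen GenD \<oplus>\<^bsub>free_algebra\<^esub> ?u \<odot>\<^bsub>free_algebra\<^esub> q_comm q free_algebra (gen GenA) (gen GenB),
        ?v \<odot>\<^bsub>free_algebra\<^esub> (gen Alpha1 \<otimes>\<^bsub>free_algebra\<^esub> gen Alpha3 \<oplus>\<^bsub>free_algebra\<^esub> gen Alpha2 \<otimes>\<^bsub>free_algebra\<^esub> gen GenK)) \<in> aw_rels q"
      unfolding aw_rels_def Let_def by blast
    from quot_class_rel[OF calg_free_algebra aw_rels_carrier this]
    have "?H (gen GenD \<oplus>\<^bsub>free_algebra\<^esub> ?u \<odot>\<^bsub>free_algebra\<^esub> q_comm q free_algebra (gen GenA) (gen GenB)) =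
       ?H (?v \<odot>\<^bsub>free_algebra\<^esub> (gen Alpha1 \<otimes>\<^bsub>free_algebra\<^esub> gen Alpha3 \<oplus>\<^bsub>free_algebra\<^esub> gen Alpha2 \<otimes>\<^bsub>free_algebra\<^esub> gen GenK))"
      by (simp only: comp_apply)
    then have "\<psi> (aw_elt q GenD) + mat_smult ?u (mat_smult q (T.A ** T.B) - mat_smult (inverse q) (T.B ** T.A))
      = mat_smult ?v (mat_smult (chi q d1 * chi q d3) (mat 1) + mat_smult (chi q d2) T.C)"
      unfolding push[OF H] Hg v \<phi>0s smul by (simp only: mult.commute[of "chi q (int d3)" "chi q (int d1)"])
    \<comment> \<open>The right side agrees with that of \<open>D_rel\<close>, so the value on D is
      forced by the prescribed ones.\<close>
    then have "\<psi> (aw_elt q GenD) = \<phi>0 GenD" unfolding D_rel[symmetric] \<phi>0s by simp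
    with v have "\<psi> (aw_elt q g) = \<phi>0 g" for g by (cases g) simp_all
    then have eq: "\<psi> (?Q (gen g)) = \<phi> (?Q (gen g))" for g using \<phi>g[of g] by (simp add: aw_elt_def)
    show ?thesis
      by (rule alg_hom_presented_unique[OF Z \<psi>h[unfolded AW3_def] \<phi>[unfolded AW3_def] eq x[unfolded AW3_def]])
  qed
  moreover have "\<phi> ` carrier (AW3 q) = carrier centralizer"
  proof
    show "\<phi> ` carrier (AW3 q) \<subseteq> carrier centralizer" using alg_homD(1)[OF \<phi>] by blast
    interpret AW: calg "AW3 q" by (rule calg_AW3)
    \<comment> \<open>The range of a homomorphism is a subalgebra, so containing the three
      generators is enough.\<close>
    have "y \<in> \<phi> ` carrier (AW3 q)" if "y \<in> gen_alg {T.A, T.B, T.C}" for y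
      using that
    proof (induction rule: gen_alg.induct)
      case (base y)
      then have "y \<in> {\<phi> (aw_elt q GenA), \<phi> (aw_elt q GenB), \<phi> (aw_elt q GenK)}" unfolding \<phi>g \<phi>0s .
      then show ?case using aw_elt_closed by blast
    next
      case one
      have "mat 1 = \<phi> \<one>\<^bsub>AW3 q\<^esub>" using alg_homD(4)[OF \<phi>] by (simp add: simps)
      then show ?case using AW.one_closed by blast
    next
      case (add x y)
      then obtain a b where ab: "a \<in> carrier (AW3 q)" "b \<in> carrier (AW3 q)" "x = \<phi> a" "y = \<phi> b" by blast
      have "x + y = \<phi> (a \<oplus>\<^bsub>AW3 q\<^esub> b)" using alg_homD(3)[OF \<phi> ab(1,2)] by (simp add: simps ab)
      then show ?case using AW.a_closed[OF ab(1,2)] by blast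
    next
      case (mult x y)
      then obtain a b where ab: "a \<in> carrier (AW3 q)" "b \<in> carrier (AW3 q)" "x = \<phi> a" "y = \<phi> b" by blast
      have "x ** y = \<phi> (a \<otimes>\<^bsub>AW3 q\<^esub> b)" using alg_homD(2)[OF \<phi> ab(1,2)] by (simp add: simps ab)
      then show ?case using AW.m_closed[OF ab(1,2)] by blast
    next
      case (mat_smult x r)
      then obtain a where a: "a \<in> carrier (AW3 q)" "x = \<phi> a" by blast
      have "mat_smult r x = \<phi> (r \<odot>\<^bsub>AW3 q\<^esub> a)" using alg_homD(5)[OF \<phi> a(1), of r] by (simp add: simps a)
      then show ?case using AW.smult_closed[OF a(1)] by blast
    qed
    then show "carrier centralizer \<subseteq> \<phi> ` carrier (AW3 q)"
      unfolding cc using T.commutant_subset_gen_alg by blast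
  qed
  ultimately show ?thesis by blast
qed

end

theorem proposition4p2:
  fixes q s :: complex
    and d1 d2 d3 :: nat
    and \<pi>1 :: "uq \<Rightarrow> complex^'n1^'n1"
    and \<pi>2 :: "uq \<Rightarrow> complex^'n2^'n2"
    and \<pi>3 :: "uq \<Rightarrow> complex^'n3^'n3"
  assumes "q \<noteq> 0"
    and "\<forall>n>0. q ^ n \<noteq> 1"
    and "s ^ 2 = q"
    and "spin_rep q s d1 \<pi>1"
    and "spin_rep q s d2 \<pi>2"
    and "spin_rep q s d3 \<pi>3"
  shows "\<exists>\<phi>. three_spins.is_aw_hom q \<pi>1 \<pi>2 \<pi>3 \<phi> \<and>
    (\<forall>\<psi>. three_spins.is_aw_hom q \<pi>1 \<pi>2 \<pi>3 \<psi> \<longrightarrow> (\<forall>x\<in>carrier (AW3 q). \<psi> x = \<phi> x)) \<and>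
    \<phi> ` carrier (AW3 q) = carrier (three_spins.centralizer q \<pi>1 \<pi>2 \<pi>3)"
proof -
  interpret three_spin_reps q s \<pi>1 \<pi>2 \<pi>3 d1 d2 d3
    by unfold_locales (use assms in auto)
  show ?thesis by (rule aw_hom_unique_surjective)
qed

end
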